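(* Let $(W,S)$ be a Coxeter system and let $I_\bullet$ be a non-reduced expression. Then $I_\bullet$ can be transformed into a reduced expression by a finite sequence of moves on contiguous subwords, each of which is either a braid relation (in either direction) or the $*$-quadratic relation applied in the length-reducing direction, i.e. replacing a contiguous subword $[J-s+s]=[J,J\setminus\{s\},J]$ ($J$ finitary, $s\in J$) by $[J]$. The braid relations are: (1) (up-up) $[K+s+t]\leftrightharpoons[K+t+s]$ for $s\neq t$ in $S\setminus K$ with $K\cup\{s,t\}$ finitary; (2) (down-down) $[K-s-t]\leftrightharpoons[K-t-s]$ for $K$ finitary and $s\ne t$ in $K$; (3) (switchback) $[K+s-t]\leftrightharpoons[K-u_1+s-u_2+u_1-u_3+u_2-\cdots-u_\delta+u_{\delta-1}]$ for $s\notin K$ with $Ks$ finitary and $t\in Ks$ with $s\ne w_{Ks}tw_{Ks}$, where $(u_i)$ is the rotation sequence of $(K,s,t)$ and $\delta$ the associated integer (here $u_0=s$, $u_\delta=t$).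
   Context: Let $(W,S)$ be a Coxeter system with identity $e$ and Bruhat order $\le$. For $I\subset S$ let $W_I$ be the parabolic subgroup generated by $I$; $I$ is finitary if $W_I$ is finite, and then $w_I$ is the longest element of $W_I$. Write $Is=I\sqcup\{s\}$. For finitary $I,J$, a $(J,I)$-coset is a double coset $p\in W_J\backslash W/W_I$ (the pair $(J,I)$ is part of the data); it has a unique Bruhat-maximal element $\overline{p}$ and a unique Bruhat-minimal element $\underline{p}$. Expressions: an expression is a sequence $[I_0,\dots,I_d]$ of finitary subsets, consecutive ones differing by adding or removing exactly one element of $S$. Notation such as $[J+s-t]$ means $[J,\,J\sqcup\{s\},\,(J\sqcup\{s\})\setminus\{t\}]$, and similarly for longer strings. The forward path of $I_\bullet=[I_0,\dots,I_d]$ is the sequence $p_0,\dots,p_d$ where $p_i$ is an $(I_0,I_i)$-coset, $e\in p_0$; if $I_i\subset I_{i+1}$, $p_{i+1}$ is the $(I_0,I_{i+1})$-coset containing $p_i$; if $I_i\supset I_{i+1}$, $p_{i+1}$ is the $(I_0,I_{i+1})$-coset containing $\overline{p_i}$. One says $I_\bullet$ expresses $p_d$; $I_\bullet\leftrightharpoons I'_\bullet$ means both express the same double coset. The left redundancy of $p_i$ is $K_i=I_0\cap\underline{p_i}I_i\underline{p_i}^{-1}$. The expression is reduced if for every $i$ with $I_i\subset I_{i+1}$ one has $\underline{p_i}=\underline{p_{i+1}}$ and $K_i=K_{i+1}$. Rotation sequence: given $s\notin J$ with $Js$ finitary and $t\in Js$ with $s\ne w_{Js}tw_{Js}$, put $u_0=s$,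 $u_{-1}=w_{Js}tw_{Js}$, $I_i=Js\setminus\{u_i\}$, and $u_{i+1}=w_{I_i}u_{i-1}w_{I_i}$ for all $i\in\mathbb Z$; all $u_i$ lie in $Js$. Put $L_i=Js\setminus\{u_i,u_{i-1}\}$. The integer $\delta$ is the largest integer such that $[I_0,L_1,I_1,\dots,L_k,I_k]$ is reduced for all $1\le k\le\delta$ (such $\delta\ge1$ exists and $u_\delta=t$). *)

theory Defs
  imports "HOL-Algebra.Algebra"
begin

section \<open>Coxeter systems\<close>

definition word_prod :: "('a, 'm) monoid_scheme \<Rightarrow> 'a list \<Rightarrow> 'a" where
  "word_prod G ws = foldr (\<otimes>\<^bsub>G\<^esub>) ws \<one>\<^bsub>G\<^esub>"

text \<open>Deletion of a defining relator \<open>(st)\<^sup>m\<close> with \<open>m\<close> the order of \<open>st\<close>. As \<open>group.ord\<close> is 0 for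
  elements of infinite order, such pairs contribute only the trivial relator; for \<open>s = t\<close> the
  relator is \<open>ss\<close>.\<close>

inductive relator_deletion :: "('a, 'm) monoid_scheme \<Rightarrow> 'a set \<Rightarrow> 'a list \<Rightarrow> 'a list \<Rightarrow> bool"
  for G S where
  "\<lbrakk>xs \<in> lists S; ys \<in> lists S; s \<in> S; t \<in> S\<rbrakk> \<Longrightarrow>
     relator_deletion G S (xs @ concat (replicate (group.ord G (s \<otimes>\<^bsub>G\<^esub> t)) [s, t]) @ ys) (xs @ ys)"

text \<open>\<open>S\<close> consists of elements of order 2 and \<open>W\<close> is presented by the generators \<open>S\<close> and
  the relations \<open>(st)\<^bsup>m(s,t)\<^esup> = 1\<close> for all \<open>s, t \<in> S\<close> such that the order \<open>m(s,t)\<close> of \<open>st\<close> is finite.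
  Since \<open>ss\<close> is among the relators, formal inverses of generators are not needed, so the
  presentation can be expressed with words over \<open>S\<close>. \<open>S\<close> may be infinite.\<close>

locale coxeter_system = group W for W (structure) +
  fixes S :: "'a set"
  assumes gens_closed: "S \<subseteq> carrier W"
    and gens_generate: "generate W S = carrier W"
    and gens_order: "s \<in> S \<Longrightarrow> ord s = 2"
    and presentation:
      "\<lbrakk>xs \<in> lists S; ys \<in> lists S; word_prod W xs = word_prod W ys\<rbrakk>
        \<Longrightarrow> equivclp (relator_deletion W S) xs ys"
begin

definition cox_length :: "'a \<Rightarrow> nat" where
  "cox_length w = (LEAST n. \<exists>ws \<in> lists S. length ws = n \<and> word_prod W ws = w)"

definition reflections :: "'a set" where
  "reflections = {w \<otimes> s \<otimes> inv w | w s. w \<in> carrier W \<and> s \<in> S}"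

definition bruhat_le :: "'a \<Rightarrow> 'a \<Rightarrow> bool" where
  "bruhat_le = (\<lambda>u v. u \<in> carrier W \<and> (\<exists>r \<in> reflections. v = u \<otimes> r) \<and> cox_length u < cox_length v)\<^sup>*\<^sup>*"

definition finitary :: "'a set \<Rightarrow> bool" where
  "finitary I \<longleftrightarrow> I \<subseteq> S \<and> finite (generate W I)"

definition longest :: "'a set \<Rightarrow> 'a" where
  "longest I = (THE w. w \<in> generate W I \<and> (\<forall>v \<in> generate W I. cox_length v \<le> cox_length w))"

definition conj_longest :: "'a set \<Rightarrow> 'a \<Rightarrow> 'a" where
  "conj_longest I x = longest I \<otimes> x \<otimes> longest I"


section \<open>Double cosets\<close>

definition is_coset :: "'a set \<Rightarrow> 'a set \<Rightarrow> 'a set \<Rightarrow> bool" where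
  "is_coset J I p \<longleftrightarrow>
     (\<exists>x \<in> carrier W. p = {a \<otimes> x \<otimes> b | a b. a \<in> generate W J \<and> b \<in> generate W I})"

definition coset_max :: "'a set \<Rightarrow> 'a" where
  "coset_max p = (THE x. x \<in> p \<and> (\<forall>y \<in> p. bruhat_le x y \<longrightarrow> y = x))"

definition coset_min :: "'a set \<Rightarrow> 'a" where
  "coset_min p = (THE x. x \<in> p \<and> (\<forall>y \<in> p. bruhat_le y x \<longrightarrow> y = x))"


section \<open>Expressions\<close>

definition adjacent :: "'a set \<Rightarrow> 'a set \<Rightarrow> bool" where
  "adjacent I I' \<longleftrightarrow> (\<exists>s \<in> S. (s \<notin> I \<and> I' = insert s I) \<or> (s \<in> I \<and> I' = I - {s}))"

definition expression :: "'a set list \<Rightarrow> bool" where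
  "expression Is \<longleftrightarrow> Is \<noteq> [] \<and> (\<forall>I \<in> set Is. finitary I) \<and> successively adjacent Is"

fun forward_path :: "'a set list \<Rightarrow> nat \<Rightarrow> 'a set" where
  "forward_path Is 0 = (THE q. is_coset (Is ! 0) (Is ! 0) q \<and> \<one> \<in> q)"
| "forward_path Is (Suc i) =
     (if Is ! i \<subseteq> Is ! Suc i
      then (THE q. is_coset (Is ! 0) (Is ! Suc i) q \<and> forward_path Is i \<subseteq> q)
      else (THE q. is_coset (Is ! 0) (Is ! Suc i) q \<and> coset_max (forward_path Is i) \<in> q))"

definition left_redundancy :: "'a set list \<Rightarrow> nat \<Rightarrow> 'a set" where
  "left_redundancy Is i =
     Is ! 0 \<inter> (let x = coset_min (forward_path Is i) in (\<lambda>s. x \<otimes> s \<otimes> inv x) ` (Is ! i))"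

definition reduced :: "'a set list \<Rightarrow> bool" where
  "reduced Is \<longleftrightarrow> expression Is \<and>
     (\<forall>i. Suc i < length Is \<and> Is ! i \<subset> Is ! Suc i \<longrightarrow>
        coset_min (forward_path Is i) = coset_min (forward_path Is (Suc i)) \<and>
        left_redundancy Is i = left_redundancy Is (Suc i))"


section \<open>Rotation sequences\<close>

text \<open>The rotation sequence of \<open>(K,s,t)\<close> at non-negative indices, the only ones the switchback
  relation uses. The value \<open>u\<^sub>-\<^sub>1 = w t w\<close>, with \<open>w\<close> longest for \<open>Ks\<close>, is inlined in the
  equation for \<open>u\<^sub>1\<close>.\<close>

fun rot :: "'a set \<Rightarrow> 'a \<Rightarrow> 'a \<Rightarrow> nat \<Rightarrow> 'a" where
  "rot K s t 0 = s"
| "rot K s t (Suc 0) = conj_longest (insert s K - {s}) (conj_longest (insert s K) t)"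
| "rot K s t (Suc (Suc i)) = conj_longest (insert s K - {rot K s t (Suc i)}) (rot K s t i)"

text \<open>\<open>[I\<^sub>0, L\<^sub>1, I\<^sub>1, \<dots>, L\<^sub>k, I\<^sub>k]\<close>, which is also \<open>[K - u\<^sub>1 + u\<^sub>0 - u\<^sub>2 + u\<^sub>1 - \<dots> - u\<^sub>k + u\<^bsub>k-1\<^esub>]\<close>\<close>

definition rot_expr :: "'a set \<Rightarrow> 'a \<Rightarrow> 'a \<Rightarrow> nat \<Rightarrow> 'a set list" where
  "rot_expr K s t k = (insert s K - {rot K s t 0}) #
     concat (map (\<lambda>i. [insert s K - {rot K s t i, rot K s t (i - 1)}, insert s K - {rot K s t i}])
       [1..<Suc k])"

definition rot_delta :: "'a set \<Rightarrow> 'a \<Rightarrow> 'a \<Rightarrow> nat" where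
  "rot_delta K s t = (GREATEST d. \<forall>k \<in> {1..d}. reduced (rot_expr K s t k))"


section \<open>Relations and moves\<close>

inductive braid :: "'a set list \<Rightarrow> 'a set list \<Rightarrow> bool" where
  up_up: "\<lbrakk>s \<in> S - K; t \<in> S - K; s \<noteq> t; finitary (K \<union> {s, t})\<rbrakk> \<Longrightarrow>
    braid [K, insert s K, insert t (insert s K)] [K, insert t K, insert s (insert t K)]"
| down_down: "\<lbrakk>finitary K; s \<in> K; t \<in> K; s \<noteq> t\<rbrakk> \<Longrightarrow>
    braid [K, K - {s}, K - {s} - {t}] [K, K - {t}, K - {t} - {s}]"
| switchback: "\<lbrakk>s \<in> S - K; finitary (insert s K); t \<in> insert s K;
      s \<noteq> conj_longest (insert s K) t\<rbrakk> \<Longrightarrow>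
    braid [K, insert s K, insert s K - {t}] (rot_expr K s t (rot_delta K s t))"

inductive star_quadratic :: "'a set list \<Rightarrow> 'a set list \<Rightarrow> bool" where
  "\<lbrakk>finitary J; s \<in> J\<rbrakk> \<Longrightarrow> star_quadratic [J, J - {s}, J] [J]"

inductive move :: "'a set list \<Rightarrow> 'a set list \<Rightarrow> bool" where
  "braid Xs Ys \<or> braid Ys Xs \<or> star_quadratic Xs Ys \<Longrightarrow> move (As @ Xs @ Bs) (As @ Ys @ Bs)"

end

end

theory Submission
  imports Defs "HOL-Library.Sublist"
begin

text \<open>
  A double coset is followed through its longest element. Write \<open>J\<close> for the initial subset of an
  expression and \<open>w\<^sub>I\<close> for the longest element of \<open>W\<^sub>I\<close>. The current \<open>(J,I)\<close>-coset has longest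
  element \<open>x = y w\<^sub>I\<close>, where \<open>y\<close> has no right descent in \<open>I\<close>. A step down keeps \<open>x\<close>, and a step up
  to \<open>M = Is\<close> replaces \<open>x\<close> by the longest element of \<open>y W\<^sub>M\<close>. Comparing minimal elements and left
  redundancies shows that this step up is reduced exactly when \<open>s\<close> is not a right descent of \<open>y\<close>
  (lemma \<open>reduced_step_iff\<close>), so that the new element is \<open>y w\<^sub>M\<close>. Reduced expressions thus become
  paths in a graph on pairs \<open>(x,I)\<close> (predicate \<open>rpath\<close>).

  In this graph any two paths to the same pair are braid equivalent (\<open>matsumoto\<close>). As in the
  classical theorem, it suffices to complete two different last steps to a common source. Two steps
  of the same direction are joined by the up-up and down-down relations. A last step down from \<open>M\<close>
  and a last step up from \<open>I - {t}\<close> are joined by a switchback whose first subset omits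
  \<open>w\<^sub>M w\<^sub>I t w\<^sub>I w\<^sub>M\<close>. This needs the fact that the rotation sequence ends where it should
  (\<open>rot_delta_char\<close>, \<open>rot_end\<close>): conjugation by the accumulated product carries each rank two complement
  \<open>L\<^sub>k\<close> back to \<open>L\<^sub>0\<close>, so a failure of reducedness can occur only at the longest element of \<open>W\<^sub>M\<close>.

  The theorem then follows by appending one step at a time to a reduced expression. Only a step up
  to \<open>M = Is\<close> with \<open>s\<close> a right descent of \<open>y\<close> is a problem (\<open>reduce_up_step\<close>). If \<open>s\<close> is also a right
  descent of \<open>x\<close>, then the expression can be braided to end with \<open>[M, I]\<close>, and the appended \<open>M\<close> is
  absorbed by the quadratic relation. Otherwise some \<open>t \<in> I\<close> lies outside the right redundancy of
  the coset, the expression can be braided to end with \<open>[I - {t}, I]\<close>, and an up-up relation turns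
  the end into \<open>[I - {t}, M - {t}, M]\<close>; here the step to \<open>M - {t}\<close> starts from a smaller set, and once it
  is repaired the step to \<open>M\<close> starts from a shorter \<open>y\<close>.
\<close>

context coxeter_system
begin

section \<open>Words and the exchange condition\<close>

abbreviation len ("\<ell>") where "len \<equiv> cox_length"

lemma gen_closed [simp]: "s \<in> S \<Longrightarrow> s \<in> carrier W"
  using gens_closed by blast

lemma gen_sq [simp]: "s \<in> S \<Longrightarrow> s \<otimes> s = \<one>"
  using pow_ord_eq_1[of s] gens_order[of s] by (simp add: numeral_2_eq_2)

lemma gen_neq_one: "s \<in> S \<Longrightarrow> s \<noteq> \<one>"
  using gens_order[of s] ord_eq_1[of \<one>] by auto

lemma gen_inv [simp]: "s \<in> S \<Longrightarrow> inv s = s"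
  by (simp add: inv_equality)

lemma gen_cancel_left [simp]: "s \<in> S \<Longrightarrow> x \<in> carrier W \<Longrightarrow> s \<otimes> (s \<otimes> x) = x"
  by (simp add: m_assoc[symmetric])

lemma gen_cancel_right [simp]: "s \<in> S \<Longrightarrow> x \<in> carrier W \<Longrightarrow> x \<otimes> s \<otimes> s = x"
  by (simp add: m_assoc)

lemma word_prod_Nil [simp]: "word_prod W [] = \<one>"
  by (simp add: word_prod_def)

lemma word_prod_Cons [simp]: "word_prod W (s # ws) = s \<otimes> word_prod W ws"
  by (simp add: word_prod_def)

lemma word_prod_closed [simp]: "ws \<in> lists S \<Longrightarrow> word_prod W ws \<in> carrier W"
  by (induction ws) auto

lemma word_prod_append:
  "xs \<in> lists S \<Longrightarrow> ys \<in> lists S \<Longrightarrow> word_prod W (xs @ ys) = word_prod W xs \<otimes> word_prod W ys"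
  by (induction xs) (auto simp: m_assoc)

lemma word_prod_rev: "xs \<in> lists S \<Longrightarrow> word_prod W (rev xs) = inv (word_prod W xs)"
  by (induction xs) (auto simp: word_prod_append inv_mult_group in_listsI)

lemma parabolic_eq_words:
  assumes "I \<subseteq> S"
  shows "generate W I = word_prod W ` lists I"
proof
  show "generate W I \<subseteq> word_prod W ` lists I"
  proof
    fix x assume "x \<in> generate W I"
    then show "x \<in> word_prod W ` lists I"
    proof (induction rule: generate.induct)
      case one
      have "word_prod W [] \<in> word_prod W ` lists I" by (rule imageI) simp
      then show ?case by simp
    next
      case (incl h)
      have "word_prod W [h] \<in> word_prod W ` lists I" by (rule imageI) (use incl in auto)
      moreover have "word_prod W [h] = h" using incl assms by auto
      ultimately show ?case by metis
    next
      case (inv h)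
      have "word_prod W [h] \<in> word_prod W ` lists I" by (rule imageI) (use inv in auto)
      moreover have "word_prod W [h] = inv h" using inv assms by auto
      ultimately show ?case by metis
    next
      case (eng h1 h2)
      then obtain a b where "a \<in> lists I" "b \<in> lists I" "h1 = word_prod W a" "h2 = word_prod W b"
        by blast
      moreover have "a \<in> lists S" "b \<in> lists S" using calculation assms by auto
      ultimately have "h1 \<otimes> h2 = word_prod W (a @ b)" "a @ b \<in> lists I"
        by (auto simp: word_prod_append)
      then show ?case by blast
    qed
  qed
  show "word_prod W ` lists I \<subseteq> generate W I"
  proof (rule image_subsetI)
    fix ws assume "ws \<in> lists I"
    then show "word_prod W ws \<in> generate W I"
      by (induction ws) (auto intro: generate.intros)
  qed
qed

lemma ex_word: "x \<in> carrier W \<Longrightarrow> \<exists>ws \<in> lists S. word_prod W ws = x"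
  using parabolic_eq_words[of S] gens_generate by auto

lemma len_le: "ws \<in> lists S \<Longrightarrow> \<ell> (word_prod W ws) \<le> length ws"
  unfolding cox_length_def by (rule Least_le) blast

lemma ex_reduced_word:
  assumes "x \<in> carrier W"
  obtains ws where "ws \<in> lists S" "word_prod W ws = x" "length ws = \<ell> x"
proof -
  have "\<exists>n. \<exists>ws \<in> lists S. length ws = n \<and> word_prod W ws = x" using ex_word[OF assms] by blast
  from LeastI_ex[OF this] show ?thesis using that unfolding cox_length_def by blast
qed

lemma len_one [simp]: "\<ell> \<one> = 0"
  using len_le[of "[]"] by simp

lemma len_eq_0: "x \<in> carrier W \<Longrightarrow> \<ell> x = 0 \<Longrightarrow> x = \<one>"
  by (erule ex_reduced_word) auto

lemma len_mult_le:
  assumes "x \<in> carrier W" "y \<in> carrier W"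
  shows "\<ell> (x \<otimes> y) \<le> \<ell> x + \<ell> y"
proof -
  obtain a b where "a \<in> lists S" "word_prod W a = x" "length a = \<ell> x"
    "b \<in> lists S" "word_prod W b = y" "length b = \<ell> y"
    using ex_reduced_word assms by metis
  then show ?thesis using len_le[of "a @ b"] by (auto simp: word_prod_append)
qed

lemma len_inv [simp]:
  assumes "x \<in> carrier W" shows "\<ell> (inv x) = \<ell> x"
proof -
  have *: "\<ell> (inv y) \<le> \<ell> y" if y: "y \<in> carrier W" for y
  proof -
    obtain a where a: "a \<in> lists S" "word_prod W a = y" "length a = \<ell> y"
      using ex_reduced_word y by metis
    then have "rev a \<in> lists S" by auto
    then show ?thesis using len_le[of "rev a"] a word_prod_rev[of a] by simp
  qed
  show ?thesis using *[OF assms] *[of "inv x"] assms by simp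
qed

lemma len_gen [simp]: assumes "s \<in> S" shows "\<ell> s = 1"
  using len_le[of "[s]"] len_eq_0[of s] gen_neq_one[of s] assms by fastforce

text \<open>The reflections \<open>(s\<^sub>1 \<cdots> s\<^bsub>i-1\<^esub>) s\<^sub>i (s\<^sub>1 \<cdots> s\<^bsub>i-1\<^esub>)\<^sup>-\<^sup>1\<close> attached to the letters of a word. The parity with
  which a given reflection occurs depends only on the product of the word; this is where the
  presentation of \<open>W\<close> enters.\<close>
primrec refls :: "'a list \<Rightarrow> 'a list" where
  "refls [] = []"
| "refls (s # ws) = s # map (\<lambda>r. s \<otimes> r \<otimes> s) (refls ws)"

lemma refls_closed: "ws \<in> lists S \<Longrightarrow> set (refls ws) \<subseteq> carrier W"
  by (induction ws) auto

lemma refls_append: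
  "xs \<in> lists S \<Longrightarrow> ys \<in> lists S \<Longrightarrow>
    refls (xs @ ys) = refls xs @ map (\<lambda>r. word_prod W xs \<otimes> r \<otimes> inv (word_prod W xs)) (refls ys)"
proof (induction xs)
  case Nil
  then show ?case using refls_closed[of ys] by (auto intro!: map_idI[symmetric])
next
  case (Cons s xs)
  then have "s \<in> S" "xs \<in> lists S" by auto
  moreover have "x \<in> carrier W" if "x \<in> set (refls ys)" for x
    using refls_closed[of ys] Cons.prems that by blast
  ultimately show ?case using Cons.IH Cons.prems(2)
    by (simp add: inv_mult_group m_assoc)
qed

lemma count_list_conj:
  assumes "set L \<subseteq> carrier W" "p \<in> carrier W" "r \<in> carrier W"
  shows "count_list (map (\<lambda>x. p \<otimes> x \<otimes> inv p) L) r = count_list L (inv p \<otimes> r \<otimes> p)"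
  using assms(1)
proof (induction L)
  case (Cons a L)
  have "p \<otimes> a \<otimes> inv p = r \<longleftrightarrow> a = inv p \<otimes> r \<otimes> p"
    using Cons assms by (auto simp: m_assoc inv_solve_left inv_solve_right)
      (metis assms(2) inv_closed inv_solve_right l_inv m_assoc m_closed r_one)+
  then show ?case using Cons by auto
qed simp

lemma relator_word: "s \<in> S \<Longrightarrow> t \<in> S \<Longrightarrow> concat (replicate n [s, t]) \<in> lists S"
  by (induction n) auto

text \<open>The reflections of \<open>(st)\<^sup>n\<close> are \<open>(st)\<^sup>k s\<close> for \<open>k < 2n\<close>, because \<open>s\<close> inverts \<open>st\<close> under
  conjugation. At \<open>n = ord (st)\<close> this list runs twice through the same period.\<close>
lemma refls_relator:
  assumes "s \<in> S" "t \<in> S"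
  shows "word_prod W (concat (replicate n [s, t])) = (s \<otimes> t) [^] n \<and>
    refls (concat (replicate n [s, t])) = map (\<lambda>k. (s \<otimes> t) [^] k \<otimes> s) [0..<2 * n]"
proof (induction n)
  case (Suc n)
  let ?R = "concat (replicate n [s, t])" and ?c = "s \<otimes> t"
  have R: "?R \<in> lists S" using relator_word assms by blast
  have st: "[s, t] \<in> lists S" using assms by auto
  have e: "concat (replicate (Suc n) [s, t]) = ?R @ [s, t]"
    by (induction n) auto
  have c: "?c \<in> carrier W" using assms by simp
  have sc: "s \<otimes> inv ?c = ?c \<otimes> s"
    using assms by (simp add: inv_mult_group m_assoc)
  have sck: "s \<otimes> inv (?c [^] k) = ?c [^] k \<otimes> s" for k :: nat
  proof (induction k)
    case (Suc k)
    have "s \<otimes> inv (?c [^] Suc k) = s \<otimes> inv ?c \<otimes> inv (?c [^] k)"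
      using assms c by (simp add: inv_mult_group m_assoc)
    also have "\<dots> = ?c \<otimes> (s \<otimes> inv (?c [^] k))" using assms c by (simp add: sc m_assoc)
    also have "\<dots> = ?c \<otimes> ?c [^] k \<otimes> s" using assms c Suc by (simp add: m_assoc)
    also have "\<dots> = ?c [^] Suc k \<otimes> s" using assms c nat_pow_Suc2[of ?c k] by simp
    finally show ?case .
  qed (use assms in simp)
  have 1: "?c [^] n \<otimes> s \<otimes> inv (?c [^] n) = ?c [^] (2 * n) \<otimes> s"
    using assms c by (simp add: m_assoc sck mult_2 nat_pow_mult[symmetric])
  have 2: "?c [^] n \<otimes> (s \<otimes> t \<otimes> s) \<otimes> inv (?c [^] n) = ?c [^] (Suc (2 * n)) \<otimes> s"
  proof -
    have "?c [^] n \<otimes> (s \<otimes> t \<otimes> s) \<otimes> inv (?c [^] n) = ?c [^] n \<otimes> ?c \<otimes> (s \<otimes> inv (?c [^] n))"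
      using assms c by (simp add: m_assoc)
    also have "\<dots> = ?c [^] Suc n \<otimes> ?c [^] n \<otimes> s" unfolding sck using assms c by (simp add: m_assoc)
    also have "\<dots> = ?c [^] (Suc (2 * n)) \<otimes> s"
      using c nat_pow_mult[OF c, of "Suc n" n] by (simp add: mult_2)
    finally show ?thesis .
  qed
  have "refls (concat (replicate (Suc n) [s, t])) =
      map (\<lambda>k. ?c [^] k \<otimes> s) [0..<2 * n] @ [?c [^] (2 * n) \<otimes> s, ?c [^] (Suc (2 * n)) \<otimes> s]"
    unfolding e refls_append[OF R st] using Suc 1 2 by simp
  moreover have "word_prod W (concat (replicate (Suc n) [s, t])) = ?c [^] Suc n"
    unfolding e word_prod_append[OF R st] using Suc assms by (simp add: m_assoc)
  ultimately show ?case by simp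
qed simp

lemma even_count_relator:
  assumes "s \<in> S" "t \<in> S"
  shows "even (count_list (refls (concat (replicate (ord (s \<otimes> t)) [s, t]))) r)"
proof -
  let ?c = "s \<otimes> t" and ?f = "\<lambda>k. (s \<otimes> t) [^] k \<otimes> s"
  let ?m = "ord ?c"
  have c: "?c \<in> carrier W" using assms by simp
  have "[0..<2 * ?m] = [0..<?m] @ map (\<lambda>k. k + ?m) [0..<?m]"
    by (metis map_add_upt mult_2 upt_add_eq_append zero_le)
  moreover have "?f (k + ?m) = ?f k" for k
    using c pow_ord_eq_1[OF c] by (simp add: nat_pow_mult[symmetric])
  ultimately have "map ?f [0..<2 * ?m] = map ?f [0..<?m] @ map ?f [0..<?m]" by simp
  then show ?thesis using refls_relator[OF assms, of ?m] by simp
qed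

lemma parity_invariant:
  assumes xs: "xs \<in> lists S" and ys: "ys \<in> lists S" and eq: "word_prod W xs = word_prod W ys"
    and r: "r \<in> carrier W"
  shows "even (count_list (refls xs) r) = even (count_list (refls ys) r)"
proof -
  have step: "even (count_list (refls as) r) = even (count_list (refls bs) r)"
    if "relator_deletion W S as bs" for as bs
    using that
  proof cases
    case (1 xs ys s t)
    let ?R = "concat (replicate (ord (s \<otimes> t)) [s, t])"
    have R: "?R \<in> lists S" "?R @ ys \<in> lists S"
      using 1 relator_word[of s t "ord (s \<otimes> t)"] by (auto simp del: set_concat set_replicate)
    have p1: "word_prod W ?R = \<one>" using refls_relator 1 pow_ord_eq_1 by simp
    have rys: "refls (?R @ ys) = refls ?R @ refls ys"
      using refls_append[OF R(1), of ys] p1 1 refls_closed[of ys] by (auto intro!: map_idI)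
    show ?thesis
      using 1 R r refls_closed[of ys] refls_closed[of ?R] even_count_relator[of s t]
      by (simp add: refls_append rys count_list_conj del: map_concat)
  qed
  have "equivclp (relator_deletion W S) xs ys" using presentation xs ys eq by blast
  then show ?thesis
    by (induction rule: equivclp_induct) (use step in auto)
qed

text \<open>If \<open>r = p s\<^sub>i p\<^sup>-\<^sup>1\<close> with \<open>p\<close> the prefix before \<open>s\<^sub>i\<close>, then multiplying by \<open>r\<close> on the left cancels
  the letter \<open>s\<^sub>i\<close>.\<close>
lemma refls_deletion:
  "r \<in> set (refls ws) \<Longrightarrow> ws \<in> lists S \<Longrightarrow>
    \<exists>us s vs. ws = us @ s # vs \<and> r \<otimes> word_prod W ws = word_prod W (us @ vs)"
proof (induction ws arbitrary: r)
  case (Cons a ws)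
  then have a: "a \<in> S" "ws \<in> lists S" by auto
  show ?case
  proof (cases "r = a")
    case True
    then have "a # ws = [] @ a # ws \<and> r \<otimes> word_prod W (a # ws) = word_prod W ([] @ ws)"
      using a by simp
    then show ?thesis by blast
  next
    case False
    then obtain q where q: "q \<in> set (refls ws)" "r = a \<otimes> q \<otimes> a" using Cons by auto
    then obtain us s vs where 1: "ws = us @ s # vs" "q \<otimes> word_prod W ws = word_prod W (us @ vs)"
      using Cons a by blast
    have "q \<in> carrier W" using q refls_closed a by blast
    then have "r \<otimes> word_prod W (a # ws) = word_prod W ((a # us) @ vs)"
      using 1 q a by (simp add: m_assoc)
    moreover have "a # ws = (a # us) @ s # vs" using 1 by simp
    ultimately show ?thesis by blast
  qed
qed simp

text \<open>An odd multiplicity survives in a reduced word for the same element, where it allows one letter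
  to be deleted.\<close>
lemma odd_refls_imp_less:
  assumes "ws \<in> lists S" "s \<in> S" "odd (count_list (refls ws) s)"
  shows "\<ell> (s \<otimes> word_prod W ws) < \<ell> (word_prod W ws)"
proof -
  obtain vs where vs: "vs \<in> lists S" "word_prod W vs = word_prod W ws" "length vs = \<ell> (word_prod W ws)"
    using ex_reduced_word assms word_prod_closed by metis
  then have "odd (count_list (refls vs) s)" using parity_invariant[of vs ws s] assms by simp
  then have "s \<in> set (refls vs)" by (metis count_list_0_iff even_zero)
  then obtain a t b where "vs = a @ t # b" "s \<otimes> word_prod W vs = word_prod W (a @ b)"
    using refls_deletion vs by blast
  moreover then have "a @ b \<in> lists S" using vs by auto
  ultimately show ?thesis using len_le[of "a @ b"] vs by simp
qed

text \<open>Prefixing \<open>s\<close> makes the multiplicity odd, so the previous lemma applies to \<open>s\<close> times the element.\<close>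
lemma even_refls_imp_greater:
  assumes "ws \<in> lists S" "s \<in> S" "even (count_list (refls ws) s)"
  shows "\<ell> (word_prod W ws) < \<ell> (s \<otimes> word_prod W ws)"
proof -
  have "count_list (map (\<lambda>r. s \<otimes> r \<otimes> s) (refls ws)) s = count_list (refls ws) s"
    using count_list_conj[of "refls ws" s s] refls_closed[of ws] assms by simp
  then have "odd (count_list (refls (s # ws)) s)" using assms by simp
  from odd_refls_imp_less[OF _ assms(2) this] show ?thesis using assms by simp
qed

lemma left_exchange:
  assumes "s \<in> S" "ws \<in> lists S" "\<ell> (s \<otimes> word_prod W ws) < \<ell> (word_prod W ws)"
  shows "\<exists>us t vs. ws = us @ t # vs \<and> s \<otimes> word_prod W ws = word_prod W (us @ vs)"
proof -
  have "odd (count_list (refls ws) s)"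
    using even_refls_imp_greater[OF assms(2,1)] assms(3) by linarith
  then have "s \<in> set (refls ws)" by (metis count_list_0_iff even_zero)
  then show ?thesis using refls_deletion assms by blast
qed

definition ldesc :: "'a \<Rightarrow> 'a set" where "ldesc x = {s \<in> S. \<ell> (s \<otimes> x) < \<ell> x}"
definition rdesc :: "'a \<Rightarrow> 'a set" where "rdesc x = {s \<in> S. \<ell> (x \<otimes> s) < \<ell> x}"

lemma len_gen_left:
  assumes "s \<in> S" "x \<in> carrier W"
  shows "\<ell> (s \<otimes> x) = (if s \<in> ldesc x then \<ell> x - 1 else \<ell> x + 1)"
    and "s \<in> ldesc x \<Longrightarrow> \<ell> x \<noteq> 0"
proof -
  obtain ws where ws: "ws \<in> lists S" "word_prod W ws = x" using ex_word assms by blast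
  have ne: "\<ell> (s \<otimes> x) < \<ell> x \<or> \<ell> x < \<ell> (s \<otimes> x)"
    using odd_refls_imp_less[OF ws(1) assms(1)] even_refls_imp_greater[OF ws(1) assms(1)] ws by blast
  have "\<ell> (s \<otimes> x) \<le> 1 + \<ell> x" using len_mult_le[of s x] assms by simp
  moreover have "\<ell> (s \<otimes> (s \<otimes> x)) \<le> 1 + \<ell> (s \<otimes> x)" using len_mult_le[of s "s \<otimes> x"] assms by simp
  then have "\<ell> x \<le> 1 + \<ell> (s \<otimes> x)" using assms by simp
  ultimately show "\<ell> (s \<otimes> x) = (if s \<in> ldesc x then \<ell> x - 1 else \<ell> x + 1)"
    using ne assms unfolding ldesc_def by auto
  show "s \<in> ldesc x \<Longrightarrow> \<ell> x \<noteq> 0" unfolding ldesc_def by auto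
qed

lemma ldesc_inv: "x \<in> carrier W \<Longrightarrow> ldesc (inv x) = rdesc x"
  and rdesc_inv: "x \<in> carrier W \<Longrightarrow> rdesc (inv x) = ldesc x"
proof -
  have a: "s \<in> S \<Longrightarrow> x \<in> carrier W \<Longrightarrow> \<ell> (s \<otimes> inv x) = \<ell> (x \<otimes> s)" for s x
    using len_inv[of "x \<otimes> s"] by (simp add: inv_mult_group)
  show "x \<in> carrier W \<Longrightarrow> ldesc (inv x) = rdesc x" unfolding ldesc_def rdesc_def using a by auto
  have "s \<in> S \<Longrightarrow> x \<in> carrier W \<Longrightarrow> \<ell> (inv x \<otimes> s) = \<ell> (s \<otimes> x)" for s
    using len_inv[of "s \<otimes> x"] by (simp add: inv_mult_group)
  then show "x \<in> carrier W \<Longrightarrow> rdesc (inv x) = ldesc x" unfolding ldesc_def rdesc_def by auto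
qed

lemma len_gen_right:
  assumes "s \<in> S" "x \<in> carrier W"
  shows "\<ell> (x \<otimes> s) = (if s \<in> rdesc x then \<ell> x - 1 else \<ell> x + 1)"
    and "s \<in> rdesc x \<Longrightarrow> \<ell> x \<noteq> 0"
proof -
  have "\<ell> (x \<otimes> s) = \<ell> (s \<otimes> inv x)" using len_inv[of "x \<otimes> s"] assms by (simp add: inv_mult_group)
  then show "\<ell> (x \<otimes> s) = (if s \<in> rdesc x then \<ell> x - 1 else \<ell> x + 1)"
    using len_gen_left[of s "inv x"] assms ldesc_inv by simp
  show "s \<in> rdesc x \<Longrightarrow> \<ell> x \<noteq> 0" unfolding rdesc_def by auto
qed

lemma right_exchange:
  assumes "s \<in> S" "ws \<in> lists S" "s \<in> rdesc (word_prod W ws)"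
  shows "\<exists>us t vs. ws = us @ t # vs \<and> word_prod W ws \<otimes> s = word_prod W (us @ vs)"
proof -
  have r: "rev ws \<in> lists S" using assms by auto
  have "s \<in> ldesc (word_prod W (rev ws))" using assms ldesc_inv word_prod_rev by simp
  then obtain us t vs where 1: "rev ws = us @ t # vs"
      "s \<otimes> word_prod W (rev ws) = word_prod W (us @ vs)"
    using left_exchange[OF assms(1) r] unfolding ldesc_def by blast
  then have e: "ws = rev vs @ t # rev us" by (metis rev.simps(2) rev_append rev_rev_ident append.assoc append_Cons append_Nil)
  have u: "us @ vs \<in> lists S" using 1 r by auto
  have "word_prod W ws \<otimes> s = inv (s \<otimes> word_prod W (rev ws))"
    using assms word_prod_rev by (simp add: inv_mult_group)
  also have "\<dots> = word_prod W (rev vs @ rev us)" using 1 word_prod_rev[OF u] by simp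
  finally show ?thesis using e by blast
qed


section \<open>Parabolic subgroups and minimal coset representatives\<close>

lemma inv_cancel_left [simp]: "x \<in> carrier W \<Longrightarrow> y \<in> carrier W \<Longrightarrow> inv x \<otimes> (x \<otimes> y) = y"
  by (simp add: m_assoc[symmetric])

lemma inv_cancel_left' [simp]: "x \<in> carrier W \<Longrightarrow> y \<in> carrier W \<Longrightarrow> x \<otimes> (inv x \<otimes> y) = y"
  by (simp add: m_assoc[symmetric])

lemma par_closed: "I \<subseteq> S \<Longrightarrow> x \<in> generate W I \<Longrightarrow> x \<in> carrier W"
  using generate_in_carrier gens_closed by blast

lemma par_mult: "x \<in> generate W I \<Longrightarrow> y \<in> generate W I \<Longrightarrow> x \<otimes> y \<in> generate W I"
  by (rule generate.eng)

lemma par_inv: "I \<subseteq> S \<Longrightarrow> x \<in> generate W I \<Longrightarrow> inv x \<in> generate W I"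
  using generate_m_inv_closed gens_closed by blast

lemma par_one [simp]: "\<one> \<in> generate W I"
  by (rule generate.one)

lemma par_gen: "s \<in> I \<Longrightarrow> s \<in> generate W I"
  by (rule generate.incl)

lemma par_mono: "I \<subseteq> J \<Longrightarrow> x \<in> generate W I \<Longrightarrow> x \<in> generate W J"
  using mono_generate by blast

lemma par_word: "I \<subseteq> S \<Longrightarrow> ws \<in> lists I \<Longrightarrow> word_prod W ws \<in> generate W I"
  by (simp add: parabolic_eq_words del: in_lists_conv_set)

lemma subseq_in_lists: "subseq vs ws \<Longrightarrow> ws \<in> lists A \<Longrightarrow> vs \<in> lists A"
  by (induction rule: list_emb.induct) auto

lemma reduced_subword:
  "ws \<in> lists S \<Longrightarrow> \<exists>vs. subseq vs ws \<and> word_prod W vs = word_prod W ws \<and> length vs = \<ell> (word_prod W ws)"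
proof (induction ws)
  case (Cons s ws)
  then have s: "s \<in> S" "ws \<in> lists S" by auto
  then obtain vs where vs: "subseq vs ws" "word_prod W vs = word_prod W ws"
      "length vs = \<ell> (word_prod W ws)"
    using Cons by blast
  have vsS: "vs \<in> lists S" using vs(1) s(2) by (rule subseq_in_lists)
  show ?case
  proof (cases "s \<in> ldesc (word_prod W ws)")
    case False
    then have "length (s # vs) = \<ell> (word_prod W (s # ws))"
      using len_gen_left(1)[OF s(1), of "word_prod W ws"] s vs by simp
    moreover have "subseq (s # vs) (s # ws)" "word_prod W (s # vs) = word_prod W (s # ws)" using vs by auto
    ultimately show ?thesis by metis
  next
    case True
    then obtain us t xs where e: "vs = us @ t # xs" "s \<otimes> word_prod W vs = word_prod W (us @ xs)"
      using left_exchange[OF s(1) vsS] vs unfolding ldesc_def by auto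
    have "length (us @ xs) = \<ell> (word_prod W (s # ws))"
      using len_gen_left(1)[OF s(1), of "word_prod W ws"] s vs e True by simp
    moreover have "subseq (us @ xs) vs" unfolding e(1) by (intro list_emb_append_mono) (auto simp: list_emb_Cons)
    then have "subseq (us @ xs) (s # ws)" using subseq_order.trans[OF _ vs(1)] by (simp add: list_emb_Cons)
    moreover have "word_prod W (us @ xs) = word_prod W (s # ws)" using e vs by simp
    ultimately show ?thesis by metis
  qed
qed auto

lemma par_reduced_word:
  assumes "I \<subseteq> S" "x \<in> generate W I"
  obtains vs where "vs \<in> lists I" "word_prod W vs = x" "length vs = \<ell> x"
proof -
  obtain ws where ws: "ws \<in> lists I" "word_prod W ws = x"
    using assms parabolic_eq_words[OF assms(1)] by (auto simp del: in_lists_conv_set)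
  have "ws \<in> lists S" using ws(1) assms(1) lists_mono by blast
  from reduced_subword[OF this] obtain vs where "subseq vs ws" "word_prod W vs = x" "length vs = \<ell> x"
    unfolding ws(2) by blast
  moreover have "vs \<in> lists I" using calculation(1) ws(1) by (rule subseq_in_lists)
  ultimately show ?thesis using that by blast
qed

lemma par_simple: assumes "I \<subseteq> S" "s \<in> generate W I" "\<ell> s = 1" shows "s \<in> I"
proof -
  obtain vs where "vs \<in> lists I" "word_prod W vs = s" "length vs = \<ell> s"
    using par_reduced_word assms by metis
  moreover then obtain t where "vs = [t]" using assms by (auto simp: length_Suc_conv)
  ultimately show ?thesis using assms by auto
qed

text \<open>The exchange condition for a concatenation of reduced words of \<open>y\<close> and \<open>v\<close>: the deleted letter
  lies in one of the two parts.\<close>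
lemma exchange_left_prod:
  assumes I: "I \<subseteq> S" and y: "y \<in> carrier W" and v: "v \<in> generate W I" and s: "s \<in> ldesc (y \<otimes> v)"
  shows "\<ell> (s \<otimes> y) < \<ell> y \<or> (\<exists>v' \<in> generate W I. \<ell> v' < \<ell> v \<and> s \<otimes> y \<otimes> v = y \<otimes> v')"
proof -
  obtain ys where ys: "ys \<in> lists S" "word_prod W ys = y" "length ys = \<ell> y"
    using ex_reduced_word y by metis
  obtain vs where vs: "vs \<in> lists I" "word_prod W vs = v" "length vs = \<ell> v"
    using par_reduced_word I v by metis
  have vS: "vs \<in> lists S" using vs I by auto
  have sS: "s \<in> S" using s unfolding ldesc_def by auto
  have all: "ys @ vs \<in> lists S" "word_prod W (ys @ vs) = y \<otimes> v"
    using ys vs vS by (auto simp: word_prod_append)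
  obtain us t xs where e: "ys @ vs = us @ t # xs" "s \<otimes> word_prod W (ys @ vs) = word_prod W (us @ xs)"
    using left_exchange[OF sS all(1)] s all unfolding ldesc_def by auto
  from e(1) consider a where "ys = us @ t # a" "xs = a @ vs" | a where "us = ys @ a" "vs = a @ t # xs"
    by (auto simp: append_eq_append_conv2 append_eq_Cons_conv)
  then show ?thesis
  proof cases
    case 1
    then have u: "us @ a \<in> lists S" using ys by auto
    have "s \<otimes> (y \<otimes> v) = word_prod W ((us @ a) @ vs)" using e all 1 by simp
    also have "\<dots> = word_prod W (us @ a) \<otimes> v" using word_prod_append[OF u vS] vs by simp
    finally have "s \<otimes> y = word_prod W (us @ a)"
      using sS y v u par_closed[OF I v] by (simp add: m_assoc[symmetric])
    then have "\<ell> (s \<otimes> y) < \<ell> y" using len_le[OF u] 1 ys by simp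
    then show ?thesis ..
  next
    case 2
    then have u: "a @ xs \<in> lists I" using vs by auto
    then have uS: "a @ xs \<in> lists S" using I by auto
    have "s \<otimes> (y \<otimes> v) = word_prod W (ys @ (a @ xs))" using e all 2 by simp
    also have "\<dots> = y \<otimes> word_prod W (a @ xs)" using word_prod_append[OF ys(1) uS] ys by simp
    finally have "s \<otimes> y \<otimes> v = y \<otimes> word_prod W (a @ xs)"
      using sS y par_closed[OF I v] by (simp add: m_assoc)
    moreover have "\<ell> (word_prod W (a @ xs)) < \<ell> v" using len_le[OF uS] 2 vs by simp
    ultimately show ?thesis using par_word[OF I u] by blast
  qed
qed

lemma exchange_right_prod:
  assumes K: "K \<subseteq> S" and y: "y \<in> generate W K" and v: "v \<in> carrier W" and s: "s \<in> rdesc (y \<otimes> v)"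
  shows "(\<exists>y' \<in> generate W K. \<ell> y' < \<ell> y \<and> y \<otimes> v \<otimes> s = y' \<otimes> v) \<or> \<ell> (v \<otimes> s) < \<ell> v"
proof -
  have yc: "y \<in> carrier W" using par_closed K y by blast
  have sS: "s \<in> S" using s unfolding rdesc_def by auto
  have "s \<in> ldesc (inv v \<otimes> inv y)" using s ldesc_inv[of "y \<otimes> v"] v yc by (simp add: inv_mult_group)
  then consider "\<ell> (s \<otimes> inv v) < \<ell> (inv v)"
    | v' where "v' \<in> generate W K" "\<ell> v' < \<ell> (inv y)" "s \<otimes> inv v \<otimes> inv y = inv v \<otimes> v'"
    using exchange_left_prod[OF K _ par_inv[OF K y], of "inv v" s] v by auto
  then show ?thesis
  proof cases
    case 1
    then show ?thesis using len_inv[of "v \<otimes> s"] sS v by (simp add: inv_mult_group)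
  next
    case 2
    have c: "v' \<in> carrier W" using 2 par_closed K by blast
    have "inv (s \<otimes> inv v \<otimes> inv y) = inv (inv v \<otimes> v')" using 2 by simp
    then have "y \<otimes> v \<otimes> s = inv v' \<otimes> v" using c v yc sS by (simp add: inv_mult_group m_assoc)
    then show ?thesis using 2 c yc par_inv[OF K] by (intro disjI1 bexI[of _ "inv v'"]) auto
  qed
qed

text \<open>By \<open>rmin_add\<close> below, such a \<open>y\<close> is the shortest element of the coset \<open>y W\<^sub>I\<close>.\<close>
definition rmin :: "'a set \<Rightarrow> 'a \<Rightarrow> bool" where
  "rmin I y \<longleftrightarrow> y \<in> carrier W \<and> I \<inter> rdesc y = {}"

lemma rmin_closed [simp]: "rmin I y \<Longrightarrow> y \<in> carrier W"
  unfolding rmin_def by simp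

text \<open>A failure of additivity would, by exchange, produce either a shorter word for \<open>v\<close> or a shorter
  element of \<open>y W\<^sub>I\<close>.\<close>
lemma coset_shortest_add:
  assumes I: "I \<subseteq> S" and y: "y \<in> carrier W" and min: "\<And>v. v \<in> generate W I \<Longrightarrow> \<ell> y \<le> \<ell> (y \<otimes> v)"
    and v: "v \<in> generate W I"
  shows "\<ell> (y \<otimes> v) = \<ell> y + \<ell> v"
proof -
  have "\<ell> (y \<otimes> word_prod W vs) = \<ell> y + length vs"
    if "vs \<in> lists I" "length vs = \<ell> (word_prod W vs)" for vs
    using that
  proof (induction vs rule: rev_induct)
    case Nil then show ?case using y by simp
  next
    case (snoc s vs)
    then have vs: "vs \<in> lists I" "vs \<in> lists S" "s \<in> I" "s \<in> S" using I by auto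
    let ?v = "word_prod W vs"
    have vI: "?v \<in> generate W I" using par_word I vs by blast
    have vc: "?v \<in> carrier W" using vs by simp
    have p: "word_prod W (vs @ [s]) = ?v \<otimes> s" using word_prod_append[of vs "[s]"] vs by simp
    have "Suc (length vs) \<le> \<ell> ?v + 1" using snoc(3) p len_mult_le[of ?v s] vs by simp
    then have l: "length vs = \<ell> ?v" using len_le[of vs] vs by simp
    then have IH: "\<ell> (y \<otimes> ?v) = \<ell> y + length vs" using snoc vs by blast
    have "s \<notin> rdesc (y \<otimes> ?v)"
    proof
      assume "s \<in> rdesc (y \<otimes> ?v)"
      then consider y' where "y' \<in> carrier W" "\<ell> y' < \<ell> y" "y \<otimes> ?v \<otimes> s = y' \<otimes> ?v" | "\<ell> (?v \<otimes> s) < \<ell> ?v"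
        using exchange_right_prod[of S y ?v s] y vc gens_generate by auto
      then show False
      proof cases
        case 1
        have "y' = y' \<otimes> ?v \<otimes> inv ?v" using 1(1) vc by (simp add: m_assoc)
        also have "\<dots> = y \<otimes> ?v \<otimes> s \<otimes> inv ?v" using 1(3) by simp
        also have "\<dots> = y \<otimes> (?v \<otimes> s \<otimes> inv ?v)" using y vc vs by (simp add: m_assoc)
        finally have "y' = y \<otimes> (?v \<otimes> s \<otimes> inv ?v)" .
        moreover have "?v \<otimes> s \<otimes> inv ?v \<in> generate W I" using vI vs I par_mult par_inv par_gen by metis
        ultimately show False using min 1 by fastforce
      next
        case 2
        then show False using l p snoc(3) by simp
      qed
    qed
    then show ?case using IH p len_gen_right(1)[of s "y \<otimes> ?v"] vs y vc by (simp add: m_assoc)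
  qed
  moreover obtain vs where "vs \<in> lists I" "word_prod W vs = v" "length vs = \<ell> v"
    using par_reduced_word I v by metis
  ultimately show ?thesis by metis
qed

lemma ex_rmin_decomp_add:
  assumes I: "I \<subseteq> S" and x: "x \<in> carrier W"
  shows "\<exists>y v. y \<in> carrier W \<and> v \<in> generate W I \<and> x = y \<otimes> v \<and> (\<forall>u \<in> generate W I. \<ell> (y \<otimes> u) = \<ell> y + \<ell> u)"
proof -
  let ?P = "\<lambda>y. \<exists>u \<in> generate W I. y = x \<otimes> u"
  have "?P x" using x by (intro bexI[of _ "\<one>"]) auto
  then obtain y where y: "?P y" and ymin: "\<And>y'. ?P y' \<Longrightarrow> \<ell> y \<le> \<ell> y'"
    using ex_has_least_nat[of ?P x \<ell>] by blast
  then obtain u where u: "u \<in> generate W I" "y = x \<otimes> u" by blast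
  have c: "u \<in> carrier W" "y \<in> carrier W" using u I x par_closed by auto
  have "\<ell> y \<le> \<ell> (y \<otimes> v)" if "v \<in> generate W I" for v
  proof (rule ymin)
    have "v \<in> carrier W" using that par_closed I by blast
    then have "y \<otimes> v = x \<otimes> (u \<otimes> v)" using u c x by (simp add: m_assoc)
    then show "?P (y \<otimes> v)" using u that par_mult by blast
  qed
  then have "\<forall>u \<in> generate W I. \<ell> (y \<otimes> u) = \<ell> y + \<ell> u" using coset_shortest_add[OF I c(2)] by blast
  moreover have "x = y \<otimes> inv u" using u c x by (simp add: m_assoc)
  moreover have "inv u \<in> generate W I" using u par_inv I by blast
  ultimately show ?thesis using c by blast
qed

lemma ex_rdesc:
  assumes I: "I \<subseteq> S" and v: "v \<in> generate W I" and "v \<noteq> \<one>"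
  shows "\<exists>s \<in> I. s \<in> rdesc v"
proof -
  obtain vs where vs: "vs \<in> lists I" "word_prod W vs = v" "length vs = \<ell> v"
    using par_reduced_word I v by metis
  then obtain us s where e: "vs = us @ [s]" using assms by (cases vs rule: rev_cases) auto
  then have us: "us \<in> lists S" "s \<in> I" "s \<in> S" using vs I by auto
  have "v = word_prod W us \<otimes> s" using e vs us word_prod_append[of us "[s]"] by auto
  then have "v \<otimes> s = word_prod W us" using us by simp
  then have "\<ell> (v \<otimes> s) < \<ell> v" using len_le[OF us(1)] e vs by simp
  then show ?thesis using us unfolding rdesc_def by blast
qed

lemma ex_ldesc:
  assumes I: "I \<subseteq> S" and v: "v \<in> generate W I" and "v \<noteq> \<one>"
  shows "\<exists>s \<in> I. s \<in> ldesc v"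
proof -
  have "v \<in> carrier W" using par_closed I v by blast
  then show ?thesis
    using ex_rdesc[of I "inv v"] par_inv[OF I v] rdesc_inv[of v] assms by auto
qed

text \<open>The coset \<open>y W\<^sub>I\<close> has a globally shortest element \<open>y\<^sub>0\<close>, for which lengths add. Writing \<open>y = y\<^sub>0 u\<close>,
  any last letter of \<open>u\<close> would be a right descent of \<open>y\<close> in \<open>I\<close>, so local minimality is global.\<close>
lemma rmin_add:
  assumes I: "I \<subseteq> S" and y: "rmin I y" and v: "v \<in> generate W I"
  shows "\<ell> (y \<otimes> v) = \<ell> y + \<ell> v"
proof -
  obtain y0 u where 0: "y0 \<in> carrier W" "u \<in> generate W I" "y = y0 \<otimes> u"
      "\<forall>u \<in> generate W I. \<ell> (y0 \<otimes> u) = \<ell> y0 + \<ell> u"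
    using ex_rmin_decomp_add[OF I rmin_closed[OF y]] by blast
  have "u = \<one>"
  proof (rule ccontr)
    assume "u \<noteq> \<one>"
    then obtain s where s: "s \<in> I" "s \<in> rdesc u" using ex_rdesc I 0 by blast
    then have "u \<otimes> s \<in> generate W I" using 0 par_mult par_gen by blast
    then have "\<ell> (y0 \<otimes> (u \<otimes> s)) < \<ell> (y0 \<otimes> u)" using 0 s unfolding rdesc_def by auto
    then have "s \<in> rdesc y" using s 0 I par_closed[OF I 0(2)] unfolding rdesc_def
      by (auto simp: m_assoc)
    then show False using y s unfolding rmin_def by blast
  qed
  then show ?thesis using 0 v by simp
qed

lemma rmin_alt:
  assumes I: "I \<subseteq> S" and y: "y \<in> carrier W" and add: "\<And>s. s \<in> I \<Longrightarrow> \<ell> y < \<ell> (y \<otimes> s)"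
  shows "rmin I y"
  unfolding rmin_def rdesc_def using assms by fastforce

lemma rmin_mono: "rmin I y \<Longrightarrow> I' \<subseteq> I \<Longrightarrow> rmin I' y"
  unfolding rmin_def by blast

lemma rmin_unique:
  assumes I: "I \<subseteq> S" and "rmin I y" "rmin I y'" "v \<in> generate W I" "y' = y \<otimes> v"
  shows "y' = y"
proof -
  have c: "v \<in> carrier W" using assms par_closed by blast
  have "\<ell> y' = \<ell> y + \<ell> v" using rmin_add[OF I assms(2,4)] assms by simp
  moreover have "y = y' \<otimes> inv v" using assms c by (simp add: m_assoc)
  then have "\<ell> y = \<ell> y' + \<ell> v" using rmin_add[OF I assms(3) par_inv[OF I assms(4)]] c by simp
  ultimately have "v = \<one>" using len_eq_0 c by simp
  then show ?thesis using assms by simp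
qed

lemma rdesc_par: 
  assumes I: "I \<subseteq> S" and v: "v \<in> generate W I" shows "rdesc v \<subseteq> I"
proof
  fix s assume s: "s \<in> rdesc v"
  then have sS: "s \<in> S" unfolding rdesc_def by blast
  have vc: "v \<in> carrier W" using par_closed I v by blast
  obtain vs where vs: "vs \<in> lists I" "word_prod W vs = v"
    using par_reduced_word I v by metis
  then have "vs \<in> lists S" using I by auto
  then obtain us t xs where e: "vs = us @ t # xs" "v \<otimes> s = word_prod W (us @ xs)"
    using right_exchange[OF sS] s vs by blast
  have "us @ xs \<in> lists I" using vs e by auto
  then have "inv v \<otimes> (v \<otimes> s) \<in> generate W I" using e par_word I par_inv par_mult v by metis
  then have "s \<in> generate W I" using vc sS by simp
  then show "s \<in> I" using par_simple I sS by simp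
qed

lemma ldesc_par: 
  assumes I: "I \<subseteq> S" and v: "v \<in> generate W I" shows "ldesc v \<subseteq> I"
  using rdesc_par[OF I par_inv[OF I v]] rdesc_inv par_closed[OF I v] by simp

lemma rdesc_rmin_mult:
  assumes M: "M \<subseteq> S" and z: "rmin M z" and v: "v \<in> generate W M"
  shows "rdesc (z \<otimes> v) \<inter> M = rdesc v"
proof -
  have vc: "v \<in> carrier W" using par_closed M v by blast
  have "s \<in> rdesc (z \<otimes> v) \<longleftrightarrow> s \<in> rdesc v" if s: "s \<in> M" for s
  proof -
    have "v \<otimes> s \<in> generate W M" using v s par_mult par_gen by blast
    then have "\<ell> (z \<otimes> v \<otimes> s) = \<ell> z + \<ell> (v \<otimes> s)" "\<ell> (z \<otimes> v) = \<ell> z + \<ell> v"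
      using rmin_add[OF M z] v s M z vc by (auto simp: m_assoc subset_iff)
    then show ?thesis unfolding rdesc_def by auto
  qed
  then show ?thesis using rdesc_par[OF M v] by blast
qed

lemma rmin_rmin_mult:
  assumes "M \<subseteq> S" "rmin M z" "v \<in> generate W M" "A \<subseteq> M"
  shows "rmin A (z \<otimes> v) \<longleftrightarrow> rmin A v"
  using rdesc_rmin_mult[OF assms(1-3)] assms par_closed[OF assms(1,3)] unfolding rmin_def by auto

lemma ldesc_rmin_mult:
  assumes "M \<subseteq> S" "rmin M z" "v \<in> generate W M" "j \<in> ldesc z"
  shows "j \<in> ldesc (z \<otimes> v)"
proof -
  have c: "j \<in> S" "v \<in> carrier W" using assms par_closed unfolding ldesc_def by auto
  have "\<ell> (j \<otimes> z \<otimes> v) \<le> \<ell> (j \<otimes> z) + \<ell> v" using len_mult_le c assms by simp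
  also have "\<dots> < \<ell> (z \<otimes> v)" using rmin_add[OF assms(1-3)] assms(4) unfolding ldesc_def by simp
  finally show ?thesis using c assms unfolding ldesc_def by (simp add: m_assoc)
qed

text \<open>Reduced words of \<open>y\<close> and \<open>v\<close> combine to one of \<open>y v\<close>, and exchange for \<open>j\<close> deletes a letter of
  either part. In the second case \<open>j\<close> passes through \<open>y\<close> as a simple reflection \<open>r\<close>; this is the source
  of the redundancy of a double coset.\<close>
lemma ldesc_rmin_cases:
  assumes I: "I \<subseteq> S" and y: "rmin I y" and v: "v \<in> generate W I" and j: "j \<in> ldesc (y \<otimes> v)"
  shows "j \<in> ldesc y \<or> (\<exists>r \<in> I. j \<otimes> y = y \<otimes> r \<and> r \<in> ldesc v)"
proof -
  have jS: "j \<in> S" using j unfolding ldesc_def by blast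
  have c: "v \<in> carrier W" "y \<in> carrier W" using par_closed I v y by auto
  show ?thesis
  proof (cases "j \<in> ldesc y")
    case False
    then obtain v' where v': "v' \<in> generate W I" "\<ell> v' < \<ell> v" "j \<otimes> y \<otimes> v = y \<otimes> v'"
      using exchange_left_prod[OF I c(2) v j] jS unfolding ldesc_def by blast
    have c': "v' \<in> carrier W" using par_closed I v' by blast
    let ?r = "v' \<otimes> inv v"
    have r: "?r \<in> generate W I" using v v' I par_mult par_inv by metis
    have "j \<otimes> y \<otimes> v \<otimes> inv v = y \<otimes> v' \<otimes> inv v" using v' by simp
    then have e: "j \<otimes> y = y \<otimes> ?r" using c c' jS by (simp add: m_assoc)
    have "\<ell> y + \<ell> ?r = \<ell> y + 1"
      using rmin_add[OF I y r] e len_gen_left(1)[OF jS c(2)] False by simp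
    then have "?r \<in> I" using par_simple[OF I r] by simp
    moreover have "?r \<otimes> v = v'" using c c' by (simp add: m_assoc)
    then have "?r \<in> ldesc v" using v' \<open>?r \<in> I\<close> I unfolding ldesc_def by auto
    ultimately show ?thesis using e by blast
  qed simp
qed

lemma ldesc_transport:
  assumes I: "I \<subseteq> S" and y: "rmin I y" and v: "v \<in> generate W I" and j: "j \<in> S"
    and r: "r \<in> ldesc v" "j \<otimes> y = y \<otimes> r"
  shows "j \<in> ldesc (y \<otimes> v)"
proof -
  have rI: "r \<in> I" using r ldesc_par I v by blast
  have c: "v \<in> carrier W" "r \<in> carrier W" "y \<in> carrier W" using par_closed I v rI y by auto
  have "j \<otimes> (y \<otimes> v) = y \<otimes> (r \<otimes> v)" using r c j by (simp add: m_assoc[symmetric])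
  moreover have "r \<otimes> v \<in> generate W I" using v rI par_mult par_gen by blast
  ultimately have "\<ell> (j \<otimes> (y \<otimes> v)) < \<ell> (y \<otimes> v)"
    using rmin_add[OF I y] v r unfolding ldesc_def by simp
  then show ?thesis using j unfolding ldesc_def by blast
qed

section \<open>Longest elements\<close>

text \<open>A reduced word of \<open>u\<close> is made a prefix of a reduced word of \<open>v\<close> by passing from each suffix \<open>U\<close> of
  it to the next longer one. If \<open>v = U a\<close> and the next letter is \<open>t\<close>, which is a left descent of \<open>v\<close>, then
  exchange cannot delete a letter of \<open>U\<close>, because \<open>t U\<close> is reduced; so it shortens \<open>a\<close>.\<close>
lemma ldesc_strip:
  assumes I: "I \<subseteq> S" and v: "v \<in> carrier W" and d: "I \<subseteq> ldesc v" and u: "u \<in> generate W I"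
  shows "\<ell> v = \<ell> u + \<ell> (inv u \<otimes> v)"
proof -
  have *: "\<exists>a \<in> carrier W. v = word_prod W us \<otimes> a \<and> \<ell> v = length us + \<ell> a"
    if "us \<in> lists I" "length us = \<ell> (word_prod W us)" for us
    using that
  proof (induction us rule: list.induct)
    case (Cons t us)
    then have t: "t \<in> I" "t \<in> S" "us \<in> lists I" "us \<in> lists S" using I by auto
    let ?U = "word_prod W us"
    have "length us = \<ell> ?U" using Cons.prems(2) len_le[OF t(4)] len_mult_le[of t ?U] t by simp
    then obtain a where a: "a \<in> carrier W" "v = ?U \<otimes> a" "\<ell> v = length us + \<ell> a" using Cons t by blast
    have "a \<in> generate W S" using a gens_generate by simp
    moreover have "\<not> \<ell> (t \<otimes> ?U) < \<ell> ?U" using Cons.prems(2) \<open>length us = \<ell> ?U\<close> by simp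
    moreover have "t \<in> ldesc (?U \<otimes> a)" using t d a by blast
    ultimately obtain a' where a': "a' \<in> generate W S" "\<ell> a' < \<ell> a" "t \<otimes> ?U \<otimes> a = ?U \<otimes> a'"
      using exchange_left_prod[of S ?U a t] t by auto
    have c: "a' \<in> carrier W" using a' gens_generate by simp
    have "t \<otimes> (t \<otimes> ?U \<otimes> a) = t \<otimes> ?U \<otimes> a'" using a' t a c by (simp add: m_assoc)
    then have e: "v = t \<otimes> ?U \<otimes> a'" using a t by (simp add: m_assoc)
    moreover have "\<ell> v \<le> \<ell> (t \<otimes> ?U) + \<ell> a'" unfolding e using len_mult_le c t by simp
    ultimately show ?case using c a a' Cons.prems(2) by (intro bexI[of _ a']) auto
  next
    case Nil
    then show ?case using v by (intro bexI[of _ v]) auto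
  qed
  obtain us where us: "us \<in> lists I" "word_prod W us = u" "length us = \<ell> u"
    using par_reduced_word I u by metis
  obtain a where "a \<in> carrier W" "v = u \<otimes> a" "\<ell> v = \<ell> u + \<ell> a" using *[of us] us by auto
  then show ?thesis using par_closed[OF I u] by simp
qed

lemma rdesc_strip:
  assumes I: "I \<subseteq> S" and v: "v \<in> carrier W" and d: "I \<subseteq> rdesc v" and u: "u \<in> generate W I"
  shows "\<ell> (v \<otimes> u) + \<ell> u = \<ell> v"
proof -
  have c: "u \<in> carrier W" using par_closed I u by blast
  have "\<ell> (inv v) = \<ell> u + \<ell> (inv u \<otimes> inv v)" using ldesc_strip[OF I _ _ u] ldesc_inv v d by simp
  moreover have "\<ell> (inv u \<otimes> inv v) = \<ell> (v \<otimes> u)" using len_inv[of "v \<otimes> u"] v c by (simp add: inv_mult_group)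
  ultimately show ?thesis using v by simp
qed

text \<open>Since every element of \<open>W\<^sub>I\<close> can be stripped from \<open>v\<close>, its length is at most that of \<open>v\<close>.\<close>
lemma finitaryI:
  assumes "I \<subseteq> S" "finite I" "v \<in> carrier W" "I \<subseteq> rdesc v"
  shows "finitary I"
proof -
  have "generate W I \<subseteq> word_prod W ` {ws. set ws \<subseteq> I \<and> length ws \<le> \<ell> v}"
  proof
    fix x assume x: "x \<in> generate W I"
    then obtain vs where "vs \<in> lists I" "word_prod W vs = x" "length vs = \<ell> x"
      using par_reduced_word assms by metis
    moreover have "\<ell> x \<le> \<ell> v" using rdesc_strip[OF assms(1,3,4) x] by simp
    ultimately show "x \<in> word_prod W ` {ws. set ws \<subseteq> I \<and> length ws \<le> \<ell> v}" by force
  qed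
  then show ?thesis using finite_lists_length_le[OF assms(2)] finite_surj assms
    unfolding finitary_def by blast
qed

lemma finitary_sub: "finitary I \<Longrightarrow> I \<subseteq> S"
  unfolding finitary_def by blast

lemma finitary_finite: "finitary I \<Longrightarrow> finite I"
  unfolding finitary_def using par_gen finite_subset by (metis subsetI)

lemma finitary_mono: "finitary I \<Longrightarrow> I' \<subseteq> I \<Longrightarrow> finitary I'"
  unfolding finitary_def using mono_generate[of I' I] finite_subset by fastforce

lemma longest_char:
  assumes I: "finitary I" and w: "w \<in> generate W I" and d: "I \<subseteq> ldesc w"
  shows "longest I = w"
proof -
  have IS: "I \<subseteq> S" using I finitary_sub by blast
  have wc: "w \<in> carrier W" using par_closed IS w by blast
  have le: "\<ell> v \<le> \<ell> w \<and> (\<ell> v = \<ell> w \<longrightarrow> v = w)" if v: "v \<in> generate W I" for v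
  proof -
    have c: "v \<in> carrier W" using par_closed IS v by blast
    have *: "\<ell> w = \<ell> v + \<ell> (inv v \<otimes> w)" using ldesc_strip[OF IS wc d v] .
    have "\<ell> v = \<ell> w \<Longrightarrow> inv v \<otimes> w = \<one>" using * len_eq_0[of "inv v \<otimes> w"] c wc by simp
    then have "\<ell> v = \<ell> w \<Longrightarrow> v = w" using c wc by (metis inv_cancel_left' r_one)
    then show ?thesis using * by simp
  qed
  show ?thesis unfolding longest_def using w le by (intro the_equality) (auto intro: le_antisym)
qed

lemma longest_props:
  assumes I: "finitary I"
  shows longest_in: "longest I \<in> generate W I" and longest_ldesc: "ldesc (longest I) = I"
    and longest_inv: "inv (longest I) = longest I"
proof -
  have IS: "I \<subseteq> S" using I finitary_sub by blast
  have fin: "finite (generate W I)" using I unfolding finitary_def by blast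
  have "generate W I \<noteq> {}" using par_one by blast
  then have "Max (\<ell> ` generate W I) \<in> \<ell> ` generate W I" using fin by (intro Max_in) auto
  then obtain w where w: "w \<in> generate W I" "\<ell> w = Max (\<ell> ` generate W I)" by auto
  have w: "w \<in> generate W I" "\<And>v. v \<in> generate W I \<Longrightarrow> \<ell> v \<le> \<ell> w"
    using w fin by auto
  have wc: "w \<in> carrier W" using par_closed IS w by blast
  have d: "I \<subseteq> ldesc v" if "v \<in> generate W I" "\<ell> v = \<ell> w" for v
  proof
    fix s assume s: "s \<in> I"
    have "s \<otimes> v \<in> generate W I" using s that par_gen par_mult by blast
    then have "\<ell> (s \<otimes> v) \<le> \<ell> v" using w that by simp
    then show "s \<in> ldesc v" using len_gen_left(1)[of s v] s IS par_closed[OF IS that(1)]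
      by (auto split: if_splits)
  qed
  have e: "longest I = w" using longest_char[OF I w(1)] d w by simp
  then show "longest I \<in> generate W I" using w by simp
  show "ldesc (longest I) = I" using e d[OF w(1)] ldesc_par[OF IS w(1)] by auto
  have "longest I = inv w" using longest_char[OF I par_inv[OF IS w(1)]] d[OF par_inv[OF IS w(1)]] wc by simp
  then show "inv (longest I) = longest I" using e by simp
qed

lemma longest_closed [simp]: "finitary I \<Longrightarrow> longest I \<in> carrier W"
  using longest_in par_closed finitary_sub by blast

lemma longest_rdesc: "finitary I \<Longrightarrow> rdesc (longest I) = I"
  using longest_ldesc longest_inv ldesc_inv longest_closed by metis

lemma longest_sq [simp]: "finitary I \<Longrightarrow> longest I \<otimes> longest I = \<one>"
  using l_inv[OF longest_closed] longest_inv by simp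

lemma longest_cancel [simp]: "finitary I \<Longrightarrow> x \<in> carrier W \<Longrightarrow> longest I \<otimes> (longest I \<otimes> x) = x"
  by (simp add: m_assoc[symmetric])

lemma longest_cancel_right [simp]: "finitary I \<Longrightarrow> x \<in> carrier W \<Longrightarrow> x \<otimes> longest I \<otimes> longest I = x"
  by (simp add: m_assoc)

lemma len_longest_mult: 
  assumes I: "finitary I" and v: "v \<in> generate W I"
  shows "\<ell> (longest I \<otimes> v) + \<ell> v = \<ell> (longest I)" "\<ell> (v \<otimes> longest I) + \<ell> v = \<ell> (longest I)"
proof -
  have IS: "I \<subseteq> S" using I finitary_sub by blast
  have c: "v \<in> carrier W" using par_closed IS v by blast
  show "\<ell> (longest I \<otimes> v) + \<ell> v = \<ell> (longest I)"
    using rdesc_strip[OF IS longest_closed[OF I] _ v] longest_rdesc[OF I] by simp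
  have "\<ell> (longest I) = \<ell> (inv v) + \<ell> (v \<otimes> longest I)"
    using ldesc_strip[OF IS longest_closed[OF I] _ par_inv[OF IS v]] longest_ldesc[OF I] c by simp
  then show "\<ell> (v \<otimes> longest I) + \<ell> v = \<ell> (longest I)" using c by simp
qed

lemma len_longest_ge: "finitary I \<Longrightarrow> v \<in> generate W I \<Longrightarrow> \<ell> v \<le> \<ell> (longest I)"
  using len_longest_mult(1) by (metis le_add2)

lemma longest_unique:
  assumes "finitary I" "v \<in> generate W I" "\<ell> v = \<ell> (longest I)" shows "v = longest I"
proof -
  have c: "v \<in> carrier W" using par_closed finitary_sub assms by blast
  have "\<ell> (longest I \<otimes> v) = 0" using len_longest_mult(1)[OF assms(1,2)] assms(3) by simp
  then have "longest I \<otimes> v = \<one>" using len_eq_0 assms c by simp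
  then show ?thesis using assms c by (metis longest_cancel longest_closed r_one)
qed

lemma longest_eq_of_rdesc:
  assumes "finitary I" "v \<in> generate W I" "I \<subseteq> rdesc v" shows "v = longest I"
proof -
  have c: "v \<in> carrier W" "I \<subseteq> S" using par_closed finitary_sub assms by blast+
  have "longest I = inv v" using longest_char[OF assms(1) par_inv[OF c(2) assms(2)]] ldesc_inv c assms by simp
  then show ?thesis using longest_inv[OF assms(1)] c by (metis inv_inv)
qed

lemma rmin_strip:
  assumes I: "finitary I" and x: "x \<in> carrier W" "I \<subseteq> rdesc x"
  shows "rmin I (x \<otimes> longest I)"
proof (rule rmin_alt)
  show IS: "I \<subseteq> S" using I finitary_sub by blast
  show "x \<otimes> longest I \<in> carrier W" using I x by simp
  fix s assume s: "s \<in> I"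
  have sS: "s \<in> S" using s IS by blast
  have ws: "longest I \<otimes> s \<in> generate W I" using s I longest_in par_mult par_gen by blast
  have "s \<in> rdesc (longest I)" using longest_rdesc I s by blast
  then have "\<ell> (longest I \<otimes> s) < \<ell> (longest I)" unfolding rdesc_def by blast
  then show "\<ell> (x \<otimes> longest I) < \<ell> (x \<otimes> longest I \<otimes> s)"
    using rdesc_strip[OF IS x ws] rdesc_strip[OF IS x longest_in[OF I]] x I sS by (simp add: m_assoc)
qed

lemma rmin_longest_rdesc:
  assumes I: "finitary I" and y: "rmin I y" shows "I \<subseteq> rdesc (y \<otimes> longest I)"
  using rdesc_rmin_mult[OF finitary_sub[OF I] y longest_in[OF I]] longest_rdesc[OF I] by blast

lemma conj_longest_closed [simp]: "finitary M \<Longrightarrow> x \<in> carrier W \<Longrightarrow> conj_longest M x \<in> carrier W"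
  unfolding conj_longest_def by simp

lemma conj_longest_invol [simp]: "finitary M \<Longrightarrow> x \<in> carrier W \<Longrightarrow> conj_longest M (conj_longest M x) = x"
  unfolding conj_longest_def by (simp add: m_assoc)

lemma conj_longest_mult:
  "finitary M \<Longrightarrow> x \<in> carrier W \<Longrightarrow> y \<in> carrier W \<Longrightarrow>
    conj_longest M (x \<otimes> y) = conj_longest M x \<otimes> conj_longest M y"
  unfolding conj_longest_def by (simp add: m_assoc)

lemma conj_longest_swap:
  "finitary M \<Longrightarrow> x \<in> carrier W \<Longrightarrow> longest M \<otimes> x = conj_longest M x \<otimes> longest M"
  unfolding conj_longest_def by (simp add: m_assoc)

lemma len_conj_longest:
  assumes M: "finitary M" and v: "v \<in> generate W M"
  shows "conj_longest M v \<in> generate W M" "\<ell> (conj_longest M v) = \<ell> v"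
proof -
  have wv: "longest M \<otimes> v \<in> generate W M" using M v longest_in par_mult by blast
  then show "conj_longest M v \<in> generate W M"
    unfolding conj_longest_def using M longest_in par_mult by blast
  show "\<ell> (conj_longest M v) = \<ell> v" unfolding conj_longest_def
    using len_longest_mult(2)[OF M wv] len_longest_mult(1)[OF M v] by simp
qed

lemma conj_longest_in: "finitary M \<Longrightarrow> s \<in> M \<Longrightarrow> conj_longest M s \<in> M"
  using len_conj_longest[of M s] par_gen[of s M] par_simple[of M] finitary_sub[of M] by auto

lemma conj_longest_inj:
  "finitary M \<Longrightarrow> x \<in> carrier W \<Longrightarrow> y \<in> carrier W \<Longrightarrow> conj_longest M x = conj_longest M y \<longleftrightarrow> x = y"
  by (metis conj_longest_invol)

lemma conj_longest_image [simp]: "finitary M \<Longrightarrow> conj_longest M ` M = M"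
  using conj_longest_in finitary_sub[of M] by (auto simp: image_iff) (metis conj_longest_invol gen_closed subsetD)

lemma conj_longest_par:
  assumes M: "finitary M" and A: "A \<subseteq> M" and v: "v \<in> generate W A"
  shows "conj_longest M v \<in> generate W (conj_longest M ` A)"
  using v
proof (induction rule: generate.induct)
  case one
  then show ?case using M by (simp add: conj_longest_def)
next
  case (incl h)
  then show ?case by (intro par_gen) simp
next
  case (inv h)
  have "inv h = h" using inv A finitary_sub[OF M] by auto
  then show ?case using inv by (intro par_gen) simp
next
  case (eng h1 h2)
  have "A \<subseteq> S" using A finitary_sub[OF M] by blast
  then have "h1 \<in> carrier W" "h2 \<in> carrier W" using eng par_closed by auto
  then show ?case using conj_longest_mult[OF M] eng par_mult by metis
qed

lemma conj_longest_longest: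
  assumes M: "finitary M" and A: "A \<subseteq> M"
  shows "conj_longest M (longest A) = longest (conj_longest M ` A)"
proof (rule longest_char[symmetric])
  have fA: "finitary A" using finitary_mono M A by blast
  have "conj_longest M ` A \<subseteq> M" using conj_longest_in[OF M] A by blast
  then show "finitary (conj_longest M ` A)" using finitary_mono M by blast
  show "conj_longest M (longest A) \<in> generate W (conj_longest M ` A)"
    using conj_longest_par[OF M A longest_in[OF fA]] .
  show "conj_longest M ` A \<subseteq> ldesc (conj_longest M (longest A))"
  proof (rule image_subsetI)
    fix s assume s: "s \<in> A"
    have AM: "x \<in> generate W A \<Longrightarrow> x \<in> generate W M" for x using par_mono A by blast
    have sS: "s \<in> S" using s A finitary_sub[OF M] by blast
    have sw: "s \<otimes> longest A \<in> generate W A" using par_mult par_gen s longest_in[OF fA] by blast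
    have "\<ell> (conj_longest M s \<otimes> conj_longest M (longest A)) = \<ell> (s \<otimes> longest A)"
      using len_conj_longest(2)[OF M AM[OF sw]] conj_longest_mult[OF M] sS fA by simp
    also have "\<dots> < \<ell> (longest A)" using longest_ldesc[OF fA] s unfolding ldesc_def by blast
    also have "\<dots> = \<ell> (conj_longest M (longest A))" using len_conj_longest(2)[OF M AM[OF longest_in[OF fA]]] by simp
    finally show "conj_longest M s \<in> ldesc (conj_longest M (longest A))"
      using conj_longest_in[OF M] s A finitary_sub[OF M] unfolding ldesc_def by auto
  qed
qed


section \<open>Double cosets\<close>

definition dcoset :: "'a set \<Rightarrow> 'a \<Rightarrow> 'a set \<Rightarrow> 'a set" where
  "dcoset J x I = {a \<otimes> x \<otimes> b | a b. a \<in> generate W J \<and> b \<in> generate W I}"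

lemma is_coset_iff: "is_coset J I p \<longleftrightarrow> (\<exists>x \<in> carrier W. p = dcoset J x I)"
  unfolding is_coset_def dcoset_def ..

lemma dcosetI: "a \<in> generate W J \<Longrightarrow> b \<in> generate W I \<Longrightarrow> a \<otimes> x \<otimes> b \<in> dcoset J x I"
  unfolding dcoset_def by blast

lemma dcoset_self: "x \<in> carrier W \<Longrightarrow> x \<in> dcoset J x I"
  using dcosetI[of \<one> J \<one> I x] by simp

lemma dcoset_right: "x \<in> carrier W \<Longrightarrow> b \<in> generate W I \<Longrightarrow> x \<otimes> b \<in> dcoset J x I"
  using dcosetI[of \<one> J b I x] by simp

lemma dcoset_left: "J \<subseteq> S \<Longrightarrow> x \<in> carrier W \<Longrightarrow> a \<in> generate W J \<Longrightarrow> a \<otimes> x \<in> dcoset J x I"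
  using dcosetI[of a J \<one> I x] par_closed by simp

lemma dcoset_closed: "J \<subseteq> S \<Longrightarrow> I \<subseteq> S \<Longrightarrow> x \<in> carrier W \<Longrightarrow> y \<in> dcoset J x I \<Longrightarrow> y \<in> carrier W"
  unfolding dcoset_def using par_closed by auto

lemma dcoset_trans:
  assumes "J \<subseteq> S" "I \<subseteq> S" "x \<in> carrier W" "y \<in> dcoset J x I" "u \<in> dcoset J y I"
  shows "u \<in> dcoset J x I"
proof -
  obtain a b where 1: "y = a \<otimes> x \<otimes> b" "a \<in> generate W J" "b \<in> generate W I"
    using assms unfolding dcoset_def by blast
  obtain c d where 2: "u = c \<otimes> y \<otimes> d" "c \<in> generate W J" "d \<in> generate W I"
    using assms unfolding dcoset_def by blast
  have "a \<in> carrier W" "b \<in> carrier W" "c \<in> carrier W" "d \<in> carrier W"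
    using 1 2 par_closed assms by auto
  then have "u = (c \<otimes> a) \<otimes> x \<otimes> (b \<otimes> d)" using 1 2 assms by (simp add: m_assoc)
  then show ?thesis using 1 2 dcosetI par_mult by metis
qed

lemma dcoset_sym:
  assumes "J \<subseteq> S" "I \<subseteq> S" "x \<in> carrier W" "y \<in> dcoset J x I"
  shows "x \<in> dcoset J y I"
proof -
  obtain a b where 1: "y = a \<otimes> x \<otimes> b" "a \<in> generate W J" "b \<in> generate W I"
    using assms unfolding dcoset_def by blast
  have "a \<in> carrier W" "b \<in> carrier W" using 1 par_closed assms by auto
  then have "x = inv a \<otimes> y \<otimes> inv b" using 1 assms by (simp add: m_assoc)
  then show ?thesis using 1 dcosetI par_inv assms by metis
qed

lemma dcoset_eq:
  assumes "J \<subseteq> S" "I \<subseteq> S" "x \<in> carrier W" "y \<in> dcoset J x I"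
  shows "dcoset J y I = dcoset J x I"
  using dcoset_trans[OF assms(1-3)] dcoset_sym[OF assms(1-3)] dcoset_closed[OF assms(1-3)]
    dcoset_trans[OF assms(1,2)] assms by blast

lemma is_coset_unique:
  assumes "J \<subseteq> S" "I \<subseteq> S" "y \<in> carrier W"
  shows "is_coset J I q \<and> y \<in> q \<longleftrightarrow> q = dcoset J y I"
  using dcoset_eq[OF assms(1,2)] dcoset_self assms unfolding is_coset_iff by metis

lemma dcoset_mono: "I \<subseteq> I' \<Longrightarrow> dcoset J x I \<subseteq> dcoset J x I'"
  unfolding dcoset_def using par_mono by blast

lemma lmin_add:
  assumes J: "J \<subseteq> S" and z: "z \<in> carrier W" "J \<inter> ldesc z = {}" and a: "a \<in> generate W J"
  shows "\<ell> (a \<otimes> z) = \<ell> a + \<ell> z"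
proof -
  have "rmin J (inv z)" using z rdesc_inv unfolding rmin_def by simp
  then have "\<ell> (inv z \<otimes> inv a) = \<ell> (inv z) + \<ell> (inv a)" using rmin_add J par_inv a by blast
  then show ?thesis using len_inv[of "a \<otimes> z"] par_closed[OF J a] z by (simp add: inv_mult_group)
qed

text \<open>The element \<open>z\<close> is the minimal element of the double coset \<open>p\<close>, in the strong sense that
  all members factor through \<open>z\<close> with additive lengths.\<close>
definition splits_coset :: "'a set \<Rightarrow> 'a set \<Rightarrow> 'a \<Rightarrow> 'a set \<Rightarrow> bool" where
  "splits_coset J I z p \<longleftrightarrow> z \<in> p \<and> (\<forall>y \<in> p. \<exists>a \<in> generate W J. \<exists>b \<in> generate W I.
      y = a \<otimes> z \<otimes> b \<and> \<ell> y = \<ell> a + \<ell> z + \<ell> b)"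

text \<open>Take \<open>z\<close> of minimal length. A word for \<open>a z b\<close> composed of words for the three factors contains a
  reduced subword, and this subword must keep every letter of \<open>z\<close>, since otherwise it would exhibit a shorter
  element of the double coset.\<close>
lemma ex_splits_coset:
  assumes J: "J \<subseteq> S" and I: "I \<subseteq> S" and x: "x \<in> carrier W"
  shows "\<exists>z. splits_coset J I z (dcoset J x I)"
proof -
  obtain z where z: "z \<in> dcoset J x I" "\<And>y. y \<in> dcoset J x I \<Longrightarrow> \<ell> z \<le> \<ell> y"
    using ex_has_least_nat[of "\<lambda>y. y \<in> dcoset J x I" x \<ell>] dcoset_self[OF x] by blast
  have zc: "z \<in> carrier W" using dcoset_closed[OF J I x z(1)] .
  have eq: "dcoset J z I = dcoset J x I" using dcoset_eq[OF J I x z(1)] .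
  obtain zs where zs: "zs \<in> lists S" "word_prod W zs = z" "length zs = \<ell> z"
    using ex_reduced_word zc by metis
  have "\<exists>a \<in> generate W J. \<exists>b \<in> generate W I. y = a \<otimes> z \<otimes> b \<and> \<ell> y = \<ell> a + \<ell> z + \<ell> b"
    if y: "y \<in> dcoset J x I" for y
  proof -
    obtain a b where ab: "y = a \<otimes> z \<otimes> b" "a \<in> generate W J" "b \<in> generate W I"
      using y eq unfolding dcoset_def by blast
    obtain as where as: "as \<in> lists J" "word_prod W as = a" using par_reduced_word J ab by metis
    obtain bs where bs: "bs \<in> lists I" "word_prod W bs = b" using par_reduced_word I ab by metis
    have asS: "as \<in> lists S" and bsS: "bs \<in> lists S" using as bs I J lists_mono by blast+
    have zbS: "zs @ bs \<in> lists S" using bsS zs by simp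
    have w: "as @ zs @ bs \<in> lists S" "word_prod W (as @ zs @ bs) = y"
      using asS bsS zs as bs ab zc par_closed[OF J] par_closed[OF I]
        word_prod_append[OF asS zbS] word_prod_append[OF zs(1) bsS] by (auto simp: m_assoc)
    obtain vs where vs: "subseq vs (as @ zs @ bs)" "word_prod W vs = y" "length vs = \<ell> y"
      using reduced_subword[OF w(1)] unfolding w(2) by blast
    obtain as' zs' bs' where s: "vs = as' @ zs' @ bs'" "subseq as' as" "subseq zs' zs" "subseq bs' bs"
      using vs(1) by (auto simp: subseq_append_iff)
    have L: "as' \<in> lists J" "zs' \<in> lists S" "bs' \<in> lists I" using s as bs zs subseq_in_lists by blast+
    have LS: "as' \<in> lists S" "bs' \<in> lists S" using L I J lists_mono by blast+
    let ?a = "word_prod W as'" and ?z = "word_prod W zs'" and ?b = "word_prod W bs'"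
    have zb': "zs' @ bs' \<in> lists S" using L LS by simp
    have y': "y = ?a \<otimes> ?z \<otimes> ?b" using vs(2) s(1) L LS
      word_prod_append[OF LS(1) zb'] word_prod_append[OF L(2) LS(2)] by (simp add: m_assoc)
    have ga: "?a \<in> generate W J" "?b \<in> generate W I" using par_word I J L by blast+
    have "y \<in> dcoset J ?z I" using ga dcosetI unfolding y' by blast
    then have "?z \<in> dcoset J y I" using dcoset_sym J I L by simp
    then have "?z \<in> dcoset J x I" using dcoset_trans J I x y by blast
    then have "\<ell> z \<le> \<ell> ?z" using z by blast
    then have "length zs \<le> length zs'" using zs len_le[OF L(2)] by simp
    then have "zs' = zs" using s(3) by (metis list_emb_length le_antisym subseq_same_length)
    then have zz: "?z = z" using zs by simp
    have "\<ell> y = length as' + length zs' + length bs'" using vs s by simp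
    then have "\<ell> y \<ge> \<ell> ?a + \<ell> z + \<ell> ?b"
      using len_le[OF LS(1)] len_le[OF LS(2)] zs \<open>zs' = zs\<close> by simp
    moreover have "\<ell> y \<le> \<ell> ?a + \<ell> z + \<ell> ?b" unfolding y' zz
      using len_mult_le[of "?a \<otimes> z" ?b] len_mult_le[of ?a z] LS zc by simp
    ultimately show ?thesis using ga y' zz by (intro bexI[of _ ?a] bexI[of _ ?b]) auto
  qed
  then show ?thesis using z unfolding splits_coset_def by blast
qed

lemma splits_coset_props:
  assumes J: "J \<subseteq> S" and I: "I \<subseteq> S" and x: "x \<in> carrier W" and z: "splits_coset J I z (dcoset J x I)"
  shows splits_coset_closed: "z \<in> carrier W" and splits_coset_eq: "dcoset J z I = dcoset J x I"
    and splits_coset_lmin: "J \<inter> ldesc z = {}" and splits_coset_rmin: "rmin I z"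
proof -
  have zp: "z \<in> dcoset J x I" using z unfolding splits_coset_def by blast
  show zc: "z \<in> carrier W" using dcoset_closed[OF J I x zp] .
  show eq: "dcoset J z I = dcoset J x I" using dcoset_eq[OF J I x zp] .
  have min: "\<ell> z \<le> \<ell> y" if "y \<in> dcoset J z I" for y
  proof -
    have "y \<in> dcoset J x I" using that eq by simp
    then have "\<exists>a b. \<ell> y = \<ell> a + \<ell> z + \<ell> b" using z unfolding splits_coset_def by meson
    then show ?thesis by auto
  qed
  show "J \<inter> ldesc z = {}"
  proof (intro equals0I)
    fix s assume "s \<in> J \<inter> ldesc z"
    then show False using min[of "s \<otimes> z"] dcoset_left[OF J zc par_gen, of s I] unfolding ldesc_def by auto
  qed
  show "rmin I z" unfolding rmin_def
  proof (intro conjI zc equals0I)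
    fix s assume "s \<in> I \<inter> rdesc z"
    then show False using min[of "z \<otimes> s"] dcoset_right[OF zc par_gen, of s I J] unfolding rdesc_def by auto
  qed
qed

lemma splits_coset_add_left:
  assumes "J \<subseteq> S" "a \<in> generate W J" "z \<in> carrier W" "b \<in> carrier W"
    and "\<ell> (a \<otimes> z \<otimes> b) = \<ell> a + \<ell> z + \<ell> b" "J \<inter> ldesc (a \<otimes> z \<otimes> b) = {}"
  shows "a = \<one>"
proof (rule ccontr)
  assume "a \<noteq> \<one>"
  then obtain s where s: "s \<in> J" "s \<in> ldesc a" using ex_ldesc assms by blast
  have sS: "s \<in> S" "a \<in> carrier W" using s assms par_closed by auto
  have "\<ell> (s \<otimes> (a \<otimes> z \<otimes> b)) = \<ell> ((s \<otimes> a) \<otimes> z \<otimes> b)" using sS assms by (simp add: m_assoc)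
  also have "\<dots> \<le> \<ell> (s \<otimes> a) + \<ell> z + \<ell> b"
    using len_mult_le[of "s \<otimes> a \<otimes> z" b] len_mult_le[of "s \<otimes> a" z] sS assms by simp
  also have "\<dots> < \<ell> (a \<otimes> z \<otimes> b)" using s assms unfolding ldesc_def by auto
  finally show False using assms s sS unfolding ldesc_def by blast
qed

lemma splits_coset_add_right:
  assumes "I \<subseteq> S" "b \<in> generate W I" "z \<in> carrier W" "a \<in> carrier W"
    and "\<ell> (a \<otimes> z \<otimes> b) = \<ell> a + \<ell> z + \<ell> b" "I \<inter> rdesc (a \<otimes> z \<otimes> b) = {}"
  shows "b = \<one>"
proof (rule ccontr)
  assume "b \<noteq> \<one>"
  then obtain s where s: "s \<in> I" "s \<in> rdesc b" using ex_rdesc assms by blast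
  have sS: "s \<in> S" "b \<in> carrier W" using s assms par_closed by auto
  have "\<ell> (a \<otimes> z \<otimes> b \<otimes> s) = \<ell> (a \<otimes> z \<otimes> (b \<otimes> s))" using sS assms by (simp add: m_assoc)
  also have "\<dots> \<le> \<ell> a + \<ell> z + \<ell> (b \<otimes> s)"
    using len_mult_le[of "a \<otimes> z" "b \<otimes> s"] len_mult_le[of a z] sS assms by simp
  also have "\<dots> < \<ell> (a \<otimes> z \<otimes> b)" using s assms unfolding rdesc_def by auto
  finally show False using assms s sS unfolding rdesc_def by blast
qed

lemma locmin_unique:
  assumes J: "J \<subseteq> S" and I: "I \<subseteq> S" and x: "x \<in> carrier W" and z: "splits_coset J I z (dcoset J x I)"
    and y: "y \<in> dcoset J x I" "J \<inter> ldesc y = {}" "I \<inter> rdesc y = {}"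
  shows "y = z"
proof -
  obtain a b where ab: "a \<in> generate W J" "b \<in> generate W I" "y = a \<otimes> z \<otimes> b" "\<ell> y = \<ell> a + \<ell> z + \<ell> b"
    using z y(1) unfolding splits_coset_def by blast
  have c: "a \<in> carrier W" "b \<in> carrier W" "z \<in> carrier W"
    using ab par_closed I J splits_coset_closed[OF J I x z] by auto
  have "a = \<one>" using splits_coset_add_left[OF J ab(1) c(3,2)] ab y by simp
  moreover have "b = \<one>" using splits_coset_add_right[OF I ab(2) c(3,1)] ab y by simp
  ultimately show ?thesis using ab c by simp
qed

text \<open>By \<open>locmax_unique\<close> and \<open>coset_max_eq\<close> below, these local conditions characterise the Bruhat-maximal
  element of the double coset \<open>W\<^sub>J x W\<^sub>I\<close>.\<close>
definition dmax :: "'a set \<Rightarrow> 'a \<Rightarrow> 'a set \<Rightarrow> bool" where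
  "dmax J x I \<longleftrightarrow> finitary J \<and> finitary I \<and> x \<in> carrier W \<and> J \<subseteq> ldesc x \<and> I \<subseteq> rdesc x"

lemma dmaxD:
  assumes "dmax J x I"
  shows "finitary J" "finitary I" "x \<in> carrier W" "J \<subseteq> ldesc x" "I \<subseteq> rdesc x" "J \<subseteq> S" "I \<subseteq> S"
  using assms finitary_sub unfolding dmax_def by auto

lemma dmax_rmin: "dmax J x I \<Longrightarrow> rmin I (x \<otimes> longest I)"
  using rmin_strip unfolding dmax_def by simp

text \<open>Split off \<open>w\<^sub>J\<close> on the left. The rest has no left descent in \<open>J\<close>, so its factorisation
  through \<open>z\<close> has trivial left factor.\<close>
lemma locmax_normal_form:
  assumes st: "dmax J x I" and z: "splits_coset J I z (dcoset J x I)"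
  shows "\<exists>d \<in> generate W I. x = longest J \<otimes> z \<otimes> d"
proof -
  note D = dmaxD[OF st]
  let ?w = "longest J"
  have wc: "?w \<in> carrier W" using D by simp
  let ?x = "?w \<otimes> x"
  have "J \<inter> ldesc ?x = {}"
  proof (intro equals0I)
    fix j assume j: "j \<in> J \<inter> ldesc ?x"
    then have jS: "j \<in> S" using D by blast
    have g: "?w \<otimes> j \<in> generate W J" using j longest_in[OF D(1)] par_gen par_mult by blast
    have "inv (?w \<otimes> j) = j \<otimes> ?w" using jS wc longest_inv[OF D(1)] by (simp add: inv_mult_group)
    then have "\<ell> x = \<ell> (?w \<otimes> j) + \<ell> (j \<otimes> ?x)"
      using ldesc_strip[OF D(6,3,4) g] D wc jS by (simp add: m_assoc)
    moreover have "\<ell> x = \<ell> ?w + \<ell> ?x"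
      using ldesc_strip[OF D(6,3,4) longest_in[OF D(1)]] longest_inv[OF D(1)] by simp
    moreover have "\<ell> (?w \<otimes> j) < \<ell> ?w" using longest_rdesc[OF D(1)] j unfolding rdesc_def by blast
    ultimately show False using j unfolding ldesc_def by simp
  qed
  moreover have "?x \<in> dcoset J x I" using dcoset_left D longest_in by blast
  then obtain c d where cd: "c \<in> generate W J" "d \<in> generate W I" "?x = c \<otimes> z \<otimes> d"
      "\<ell> ?x = \<ell> c + \<ell> z + \<ell> d"
    using z unfolding splits_coset_def by blast
  have zc: "z \<in> carrier W" using splits_coset_closed[OF D(6,7,3) z] .
  have dc: "d \<in> carrier W" using par_closed D cd by blast
  ultimately have "c = \<one>" using splits_coset_add_left[OF D(6) cd(1) zc dc] by (simp add: cd(3) cd(4)[unfolded cd(3)])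
  then have "?w \<otimes> ?x = ?w \<otimes> (z \<otimes> d)" using cd zc dc by simp
  then have "x = ?w \<otimes> z \<otimes> d" using wc zc dc D by (simp add: m_assoc)
  then show ?thesis using cd by blast
qed

text \<open>By the normal form, two such elements lie in the single coset \<open>w\<^sub>J z W\<^sub>I\<close>, and each of them is the
  shortest element of that coset times \<open>w\<^sub>I\<close>.\<close>
lemma locmax_unique:
  assumes st: "dmax J x I" and x': "x' \<in> dcoset J x I" "J \<subseteq> ldesc x'" "I \<subseteq> rdesc x'"
  shows "x' = x"
proof -
  note D = dmaxD[OF st]
  have c': "x' \<in> carrier W" using dcoset_closed D x' by blast
  have st': "dmax J x' I" using st x' c' unfolding dmax_def by blast
  obtain z where z: "splits_coset J I z (dcoset J x I)" using ex_splits_coset[OF D(6,7,3)] by blast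
  have zc: "z \<in> carrier W" using splits_coset_closed[OF D(6,7,3) z] .
  obtain d where d: "d \<in> generate W I" "x = longest J \<otimes> z \<otimes> d" using locmax_normal_form[OF st z] by blast
  obtain e where e: "e \<in> generate W I" "x' = longest J \<otimes> z \<otimes> e"
    using locmax_normal_form[OF st'] z dcoset_eq[OF D(6,7,3) x'(1)] by auto
  have c: "d \<in> carrier W" "e \<in> carrier W" "longest J \<in> carrier W" "longest I \<in> carrier W"
    using d e par_closed D by auto
  let ?u = "longest I \<otimes> inv d \<otimes> e \<otimes> longest I"
  have "?u \<in> generate W I" using d e longest_in[OF D(2)] par_inv[OF D(7)] par_mult by metis
  moreover have "x' \<otimes> longest I = x \<otimes> longest I \<otimes> ?u"
    using d(2) e(2) c zc D(2) by (simp add: m_assoc)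
  ultimately have "x' \<otimes> longest I = x \<otimes> longest I"
    using rmin_unique[OF D(7) dmax_rmin[OF st] dmax_rmin[OF st']] by blast
  then show ?thesis using c c' D by simp
qed

lemma ex_locmax:
  assumes J: "finitary J" and I: "finitary I" and x: "x \<in> carrier W"
  shows "\<exists>y \<in> dcoset J x I. dmax J y I \<and> (\<forall>u \<in> dcoset J x I. \<ell> u \<le> \<ell> y)"
proof -
  have JS: "J \<subseteq> S" and IS: "I \<subseteq> S" using J I finitary_sub by auto
  obtain z where z: "splits_coset J I z (dcoset J x I)" using ex_splits_coset JS IS x by blast
  have "\<ell> u < Suc (\<ell> (longest J) + \<ell> z + \<ell> (longest I))" if u: "u \<in> dcoset J x I" for u
  proof -
    obtain a b where "a \<in> generate W J" "b \<in> generate W I" "\<ell> u = \<ell> a + \<ell> z + \<ell> b"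
      using z u unfolding splits_coset_def by blast
    then show ?thesis using len_longest_ge[OF J, of a] len_longest_ge[OF I, of b] by simp
  qed
  then obtain y where y: "y \<in> dcoset J x I" "\<And>u. u \<in> dcoset J x I \<Longrightarrow> \<ell> u \<le> \<ell> y"
    using ex_has_greatest_nat[of "\<lambda>y. y \<in> dcoset J x I" x \<ell>] dcoset_self[OF x] by blast
  have yc: "y \<in> carrier W" using dcoset_closed JS IS x y by blast
  have "J \<subseteq> ldesc y"
  proof
    fix j assume j: "j \<in> J"
    then have jS: "j \<in> S" using JS by blast
    have "j \<otimes> y \<in> dcoset J x I" using dcoset_left[OF JS yc par_gen[OF j]] dcoset_trans JS IS x y by blast
    then have "\<ell> (j \<otimes> y) \<le> \<ell> y" using y by blast
    then show "j \<in> ldesc y" using len_gen_left(1)[OF jS yc] by (auto split: if_splits)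
  qed
  moreover have "I \<subseteq> rdesc y"
  proof
    fix j assume j: "j \<in> I"
    then have jS: "j \<in> S" using IS by blast
    have "y \<otimes> j \<in> dcoset J x I" using dcoset_right[OF yc par_gen[OF j]] dcoset_trans JS IS x y by blast
    then have "\<ell> (y \<otimes> j) \<le> \<ell> y" using y by blast
    then show "j \<in> rdesc y" using len_gen_right(1)[OF jS yc] by (auto split: if_splits)
  qed
  ultimately have "dmax J y I" using J I yc unfolding dmax_def by blast
  then show ?thesis using y by blast
qed

lemma dmax_max: assumes st: "dmax J x I" and u: "u \<in> dcoset J x I" shows "\<ell> u \<le> \<ell> x"
proof -
  note D = dmaxD[OF st]
  obtain y where "y \<in> dcoset J x I" "dmax J y I" "\<forall>u \<in> dcoset J x I. \<ell> u \<le> \<ell> y"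
    using ex_locmax D by blast
  then show ?thesis using locmax_unique[OF st] dmaxD u by metis
qed

lemma bruhat_imp_len: "bruhat_le u v \<Longrightarrow> u = v \<or> \<ell> u < \<ell> v"
  unfolding bruhat_le_def by (induction rule: rtranclp_induct) auto

lemma bruhat_le_right: assumes "u \<in> carrier W" "s \<in> S" "\<ell> u < \<ell> (u \<otimes> s)" shows "bruhat_le u (u \<otimes> s)"
proof -
  have "s = \<one> \<otimes> s \<otimes> inv \<one>" using assms by simp
  then have "s \<in> reflections" unfolding reflections_def using assms by blast
  then show ?thesis unfolding bruhat_le_def using assms by (intro r_into_rtranclp) blast
qed

lemma bruhat_le_left: assumes "u \<in> carrier W" "s \<in> S" "\<ell> u < \<ell> (s \<otimes> u)" shows "bruhat_le u (s \<otimes> u)"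
proof -
  have "inv u \<otimes> s \<otimes> inv (inv u) \<in> reflections" unfolding reflections_def using assms inv_closed by blast
  moreover have "s \<otimes> u = u \<otimes> (inv u \<otimes> s \<otimes> inv (inv u))" using assms by (simp add: m_assoc)
  ultimately show ?thesis unfolding bruhat_le_def using assms by (intro r_into_rtranclp) blast
qed

text \<open>A Bruhat-maximal element admits no ascent by a simple reflection from \<open>J\<close> or \<open>I\<close>, hence it is the
  unique element without such ascents.\<close>
lemma coset_max_eq: assumes st: "dmax J x I" shows "coset_max (dcoset J x I) = x"
proof -
  note D = dmaxD[OF st]
  let ?p = "dcoset J x I"
  show ?thesis unfolding coset_max_def
  proof (rule the_equality)
    show "x \<in> ?p \<and> (\<forall>y \<in> ?p. bruhat_le x y \<longrightarrow> y = x)"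
      using dcoset_self D bruhat_imp_len dmax_max[OF st] by fastforce
  next
    fix x' assume x': "x' \<in> ?p \<and> (\<forall>y \<in> ?p. bruhat_le x' y \<longrightarrow> y = x')"
    have c: "x' \<in> carrier W" using dcoset_closed D x' by blast
    have "J \<subseteq> ldesc x'"
    proof (rule ccontr)
      assume "\<not> J \<subseteq> ldesc x'"
      then obtain j where j: "j \<in> J" "j \<notin> ldesc x'" by blast
      then have jS: "j \<in> S" using D by blast
      have l: "\<ell> (j \<otimes> x') = \<ell> x' + 1" using len_gen_left(1)[OF jS c] j by simp
      have "j \<otimes> x' \<in> ?p" using dcoset_left[OF D(6) c par_gen[OF j(1)]] dcoset_trans D x' by blast
      moreover have "bruhat_le x' (j \<otimes> x')" using bruhat_le_left[OF c jS] l by simp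
      ultimately show False using x' l by fastforce
    qed
    moreover have "I \<subseteq> rdesc x'"
    proof (rule ccontr)
      assume "\<not> I \<subseteq> rdesc x'"
      then obtain j where j: "j \<in> I" "j \<notin> rdesc x'" by blast
      then have jS: "j \<in> S" using D by blast
      have l: "\<ell> (x' \<otimes> j) = \<ell> x' + 1" using len_gen_right(1)[OF jS c] j by simp
      have "x' \<otimes> j \<in> ?p" using dcoset_right[OF c par_gen[OF j(1)]] dcoset_trans D x' by blast
      moreover have "bruhat_le x' (x' \<otimes> j)" using bruhat_le_right[OF c jS] l by simp
      ultimately show False using x' l by fastforce
    qed
    ultimately show "x' = x" using locmax_unique[OF st] x' by blast
  qed
qed

lemma coset_min_eq:
  assumes J: "J \<subseteq> S" and I: "I \<subseteq> S" and x: "x \<in> carrier W" and z: "splits_coset J I z (dcoset J x I)"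
  shows "coset_min (dcoset J x I) = z"
proof -
  let ?p = "dcoset J x I"
  note Z = splits_coset_props[OF J I x z]
  show ?thesis unfolding coset_min_def
  proof (rule the_equality)
    have "\<ell> z \<le> \<ell> y" if "y \<in> ?p" for y
      using z that unfolding splits_coset_def by fastforce
    then show "z \<in> ?p \<and> (\<forall>y \<in> ?p. bruhat_le y z \<longrightarrow> y = z)"
      using z bruhat_imp_len unfolding splits_coset_def by fastforce
  next
    fix x' assume x': "x' \<in> ?p \<and> (\<forall>y \<in> ?p. bruhat_le y x' \<longrightarrow> y = x')"
    have c: "x' \<in> carrier W" using dcoset_closed J I x x' by blast
    have "J \<inter> ldesc x' = {}"
    proof (intro equals0I)
      fix j assume j: "j \<in> J \<inter> ldesc x'"
      then have jS: "j \<in> S" and jJ: "j \<in> J" using J by auto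
      have l: "\<ell> (j \<otimes> x') < \<ell> x'" using j unfolding ldesc_def by blast
      have "j \<otimes> x' \<in> ?p" using dcoset_left[OF J c par_gen[OF jJ]] dcoset_trans J I x x' by blast
      moreover have "bruhat_le (j \<otimes> x') x'" using bruhat_le_left[of "j \<otimes> x'" j] c jS l by simp
      ultimately show False using x' l by fastforce
    qed
    moreover have "I \<inter> rdesc x' = {}"
    proof (intro equals0I)
      fix j assume j: "j \<in> I \<inter> rdesc x'"
      then have jS: "j \<in> S" and jJ: "j \<in> I" using I by auto
      have l: "\<ell> (x' \<otimes> j) < \<ell> x'" using j unfolding rdesc_def by blast
      have "x' \<otimes> j \<in> ?p" using dcoset_right[OF c par_gen[OF jJ]] dcoset_trans J I x x' by blast
      moreover have "bruhat_le (x' \<otimes> j) x'" using bruhat_le_right[of "x' \<otimes> j" j] c jS l by simp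
      ultimately show False using x' l by fastforce
    qed
    ultimately show "x' = z" using locmin_unique[OF J I x z] x' by blast
  qed
qed

text \<open>Put \<open>y = x w\<^sub>I = c z\<close> with \<open>c \<in> W\<^sub>J\<close> and \<open>z\<close> minimal. If \<open>s\<close> is not a right descent of \<open>y\<close>, then
  \<open>z\<close> stays minimal; and a new redundancy \<open>z s z\<^sup>-\<^sup>1 \<in> J\<close> would put \<open>y s w\<^sub>I\<close>, which is longer than \<open>x\<close>, into
  the double coset of \<open>x\<close>. Conversely, if \<open>s\<close> is a right descent of \<open>y\<close> but not of \<open>z\<close>, exchange
  in \<open>c z\<close> gives \<open>z s z\<^sup>-\<^sup>1 \<in> J\<close>, so the redundancy grows; if \<open>s\<close> is a right descent of \<open>z\<close>, the minimal
  element changes.\<close>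
lemma reduced_step_iff:
  assumes st: "dmax J x I" and s: "s \<notin> I" and M: "finitary (insert s I)"
  shows "coset_min (dcoset J x I) = coset_min (dcoset J x (insert s I)) \<and>
     J \<inter> (\<lambda>r. coset_min (dcoset J x I) \<otimes> r \<otimes> inv (coset_min (dcoset J x I))) ` I =
     J \<inter> (\<lambda>r. coset_min (dcoset J x (insert s I)) \<otimes> r \<otimes> inv (coset_min (dcoset J x (insert s I)))) ` (insert s I)
     \<longleftrightarrow> rmin (insert s I) (x \<otimes> longest I)"
    (is "?L \<longleftrightarrow> rmin ?M ?y")
proof -
  note D = dmaxD[OF st]
  have MS: "?M \<subseteq> S" using M finitary_sub by blast
  then have sS: "s \<in> S" by blast
  let ?w = "longest I"
  have wc: "?w \<in> carrier W" and yc: "?y \<in> carrier W" using D by simp_all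
  have ym: "rmin I ?y" using dmax_rmin[OF st] .
  obtain z where z: "splits_coset J I z (dcoset J x I)" using ex_splits_coset[OF D(6,7,3)] by blast
  note Z = splits_coset_props[OF D(6,7,3) z]
  obtain z' where z': "splits_coset J ?M z' (dcoset J x ?M)" using ex_splits_coset[OF D(6) MS D(3)] by blast
  note Z' = splits_coset_props[OF D(6) MS D(3) z']
  have mz: "coset_min (dcoset J x I) = z" "coset_min (dcoset J x ?M) = z'"
    using coset_min_eq[OF D(6,7,3) z] coset_min_eq[OF D(6) MS D(3) z'] by auto
  have "?y \<in> dcoset J x I" using dcoset_right[OF D(3) longest_in[OF D(2)]] .
  then obtain c d where cd: "c \<in> generate W J" "d \<in> generate W I" "?y = c \<otimes> z \<otimes> d"
      "\<ell> ?y = \<ell> c + \<ell> z + \<ell> d"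
    using z unfolding splits_coset_def by blast
  have cc: "c \<in> carrier W" "d \<in> carrier W" using cd par_closed D by auto
  have "d = \<one>" using splits_coset_add_right[OF D(7) cd(2) Z(1) cc(1)] cd ym unfolding rmin_def by simp
  then have y: "?y = c \<otimes> z" "\<ell> ?y = \<ell> c + \<ell> z" using cd cc Z(1) by simp_all
  show ?thesis
  proof
    assume m: "rmin ?M ?y"
    have zm: "rmin ?M z"
      unfolding rmin_def
    proof (intro conjI Z(1) equals0I)
      fix r assume r: "r \<in> ?M \<inter> rdesc z"
      then have rS: "r \<in> S" using MS by blast
      have "\<ell> (?y \<otimes> r) \<le> \<ell> c + \<ell> (z \<otimes> r)"
        using y len_mult_le[of c "z \<otimes> r"] cc Z(1) rS by (simp add: m_assoc)
      then have "r \<in> rdesc ?y" using r y rS unfolding rdesc_def by auto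
      then show False using m r unfolding rmin_def by blast
    qed
    have "z \<in> dcoset J x ?M" using z dcoset_mono[of I ?M J x] unfolding splits_coset_def by blast
    then have zz: "z = z'" using locmin_unique[OF D(6) MS D(3) z'] Z(3) zm unfolding rmin_def by blast
    have "z \<otimes> s \<otimes> inv z \<notin> J"
    proof
      assume r: "z \<otimes> s \<otimes> inv z \<in> J"
      let ?r = "z \<otimes> s \<otimes> inv z"
      have "c \<otimes> ?r \<in> generate W J" using cd r par_gen par_mult by blast
      then have "c \<otimes> ?r \<otimes> z \<otimes> ?w \<in> dcoset J x I" using dcosetI longest_in[OF D(2)] Z(2) by blast
      moreover have "c \<otimes> ?r \<otimes> z \<otimes> ?w = ?y \<otimes> (s \<otimes> ?w)" unfolding y(1) using cc Z(1) sS wc by (simp add: m_assoc)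
      ultimately have le: "\<ell> (?y \<otimes> (s \<otimes> ?w)) \<le> \<ell> x" using dmax_max[OF st] by simp
      have "?w \<in> generate W ?M" using par_mono[OF _ longest_in[OF D(2)]] by blast
      then have "s \<otimes> ?w \<in> generate W ?M" using par_mult[OF par_gen[of s ?M]] by blast
      then have "\<ell> (?y \<otimes> (s \<otimes> ?w)) = \<ell> ?y + \<ell> (s \<otimes> ?w)" using rmin_add[OF MS m] by blast
      moreover have "\<ell> (s \<otimes> ?w) = \<ell> ?w + 1"
        using len_gen_left(1)[OF sS wc] longest_ldesc[OF D(2)] s by simp
      moreover have "\<ell> x = \<ell> ?y + \<ell> ?w" using rmin_add[OF D(7) ym longest_in[OF D(2)]] D by simp
      ultimately show False using le by simp
    qed
    then show ?L unfolding mz zz[symmetric] by auto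
  next
    assume L: ?L
    then have zz: "z' = z" and red: "J \<inter> (\<lambda>r. z \<otimes> r \<otimes> inv z) ` ?M \<subseteq> (\<lambda>r. z \<otimes> r \<otimes> inv z) ` I"
      unfolding mz by auto
    have "s \<notin> rdesc ?y"
    proof
      assume "s \<in> rdesc ?y"
      then have "s \<in> rdesc (c \<otimes> z)" using y by simp
      moreover have sz: "s \<notin> rdesc z" using Z'(4) zz unfolding rmin_def by blast
      ultimately obtain c' where c': "c' \<in> generate W J" "c \<otimes> z \<otimes> s = c' \<otimes> z"
        using exchange_right_prod[OF D(6) cd(1) Z(1)] sS unfolding rdesc_def by blast
      have c'c: "c' \<in> carrier W" using c' par_closed D by blast
      let ?r = "inv c \<otimes> c'"
      have "inv c \<otimes> (c \<otimes> z \<otimes> s) = inv c \<otimes> (c' \<otimes> z)" using c' by simp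
      then have rz: "z \<otimes> s = ?r \<otimes> z" using cc c'c Z(1) sS by (simp add: m_assoc)
      have rJ: "?r \<in> generate W J" using cd c' par_inv D par_mult by metis
      have "\<ell> (z \<otimes> s) = \<ell> ?r + \<ell> z" unfolding rz using lmin_add[OF D(6) Z(1,3) rJ] .
      then have "\<ell> ?r = 1" using len_gen_right(1)[OF sS Z(1)] sz by simp
      then have "?r \<in> J" using par_simple D rJ by blast
      have "z \<otimes> s \<otimes> inv z = ?r \<otimes> z \<otimes> inv z" using rz by simp
      then have "?r = z \<otimes> s \<otimes> inv z" using cc c'c Z(1) by (simp add: m_assoc)
      then obtain i where i: "i \<in> I" "z \<otimes> s \<otimes> inv z = z \<otimes> i \<otimes> inv z" using red \<open>?r \<in> J\<close> by auto
      moreover have "i \<in> S" using i D by blast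
      ultimately have "s = i" using Z(1) sS by simp
      then show False using i s by simp
    qed
    then show "rmin ?M ?y" using ym unfolding rmin_def by blast
  qed
qed


section \<open>Reduced expressions as paths of maximal elements\<close>

lemma dmax_base: "finitary J \<Longrightarrow> dmax J (longest J) J"
  unfolding dmax_def using longest_ldesc longest_rdesc by simp

lemma dmax_down: "dmax J x I \<Longrightarrow> I' \<subseteq> I \<Longrightarrow> dmax J x I'"
  unfolding dmax_def using finitary_mono by blast

lemma dmax_up:
  assumes st: "dmax J x I" and M: "finitary M" and IM: "I \<subseteq> M" and m: "rmin M (x \<otimes> longest I)"
  shows "dmax J (x \<otimes> longest I \<otimes> longest M) M"
proof -
  note D = dmaxD[OF st]
  have MS: "M \<subseteq> S" using M finitary_sub by blast
  let ?y = "x \<otimes> longest I"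
  have ym: "rmin I ?y" using dmax_rmin[OF st] .
  have "J \<subseteq> ldesc (?y \<otimes> longest M)"
  proof
    fix j assume j: "j \<in> J"
    then have jS: "j \<in> S" using D by blast
    have "j \<in> ldesc (?y \<otimes> longest I)" using j D by auto
    then consider "j \<in> ldesc ?y" | r where "r \<in> I" "j \<otimes> ?y = ?y \<otimes> r"
      using ldesc_rmin_cases[OF D(7) ym longest_in[OF D(2)]] by blast
    then show "j \<in> ldesc (?y \<otimes> longest M)"
    proof cases
      case 1
      then show ?thesis using ldesc_rmin_mult[OF MS m longest_in[OF M]] by blast
    next
      case 2
      then show ?thesis using ldesc_transport[OF MS m longest_in[OF M] jS] longest_ldesc[OF M] IM by blast
    qed
  qed
  moreover have "?y \<otimes> longest M \<in> carrier W" using D M by simp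
  ultimately show ?thesis using D(1) M rmin_longest_rdesc[OF M m] unfolding dmax_def by blast
qed

text \<open>In \<open>rpath J E x I\<close> the expression \<open>E\<close> leads from \<open>J\<close> to \<open>I\<close> and \<open>x\<close> is the maximal element of the
  double coset that it expresses. Recording \<open>x\<close> instead of the coset makes the length-additivity of
  every step up explicit.\<close>
inductive rpath :: "'a set \<Rightarrow> 'a set list \<Rightarrow> 'a \<Rightarrow> 'a set \<Rightarrow> bool" for J where
  base: "finitary J \<Longrightarrow> rpath J [J] (longest J) J"
| down: "rpath J E x I \<Longrightarrow> s \<in> I \<Longrightarrow> rpath J (E @ [I - {s}]) x (I - {s})"
| up: "rpath J E x I \<Longrightarrow> s \<notin> I \<Longrightarrow> finitary (insert s I) \<Longrightarrow> rmin (insert s I) (x \<otimes> longest I) \<Longrightarrow>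
    rpath J (E @ [insert s I]) (x \<otimes> longest I \<otimes> longest (insert s I)) (insert s I)"

lemma expression_snoc:
  "E \<noteq> [] \<Longrightarrow> expression (E @ [I']) \<longleftrightarrow> expression E \<and> finitary I' \<and> adjacent (last E) I'"
  unfolding expression_def by (auto simp: successively_append_iff)

lemma rpath_props:
  assumes "rpath J E x I"
  shows rpath_dmax: "dmax J x I" and rpath_nonempty: "E \<noteq> []" and rpath_hd: "hd E = J"
    and rpath_last: "last E = I" and rpath_expression: "expression E"
proof -
  have "dmax J x I \<and> E \<noteq> [] \<and> hd E = J \<and> last E = I \<and> expression E"
    using assms
  proof (induction rule: rpath.induct)
    case base
    then show ?case using dmax_base by (auto simp: expression_def)
  next
    case (down E x I s)
    then have "s \<in> S" using dmaxD(7) by blast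
    then have "adjacent I (I - {s})" using down unfolding adjacent_def by blast
    moreover have "dmax J x (I - {s})" using down dmax_down by blast
    ultimately show ?case using down dmaxD(2)[of J x "I - {s}"] expression_snoc[of E "I - {s}"] by auto
  next
    case (up E x I s)
    then have "s \<in> S" using finitary_sub by blast
    then have "adjacent I (insert s I)" using up unfolding adjacent_def by blast
    then show ?case using up dmax_up[of J x I "insert s I"] expression_snoc[of E "insert s I"] by auto
  qed
  then show "dmax J x I" "E \<noteq> []" "hd E = J" "last E = I" "expression E" by auto
qed

lemma nth_prefix: "i < length E \<Longrightarrow> (E @ F) ! i = E ! i" "i < length E \<Longrightarrow> (E @ F) ! 0 = E ! 0"
  by (auto simp: nth_append)

lemma forward_path_append: "i < length E \<Longrightarrow> forward_path (E @ F) i = forward_path E i"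
proof (induction i)
  case 0
  then show ?case by (simp add: nth_append)
next
  case (Suc i)
  moreover have "(E @ F) ! 0 = E ! 0" "(E @ F) ! i = E ! i" "(E @ F) ! Suc i = E ! Suc i"
    using Suc.prems nth_prefix[of _ E F] by auto
  ultimately show ?case by simp
qed

lemma left_redundancy_append: "i < length E \<Longrightarrow> left_redundancy (E @ F) i = left_redundancy E i"
  unfolding left_redundancy_def using forward_path_append[of i E F] nth_prefix[of i E F] by simp

lemma forward_path_base: "finitary J \<Longrightarrow> forward_path [J] 0 = dcoset J (longest J) J"
proof -
  assume J: "finitary J"
  then have JS: "J \<subseteq> S" using finitary_sub by blast
  have "longest J \<in> dcoset J \<one> J" using dcoset_left[OF JS _ longest_in[OF J], of \<one>] J by simp
  then have "dcoset J \<one> J = dcoset J (longest J) J" using dcoset_eq[OF JS JS, of \<one>] by simp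
  then show ?thesis using is_coset_unique[OF JS JS, of \<one>] by simp
qed

lemma forward_path_up:
  assumes E: "E \<noteq> []" "hd E = J" "last E = I" "forward_path E (length E - 1) = dcoset J x I"
    and st: "dmax J x I" and I': "I' \<subseteq> S" "I \<subseteq> I'"
  shows "forward_path (E @ [I']) (length E) = dcoset J x I'"
proof -
  note D = dmaxD[OF st]
  obtain n where n: "length E = Suc n" using E(1) by (cases E) auto
  have nth: "(E @ [I']) ! 0 = J" "(E @ [I']) ! n = I" "(E @ [I']) ! Suc n = I'"
    using E n by (auto simp: nth_append hd_conv_nth last_conv_nth)
  have "is_coset J I' q \<and> dcoset J x I \<subseteq> q \<longleftrightarrow> q = dcoset J x I'" for q
    using is_coset_unique[OF D(6) I'(1) D(3), of q] dcoset_self[OF D(3), of J I]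
      dcoset_mono[OF I'(2), of J x] by blast
  then show ?thesis unfolding n using nth I'(2) forward_path_append[of n E "[I']"] n E(4) by simp
qed

lemma forward_path_down:
  assumes E: "E \<noteq> []" "hd E = J" "last E = I" "forward_path E (length E - 1) = dcoset J x I"
    and st: "dmax J x I" and I': "I' \<subset> I"
  shows "forward_path (E @ [I']) (length E) = dcoset J x I'"
proof -
  note D = dmaxD[OF st]
  obtain n where n: "length E = Suc n" using E(1) by (cases E) auto
  have nth: "(E @ [I']) ! 0 = J" "(E @ [I']) ! n = I" "(E @ [I']) ! Suc n = I'"
    using E n by (auto simp: nth_append hd_conv_nth last_conv_nth)
  have "I' \<subseteq> S" using I' D by blast
  then have "is_coset J I' q \<and> x \<in> q \<longleftrightarrow> q = dcoset J x I'" for q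
    using is_coset_unique[OF D(6) _ D(3)] by blast
  then show ?thesis unfolding n
    using nth I' forward_path_append[of n E "[I']"] n E(4) coset_max_eq[OF st] by auto
qed

lemma rpath_forward_path: "rpath J E x I \<Longrightarrow> forward_path E (length E - 1) = dcoset J x I"
proof (induction rule: rpath.induct)
  case base
  then show ?case using forward_path_base by simp
next
  case (down E x I s)
  note P = rpath_props[OF down(1)]
  show ?case using forward_path_down[OF P(2-4) down(3) P(1), of "I - {s}"] down(2) by auto
next
  case (up E x I s)
  note P = rpath_props[OF up(1)]
  note D = dmaxD[OF P(1)]
  let ?M = "insert s I"
  have MS: "?M \<subseteq> S" using up finitary_sub by blast
  have "forward_path (E @ [?M]) (length E) = dcoset J x ?M"
    using forward_path_up[OF P(2-4) up(5) P(1) MS] by auto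
  moreover have "longest I \<in> generate W ?M" using par_mono[OF _ longest_in[OF D(2)]] by blast
  then have "longest I \<otimes> longest ?M \<in> generate W ?M" using longest_in[OF up(3)] par_mult by blast
  then have "x \<otimes> longest I \<otimes> longest ?M \<in> dcoset J x ?M"
    using dcoset_right[OF D(3)] D up(3) by (simp add: m_assoc)
  ultimately show ?case using dcoset_eq[OF D(6) MS D(3)] by simp
qed

lemma reduced_snoc:
  assumes "E \<noteq> []"
  shows "reduced (E @ [I']) \<longleftrightarrow> reduced E \<and> finitary I' \<and> adjacent (last E) I' \<and>
    (last E \<subset> I' \<longrightarrow>
      coset_min (forward_path E (length E - 1)) = coset_min (forward_path (E @ [I']) (length E)) \<and>
      left_redundancy E (length E - 1) = left_redundancy (E @ [I']) (length E))"
proof -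
  obtain n where n: "length E = Suc n" using assms by (cases E) auto
  have l: "last E = E ! n" using assms n by (simp add: last_conv_nth)
  have *: "(\<forall>i. Suc i < length (E @ [I']) \<and> Q i \<longrightarrow> P i) \<longleftrightarrow>
      (\<forall>i. Suc i < length E \<and> Q i \<longrightarrow> P i) \<and> (Q n \<longrightarrow> P n)" for P Q
    using n by (auto simp: less_Suc_eq)
  show ?thesis
    unfolding reduced_def * expression_snoc[OF assms]
    using n l by (auto simp: nth_append forward_path_append left_redundancy_append
        simp del: forward_path.simps)
qed

text \<open>Along a path, the definition of reducedness for the next step up is the criterion
  \<open>reduced_step_iff\<close> for the maximal element reached so far.\<close>
lemma reduced_up_iff:
  assumes p: "rpath J E x I" and s: "s \<notin> I" and M: "finitary (insert s I)"
  shows "reduced (E @ [insert s I]) \<longleftrightarrow> reduced E \<and> rmin (insert s I) (x \<otimes> longest I)"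
proof -
  note P = rpath_props[OF p]
  have MS: "insert s I \<subseteq> S" using M finitary_sub by blast
  then have "adjacent (last E) (insert s I)" using P s unfolding adjacent_def by blast
  moreover have "forward_path E (length E - 1) = dcoset J x I" using rpath_forward_path[OF p] .
  moreover from this have "forward_path (E @ [insert s I]) (length E) = dcoset J x (insert s I)"
    using forward_path_up[OF P(2-4) _ P(1) MS] by auto
  moreover have "E ! 0 = J" "E ! (length E - 1) = I" using P by (auto simp: hd_conv_nth last_conv_nth)
  ultimately show ?thesis
    using reduced_snoc[OF P(2), of "insert s I"] reduced_step_iff[OF P(1) s M] s M P(2,4)
    by (auto simp: left_redundancy_def Let_def nth_append simp del: forward_path.simps)
qed

lemma rpath_reduced: "rpath J E x I \<Longrightarrow> reduced E"
proof (induction rule: rpath.induct)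
  case base
  then show ?case unfolding reduced_def expression_def by simp
next
  case (down E x I s)
  note P = rpath_props[OF rpath.down[OF down(1,2)]]
  note P0 = rpath_props[OF down(1)]
  show ?case using reduced_snoc[OF P0(2)] down(3) P(5) P0 expression_snoc[OF P0(2)] by auto
next
  case (up E x I s)
  then show ?case using reduced_up_iff by blast
qed

section \<open>Rotation sequences\<close>

definition conj_by :: "'a \<Rightarrow> 'a \<Rightarrow> 'a" where "conj_by g x = g \<otimes> x \<otimes> inv g"

lemma conj_by_mult: "g \<in> carrier W \<Longrightarrow> h \<in> carrier W \<Longrightarrow> x \<in> carrier W \<Longrightarrow> conj_by (g \<otimes> h) x = conj_by g (conj_by h x)"
  unfolding conj_by_def by (simp add: m_assoc inv_mult_group)

lemma conj_by_longest: "finitary I \<Longrightarrow> conj_by (longest I) x = conj_longest I x"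
  unfolding conj_by_def conj_longest_def by (simp add: longest_inv)

lemma len_conj_by_par_le:
  assumes A: "A \<subseteq> S" and g: "g \<in> carrier W" and into: "\<And>x. x \<in> A \<Longrightarrow> conj_by g x \<in> S"
    and v: "v \<in> generate W A"
  shows "\<ell> (conj_by g v) \<le> \<ell> v"
proof -
  have "\<ell> (conj_by g (word_prod W vs)) \<le> length vs" if "set vs \<subseteq> A" for vs
    using that
  proof (induction vs)
    case Nil
    then show ?case using g by (simp add: conj_by_def)
  next
    case (Cons a vs)
    then have a: "a \<in> A" "a \<in> S" "vs \<in> lists S" using A by auto
    let ?v = "word_prod W vs"
    have c: "conj_by g ?v \<in> carrier W" "?v \<in> carrier W" using g a unfolding conj_by_def by auto
    have "conj_by g (a \<otimes> ?v) = conj_by g a \<otimes> conj_by g ?v"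
      using g c a unfolding conj_by_def by (simp add: m_assoc)
    then show ?case using Cons len_mult_le[of "conj_by g a" "conj_by g ?v"] into[OF a(1)] c by simp
  qed
  moreover obtain vs where "vs \<in> lists A" "word_prod W vs = v" "length vs = \<ell> v"
    using par_reduced_word A v by metis
  ultimately show ?thesis by (metis in_lists_conv_set subsetI)
qed

text \<open>If conjugation by \<open>g\<close> sends \<open>A\<close> into \<open>S\<close>, then \<open>g w\<^sub>A = w g\<close> with \<open>w\<close> of length at most that of \<open>w\<^sub>A\<close>. The
  factor \<open>g\<close> thus stands at the right end of a reduced product and its right descents persist.\<close>
lemma rdesc_normalizing:
  assumes A: "finitary A" and g: "rmin A g" and into: "\<And>x. x \<in> A \<Longrightarrow> conj_by g x \<in> S" and s: "s \<in> rdesc g"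
  shows "s \<in> rdesc (g \<otimes> longest A)"
proof -
  let ?w = "longest A"
  have AS: "A \<subseteq> S" using A finitary_sub by blast
  have c: "g \<in> carrier W" "?w \<in> carrier W" "s \<in> S" "conj_by g ?w \<in> carrier W"
    using g A s unfolding rdesc_def conj_by_def by auto
  have gw: "g \<otimes> ?w = conj_by g ?w \<otimes> g" using c unfolding conj_by_def by (simp add: m_assoc)
  have "\<ell> (g \<otimes> ?w \<otimes> s) = \<ell> (conj_by g ?w \<otimes> (g \<otimes> s))" unfolding gw using c by (simp add: m_assoc)
  also have "\<dots> \<le> \<ell> ?w + \<ell> (g \<otimes> s)"
    using len_mult_le[of "conj_by g ?w" "g \<otimes> s"] len_conj_by_par_le[OF AS c(1) into longest_in[OF A]] c by simp
  also have "\<dots> < \<ell> (g \<otimes> ?w)" using rmin_add[OF AS g longest_in[OF A]] s unfolding rdesc_def by auto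
  finally show ?thesis using c unfolding rdesc_def by blast
qed

lemma len_longest_psubset:
  assumes M: "finitary M" and A: "A \<subset> M" shows "\<ell> (longest A) < \<ell> (longest M)"
proof -
  have fA: "finitary A" using finitary_mono M A by blast
  have wA: "longest A \<in> generate W M" using par_mono[OF _ longest_in[OF fA]] A by blast
  have "\<ell> (longest A) \<noteq> \<ell> (longest M)"
  proof
    assume "\<ell> (longest A) = \<ell> (longest M)"
    then have "longest A = longest M" by (rule longest_unique[OF M wA])
    then have "rdesc (longest A) = rdesc (longest M)" by (rule arg_cong)
    then have "A = M" unfolding longest_rdesc[OF fA] longest_rdesc[OF M] .
    then show False using A by blast
  qed
  then show ?thesis using len_longest_ge[OF M wA] by simp
qed

text \<open>
  Throughout this part \<open>K = M - {a}\<close> and the rotation sequence is that of \<open>(K,a,t)\<close>, so that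
  \<open>K + a - t\<close> is the side \<open>[K, M, M - {t}]\<close> of the switchback relation.
\<close>
context
  fixes M a t
  assumes M: "finitary M" and a: "a \<in> M" and t: "t \<in> M" and at: "a \<noteq> conj_longest M t"
begin

text \<open>The rotation sequence with indices shifted by one, so that it starts with
  \<open>u\<^sub>-\<^sub>1 = w\<^sub>M t w\<^sub>M\<close> and satisfies a uniform recursion. With this shift \<open>rotI k\<close> and \<open>rotL k\<close> are the subsets
  \<open>I\<^sub>k\<close> and \<open>L\<^sub>k\<close> of the rotation expression, including \<open>L\<^sub>0\<close>.\<close>
definition rot_elt :: "nat \<Rightarrow> 'a" where
  "rot_elt k = (case k of 0 \<Rightarrow> conj_longest M t | Suc i \<Rightarrow> rot (M - {a}) a t i)"

abbreviation rotI :: "nat \<Rightarrow> 'a set" where "rotI k \<equiv> M - {rot_elt (Suc k)}"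
abbreviation rotL :: "nat \<Rightarrow> 'a set" where "rotL k \<equiv> M - {rot_elt (Suc k), rot_elt k}"

lemma rot_set_sub: "M \<subseteq> S" using M finitary_sub by blast

lemma rot_elt_1: "rot_elt (Suc 0) = a"
  unfolding rot_elt_def by simp

lemma rot_elt_step: "rot_elt (Suc (Suc k)) = conj_longest (rotI k) (rot_elt k)"
  using a by (cases k) (auto simp: rot_elt_def insert_absorb)

lemma rot_fin [simp]: "finitary (rotI k)" "finitary (rotL k)"
  using finitary_mono[OF M] by auto

lemma rot_elt_in: "rot_elt k \<in> M \<and> rot_elt (Suc k) \<in> M \<and> rot_elt (Suc k) \<noteq> rot_elt k"
proof (induction k)
  case 0
  then show ?case using a at conj_longest_in[OF M t] rot_elt_1 by (simp add: rot_elt_def)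
next
  case (Suc k)
  then have "rot_elt k \<in> rotI k" by auto
  then have "rot_elt (Suc (Suc k)) \<in> rotI k" unfolding rot_elt_step by (intro conj_longest_in) simp
  then show ?case using Suc by auto
qed

lemma rotL_Suc: "rotL (Suc k) = rotI k - {rot_elt (Suc (Suc k))}"
  by auto

lemma rotL_conj: "conj_longest (rotI k) ` rotL (Suc k) = rotL k"
proof -
  have I: "rotI k \<subseteq> carrier W" using rot_set_sub by auto
  have inj: "inj_on (conj_longest (rotI k)) (rotI k)"
    using conj_longest_inj[of "rotI k"] I by (intro inj_onI) (auto dest: subsetD)
  have v: "rot_elt k \<in> rotI k" "rot_elt k \<in> carrier W" using rot_elt_in[of k] rot_set_sub by auto
  have "rot_elt (Suc (Suc k)) \<in> rotI k" using rot_elt_in[of "Suc k"] by auto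
  moreover have "conj_longest (rotI k) (rot_elt (Suc (Suc k))) = rot_elt k"
    unfolding rot_elt_step using v by simp
  ultimately have "conj_longest (rotI k) ` rotL (Suc k) = rotI k - {rot_elt k}"
    unfolding rotL_Suc using inj_on_image_set_diff[OF inj, of "rotI k" "{rot_elt (Suc (Suc k))}"] by simp
  then show ?thesis by auto
qed

text \<open>The maximal elements along the rotation expression, as long as its steps up are reduced.\<close>
primrec rot_max :: "nat \<Rightarrow> 'a" where
  "rot_max 0 = longest (rotI 0)"
| "rot_max (Suc k) = rot_max k \<otimes> longest (rotL (Suc k)) \<otimes> longest (rotI (Suc k))"

abbreviation rot_low :: "nat \<Rightarrow> 'a" where "rot_low k \<equiv> rot_max k \<otimes> longest (rotL (Suc k))"

definition rot_reduced_upto :: "nat \<Rightarrow> bool" where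
  "rot_reduced_upto k \<longleftrightarrow> (\<forall>i < k. rmin (rotI (Suc i)) (rot_low i))"

lemma rot_max_par: "rot_max k \<in> generate W M"
proof (induction k)
  case 0
  then show ?case using par_mono[OF _ longest_in[OF rot_fin(1)[of 0]]] by auto
next
  case (Suc k)
  have "longest (rotL (Suc k)) \<in> generate W M" "longest (rotI (Suc k)) \<in> generate W M"
    using par_mono[OF _ longest_in[OF rot_fin(2)]] par_mono[OF _ longest_in[OF rot_fin(1)]] by blast+
  then show ?case using Suc par_mult by simp
qed

lemma rot_max_closed [simp]: "rot_max k \<in> carrier W"
  using rot_max_par par_closed rot_set_sub by blast

text \<open>The longest element for \<open>I\<^sub>k\<close> conjugates \<open>L\<^bsub>k+1\<^esub>\<close> to \<open>L\<^sub>k\<close>, and the one for \<open>L\<^bsub>k+1\<^esub>\<close> preserves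
  \<open>L\<^bsub>k+1\<^esub>\<close>. The product of these elements therefore leads back to \<open>L\<^sub>0\<close>.\<close>
lemma rot_low_conj: "conj_by (rot_low k) ` rotL (Suc k) = rotL 0"
proof (induction k)
  case 0
  have "conj_by (rot_low 0) x = conj_longest (rotI 0) (conj_longest (rotL (Suc 0)) x)" if "x \<in> rotL (Suc 0)" for x
    using that rot_set_sub by (simp add: conj_by_mult conj_by_longest subset_iff)
  then have "conj_by (rot_low 0) ` rotL (Suc 0) = conj_longest (rotI 0) ` (conj_longest (rotL (Suc 0)) ` rotL (Suc 0))"
    unfolding image_image by (rule image_cong[OF refl])
  then show ?case unfolding conj_longest_image[OF rot_fin(2)] rotL_conj .
next
  case (Suc k)
  have c: "rot_low k \<in> carrier W" by simp
  have "conj_by (rot_low (Suc k)) x =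
      conj_by (rot_low k) (conj_longest (rotI (Suc k)) (conj_longest (rotL (Suc (Suc k))) x))"
    if "x \<in> rotL (Suc (Suc k))" for x
  proof -
    have x: "x \<in> carrier W" using that rot_set_sub by auto
    have "rot_low (Suc k) = rot_low k \<otimes> (longest (rotI (Suc k)) \<otimes> longest (rotL (Suc (Suc k))))"
      by (simp add: m_assoc)
    then show ?thesis using x c by (simp only: conj_by_mult conj_by_longest longest_closed rot_fin m_closed
          conj_longest_closed)
  qed
  then have "conj_by (rot_low (Suc k)) ` rotL (Suc (Suc k)) = conj_by (rot_low k) ` (conj_longest (rotI (Suc k)) `
      (conj_longest (rotL (Suc (Suc k))) ` rotL (Suc (Suc k))))"
    unfolding image_image by (rule image_cong[OF refl])
  then show ?case unfolding conj_longest_image[OF rot_fin(2)] rotL_conj Suc .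
qed

lemma rot_expr_0: "rot_expr (M - {a}) a t 0 = [rotI 0]"
  unfolding rot_expr_def using a by (auto simp: rot_elt_1 insert_absorb)

lemma rot_expr_Suc:
  "rot_expr (M - {a}) a t (Suc k) = rot_expr (M - {a}) a t k @ [rotL (Suc k), rotI (Suc k)]"
  unfolding rot_expr_def using a by (simp add: rot_elt_def insert_absorb)

lemma rpath_rot_down:
  assumes p: "rpath J (F @ rot_expr (M - {a}) a t k) (z \<otimes> rot_max k) (rotI k)"
  shows "rpath J (F @ rot_expr (M - {a}) a t k @ [rotL (Suc k)]) (z \<otimes> rot_max k) (rotL (Suc k))"
proof -
  have "rot_elt (Suc (Suc k)) \<in> rotI k" using rot_elt_in[of "Suc k"] by auto
  then show ?thesis using rpath.down[OF p] unfolding rotL_Suc by simp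
qed

lemma rotI_Suc: "rotI (Suc k) = insert (rot_elt (Suc k)) (rotL (Suc k))" "rot_elt (Suc k) \<notin> rotL (Suc k)"
  using rot_elt_in[of "Suc k"] rot_elt_in[of k] by auto

text \<open>Everything that the rotation expression does takes place in \<open>W\<^sub>M\<close>, so it may be carried out
  to the right of any \<open>z\<close> without right descents in \<open>M\<close>.\<close>
lemma rpath_rot_expr:
  assumes z: "rmin M z" and p: "rpath J (F @ [rotI 0]) (z \<otimes> longest (rotI 0)) (rotI 0)"
  shows "rot_reduced_upto k \<Longrightarrow> rpath J (F @ rot_expr (M - {a}) a t k) (z \<otimes> rot_max k) (rotI k)"
proof (induction k)
  case 0
  then show ?case using p rot_expr_0 by simp
next
  case (Suc k)
  then have "rpath J (F @ rot_expr (M - {a}) a t k) (z \<otimes> rot_max k) (rotI k)"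
    unfolding rot_reduced_upto_def by simp
  note d = rpath_rot_down[OF this]
  have low: "rot_low k \<in> generate W M"
    using rot_max_par par_mono[OF _ longest_in[OF rot_fin(2)]] par_mult by (metis Diff_subset)
  have "rmin (rotI (Suc k)) (rot_low k)" using Suc unfolding rot_reduced_upto_def by simp
  then have "rmin (rotI (Suc k)) (z \<otimes> rot_low k)" using rmin_rmin_mult[OF rot_set_sub z low, of "rotI (Suc k)"] by simp
  then have "rmin (insert (rot_elt (Suc k)) (rotL (Suc k))) (z \<otimes> rot_max k \<otimes> longest (rotL (Suc k)))"
    unfolding rotI_Suc(1)[symmetric] using z by (simp add: m_assoc)
  from rpath.up[OF d rotI_Suc(2) _ this]
  show ?case unfolding rotI_Suc(1)[symmetric] rot_expr_Suc using z by (simp add: m_assoc)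
qed

lemma rpath_rot_self:
  assumes "rot_reduced_upto k" shows "rpath (rotI 0) (rot_expr (M - {a}) a t k) (rot_max k) (rotI k)"
proof -
  have "rmin M \<one>" unfolding rmin_def rdesc_def using rot_set_sub by auto
  moreover have "rpath (rotI 0) ([] @ [rotI 0]) (\<one> \<otimes> longest (rotI 0)) (rotI 0)"
    using rpath.base[OF rot_fin(1)[of 0]] by simp
  ultimately show ?thesis using rpath_rot_expr[of \<one> "rotI 0" "[]" k] assms by simp
qed

text \<open>A step up that fails to be reduced shows that \<open>u\<^sub>k\<close> is a right descent of \<open>rot_low k\<close>. As \<open>rot_low k\<close>
  conjugates \<open>L\<^bsub>k+1\<^esub>\<close> to simple reflections, \<open>u\<^sub>k\<close> is also a right descent of \<open>rot_max k\<close>, whose right descents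
  then exhaust \<open>M\<close>.\<close>
lemma rot_stop_imp_longest:
  assumes k: "rot_reduced_upto k" and n: "\<not> rmin (rotI (Suc k)) (rot_low k)"
  shows "rot_max k = longest M"
proof (rule longest_eq_of_rdesc[OF M rot_max_par])
  have st: "dmax (rotI 0) (rot_max k) (rotI k)" using rpath_dmax[OF rpath_rot_self[OF k]] .
  then have I: "rotI k \<subseteq> rdesc (rot_max k)" using dmaxD by blast
  have "dmax (rotI 0) (rot_max k) (rotL (Suc k))" using dmax_down[OF st] by blast
  then have m: "rmin (rotL (Suc k)) (rot_low k)" by (rule dmax_rmin)
  then have u: "rot_elt (Suc k) \<in> rdesc (rot_low k)" using n unfolding rotI_Suc(1) rmin_def by blast
  have "conj_by (rot_low k) x \<in> S" if "x \<in> rotL (Suc k)" for x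
    using rot_low_conj[of k] that rot_set_sub by blast
  then have "rot_elt (Suc k) \<in> rdesc (rot_low k \<otimes> longest (rotL (Suc k)))"
    using rdesc_normalizing[OF _ m _ u] by simp
  then have "rot_elt (Suc k) \<in> rdesc (rot_max k)" by simp
  then show "M \<subseteq> rdesc (rot_max k)" using I by blast
qed

lemma rot_reduced_upto_bounded: "rot_reduced_upto k \<Longrightarrow> k \<le> \<ell> (rot_max k)"
proof (induction k)
  case (Suc k)
  have m: "rmin (rotI (Suc k)) (rot_low k)" using Suc unfolding rot_reduced_upto_def by simp
  have mL: "rmin (rotL (Suc k)) (rot_low k)" using rmin_mono[OF m] by blast
  have "\<ell> (rot_max (Suc k)) = \<ell> (rot_low k) + \<ell> (longest (rotI (Suc k)))"
    using rmin_add[OF _ m longest_in] rot_set_sub by auto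
  moreover have "\<ell> (rot_low k \<otimes> longest (rotL (Suc k))) = \<ell> (rot_low k) + \<ell> (longest (rotL (Suc k)))"
    using rmin_add[OF _ mL longest_in] rot_set_sub by auto
  moreover have "rot_low k \<otimes> longest (rotL (Suc k)) = rot_max k" by simp
  moreover have "\<ell> (longest (rotL (Suc k))) < \<ell> (longest (rotI (Suc k)))"
  proof (rule len_longest_psubset[OF rot_fin(1)])
    have "x \<notin> A \<Longrightarrow> A \<subset> insert x A" for x and A :: "'a set" by blast
    from this[OF rotI_Suc(2)] show "rotL (Suc k) \<subset> rotI (Suc k)" unfolding rotI_Suc(1)[symmetric] .
  qed
  moreover have "rot_reduced_upto k" using Suc(2) unfolding rot_reduced_upto_def by simp
  ultimately show ?case using Suc(1) by simp
qed simp

text \<open>The element \<open>rot_low 0\<close> lies in the parabolic subgroup of \<open>I\<^sub>0 = M - {a}\<close>, so \<open>u\<^sub>0 = a\<close> is not one of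
  its right descents.\<close>
lemma rot_reduced_upto_1: "rot_reduced_upto (Suc 0)"
proof -
  have "longest (rotL (Suc 0)) \<in> generate W (rotI 0)"
    using par_mono[OF _ longest_in[OF rot_fin(2)]] rotL_Suc by (metis Diff_subset)
  then have low: "rot_low 0 \<in> generate W (rotI 0)" using longest_in[OF rot_fin(1)[of 0]] par_mult by simp
  have I: "rotI 0 \<subseteq> S" using rot_set_sub by blast
  have "rot_elt (Suc 0) \<notin> rdesc (rot_low 0)" using rdesc_par[OF I low] by blast
  moreover have "dmax (rotI 0) (rot_max 0) (rotI 0)" using dmax_base by simp
  then have "dmax (rotI 0) (rot_max 0) (rotL (Suc 0))" using dmax_down by blast
  then have "rmin (rotL (Suc 0)) (rot_low 0)" by (rule dmax_rmin)
  ultimately have "rmin (rotI (Suc 0)) (rot_low 0)" unfolding rotI_Suc(1) rmin_def by blast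
  then show ?thesis unfolding rot_reduced_upto_def by simp
qed

text \<open>Each reduced step up strictly increases the length inside the finite group \<open>W\<^sub>M\<close>, so reducedness breaks
  down for a first time, and this happens at \<open>w\<^sub>M\<close>.\<close>
lemma rot_delta_char:
  "\<exists>m. rot_delta (M - {a}) a t = Suc m \<and> rot_reduced_upto (Suc m) \<and> rot_max (Suc m) = longest M"
proof -
  have "\<exists>k. \<not> rot_reduced_upto k"
  proof (rule ccontr)
    assume "\<nexists>k. \<not> rot_reduced_upto k"
    then have "rot_reduced_upto (Suc (\<ell> (longest M)))" by blast
    then show False using rot_reduced_upto_bounded len_longest_ge[OF M rot_max_par] by (meson Suc_n_not_le_n le_trans)
  qed
  moreover have "rot_reduced_upto 0" unfolding rot_reduced_upto_def by simp
  ultimately obtain n where n: "rot_reduced_upto n" "\<not> rot_reduced_upto (Suc n)"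
    by (metis nat_induct)
  have "n \<noteq> 0"
  proof
    assume "n = 0"
    then show False using n(2) rot_reduced_upto_1 by simp
  qed
  then obtain m where m: "n = Suc m" by (cases n) auto
  have bad: "\<not> rmin (rotI (Suc n)) (rot_low n)" using n unfolding rot_reduced_upto_def by (auto simp: less_Suc_eq)
  have red: "reduced (rot_expr (M - {a}) a t k)" if "k \<le> n" for k
    using rpath_reduced rpath_rot_self that n(1) unfolding rot_reduced_upto_def by (meson order_less_le_trans)
  \<comment> \<open>The criterion for the next step up turns its failure into non-reducedness.\<close>
  have "\<not> reduced (rot_expr (M - {a}) a t (Suc n))"
  proof
    assume r: "reduced (rot_expr (M - {a}) a t (Suc n))"
    have p: "rpath (rotI 0) (rot_expr (M - {a}) a t n @ [rotL (Suc n)]) (rot_max n) (rotL (Suc n))"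
      using rpath_rot_down[of "rotI 0" "[]" n \<one>] rpath_rot_self[OF n(1)] by simp
    have "reduced ((rot_expr (M - {a}) a t n @ [rotL (Suc n)]) @ [insert (rot_elt (Suc n)) (rotL (Suc n))])"
      using r unfolding rot_expr_Suc rotI_Suc(1)[symmetric] by simp
    then have "rmin (insert (rot_elt (Suc n)) (rotL (Suc n))) (rot_low n)"
      using reduced_up_iff[OF p rotI_Suc(2)] unfolding rotI_Suc(1)[symmetric] by simp
    then show False using bad unfolding rotI_Suc(1)[symmetric] by simp
  qed
  then have "rot_delta (M - {a}) a t = n"
    unfolding rot_delta_def using red
    by (intro Greatest_equality) (auto simp: not_less_eq_eq[symmetric])
  moreover have "rot_max n = longest M" by (rule rot_stop_imp_longest[OF n(1) bad])
  ultimately show ?thesis using n(1) unfolding m by (intro exI[of _ m]) simp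
qed

text \<open>At the end, conjugation by \<open>w\<^sub>M\<close> maps the two elements missing from \<open>L\<^bsub>\<delta>+1\<^esub>\<close> to the two missing from
  \<open>L\<^sub>0\<close>, namely \<open>a\<close> and \<open>w\<^sub>M t w\<^sub>M\<close>. If \<open>u\<^sub>\<delta>\<close> went to \<open>a\<close>, then \<open>rot_low (\<delta> - 1)\<close> would be
  \<open>w w\<^sub>M\<close> with \<open>w\<close> longest for \<open>I\<^sub>0\<close>, which has no left descent in \<open>I\<^sub>0\<close>; but the path starts with a nontrivial
  element of the parabolic subgroup of \<open>I\<^sub>0\<close>, whose left descents persist. Hence \<open>u\<^sub>\<delta> = t\<close>, and
  \<open>u\<^bsub>\<delta>+1\<^esub> = w\<^sub>M a w\<^sub>M\<close> determines \<open>u\<^bsub>\<delta>-1\<^esub>\<close>.\<close>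
lemma rot_end:
  assumes g: "rot_reduced_upto (Suc m)" and X: "rot_max (Suc m) = longest M"
  shows "rot_elt (Suc (Suc m)) = t" and "rot_elt (Suc m) = conj_longest (M - {t}) (conj_longest M a)"
proof -
  let ?c = "conj_longest M" and ?p = "rot_elt (Suc (Suc (Suc m)))" and ?q = "rot_elt (Suc (Suc m))"
  have pq: "?p \<in> M" "?q \<in> M" "rot_elt (Suc m) \<in> M" using rot_elt_in by blast+
  have Mc: "x \<in> M \<Longrightarrow> x \<in> carrier W" for x using rot_set_sub by auto
  have inj: "inj_on ?c M" using conj_longest_inj[OF M] Mc by (auto intro: inj_onI)
  have "conj_by (rot_low (Suc m)) x = ?c (conj_longest (rotL (Suc (Suc m))) x)" if "x \<in> rotL (Suc (Suc m))" for x
    using that Mc M unfolding X by (simp add: conj_by_mult conj_by_longest)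
  then have "conj_by (rot_low (Suc m)) ` rotL (Suc (Suc m)) =
      ?c ` (conj_longest (rotL (Suc (Suc m))) ` rotL (Suc (Suc m)))"
    unfolding image_image by (rule image_cong[OF refl])
  then have "?c ` rotL (Suc (Suc m)) = rotL 0"
    unfolding conj_longest_image[OF rot_fin(2)] rot_low_conj by simp
  moreover have "?c ` rotL (Suc (Suc m)) = M - {?c ?p, ?c ?q}"
    using inj_on_image_set_diff[OF inj, of M "{?p, ?q}"] pq M by simp
  moreover have "rotL 0 = M - {a, ?c t}" using rot_elt_1 by (simp add: rot_elt_def)
  ultimately have "M - {?c ?p, ?c ?q} = M - {a, ?c t}" by simp
  then have eq: "{?c ?p, ?c ?q} = {a, ?c t}" using a conj_longest_in[OF M] t pq by blast
  have "?c ?q \<noteq> a"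
  proof
    assume q: "?c ?q = a"
    have I0: "rotI 0 = M - {a}" using rot_elt_1 by simp
    let ?w = "longest (rotI 0)"
    have "?c ` rotI (Suc m) = M - {a}"
      using inj_on_image_set_diff[OF inj, of M "{?q}"] pq M q by simp
    then have cw: "?c (longest (rotI (Suc m))) = ?w"
      using conj_longest_longest[OF M, of "rotI (Suc m)"] I0 by simp
    have "rot_low m = rot_max (Suc m) \<otimes> longest (rotI (Suc m))" by simp
    also have "\<dots> = ?w \<otimes> longest M" unfolding X using conj_longest_swap[OF M] cw by simp
    finally have low: "rot_low m = ?w \<otimes> longest M" .
    have I0S: "rotI 0 \<subseteq> S" using rot_set_sub by blast
    have L0: "longest (rotL (Suc 0)) \<in> generate W (rotI 0)"
      using par_mono[OF _ longest_in[OF rot_fin(2)]] rotL_Suc by (metis Diff_subset)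
    have low0: "rot_low 0 \<in> generate W (rotI 0)" using longest_in[OF rot_fin(1)[of 0]] L0 par_mult by simp
    have "rot_low 0 \<noteq> \<one>"
    proof
      assume "rot_low 0 = \<one>"
      then have "rot_low 0 \<otimes> longest (rotL (Suc 0)) = longest (rotL (Suc 0))" by simp
      then have "?w = longest (rotL (Suc 0))" by simp
      then have "rotI 0 = rotL (Suc 0)" using longest_rdesc[OF rot_fin(1)[of 0]] longest_rdesc[OF rot_fin(2)] by metis
      then show False using rot_elt_in[of "Suc 0"] by auto
    qed
    then obtain i where i: "i \<in> rotI 0" "i \<in> ldesc (rot_low 0)" using ex_ldesc[OF I0S low0] by blast
    have "i \<in> ldesc (rot_low k)" if "k \<le> m" for k
      using that
    proof (induction k)
      case (Suc k)
      have "rmin (rotI (Suc k)) (rot_low k)" using g Suc unfolding rot_reduced_upto_def by simp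
      moreover have "longest (rotL (Suc (Suc k))) \<in> generate W (rotI (Suc k))"
        using par_mono[OF _ longest_in[OF rot_fin(2)]] rotL_Suc by (metis Diff_subset)
      then have "longest (rotI (Suc k)) \<otimes> longest (rotL (Suc (Suc k))) \<in> generate W (rotI (Suc k))"
        using longest_in[OF rot_fin(1)] par_mult by blast
      moreover have "rotI (Suc k) \<subseteq> S" using rot_set_sub by blast
      ultimately have "i \<in> ldesc (rot_low k \<otimes> (longest (rotI (Suc k)) \<otimes> longest (rotL (Suc (Suc k)))))"
        using ldesc_rmin_mult Suc by simp
      then show ?case by (simp add: m_assoc)
    qed (use i in simp)
    from this[of m] have im: "i \<in> ldesc (?w \<otimes> longest M)" unfolding low by simp
    have iS: "i \<in> S" using i rot_set_sub by blast
    have wM: "?w \<in> generate W M" using par_mono[OF _ longest_in[OF rot_fin(1)]] by blast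
    have iw: "i \<otimes> ?w \<in> generate W M" using par_mult[OF par_gen wM] i by blast
    have "\<ell> (i \<otimes> (?w \<otimes> longest M)) + \<ell> (i \<otimes> ?w) = \<ell> (longest M)"
      using len_longest_mult(2)[OF M iw] iS M by (simp add: m_assoc)
    moreover have "\<ell> (?w \<otimes> longest M) + \<ell> ?w = \<ell> (longest M)" using len_longest_mult(2)[OF M wM] .
    moreover have "\<ell> (i \<otimes> ?w) < \<ell> ?w" using longest_ldesc[OF rot_fin(1)[of 0]] i unfolding ldesc_def by blast
    ultimately show False using im unfolding ldesc_def by simp
  qed
  then have e: "?c ?q = ?c t" "?c ?p = a" using eq by (auto simp: doubleton_eq_iff)
  then show qt: "?q = t" using conj_longest_inj[OF M] Mc pq t by blast
  have "?p = ?c a" using e(2) conj_longest_invol[OF M] Mc pq by metis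
  moreover have "?p = conj_longest (rotI (Suc m)) (rot_elt (Suc m))" by (rule rot_elt_step)
  ultimately have "rot_elt (Suc m) = conj_longest (rotI (Suc m)) (?c a)"
    using conj_longest_invol[OF rot_fin(1)] Mc pq by metis
  then show "rot_elt (Suc m) = conj_longest (M - {t}) (?c a)" using qt by simp
qed

text \<open>The long side of the switchback relation, with the last subset split off: its penultimate subset
  is \<open>L\<^sub>\<delta>\<close>, and the coset reached there is determined by the length-additivity of the last step.\<close>
lemma rotation_path:
  obtains E where "rot_expr (M - {a}) a t (rot_delta (M - {a}) a t) = E @ [M - {t}]"
    and "\<And>J F z. rmin M z \<Longrightarrow> rpath J (F @ [M - {a}]) (z \<otimes> longest (M - {a})) (M - {a}) \<Longrightarrow>
      rpath J (F @ E) (z \<otimes> longest M \<otimes> longest (M - {t}) \<otimes>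
          longest (M - {t} - {conj_longest (M - {t}) (conj_longest M a)}))
        (M - {t} - {conj_longest (M - {t}) (conj_longest M a)})"
proof -
  obtain m where m: "rot_delta (M - {a}) a t = Suc m" "rot_reduced_upto (Suc m)" "rot_max (Suc m) = longest M"
    using rot_delta_char by blast
  note e = rot_end[OF m(2,3)]
  let ?L = "M - {t} - {conj_longest (M - {t}) (conj_longest M a)}"
  have L: "rotL (Suc m) = ?L" using e by auto
  have I: "rotI (Suc m) = M - {t}" using e by simp
  let ?E = "rot_expr (M - {a}) a t m @ [rotL (Suc m)]"
  have 1: "rot_expr (M - {a}) a t (rot_delta (M - {a}) a t) = ?E @ [M - {t}]"
    unfolding m(1) rot_expr_Suc I by simp
  have "rot_max m = rot_max (Suc m) \<otimes> longest (rotI (Suc m)) \<otimes> longest (rotL (Suc m))" by simp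
  then have x: "rot_max m = longest M \<otimes> longest (M - {t}) \<otimes> longest ?L" unfolding m(3) I L .
  have gm: "rot_reduced_upto m" using m(2) unfolding rot_reduced_upto_def by simp
  have fin: "finitary (M - {t})" "finitary ?L" by (rule finitary_mono[OF M]; blast)+
  have 2: "rpath J (F @ ?E) (z \<otimes> longest M \<otimes> longest (M - {t}) \<otimes> longest ?L) ?L"
    if z: "rmin M z" and p: "rpath J (F @ [M - {a}]) (z \<otimes> longest (M - {a})) (M - {a})" for J F z
  proof -
    have "rpath J (F @ [rotI 0]) (z \<otimes> longest (rotI 0)) (rotI 0)" using p rot_elt_1 by simp
    from rpath_rot_down[OF rpath_rot_expr[OF z this gm]]
    have "rpath J (F @ ?E) (z \<otimes> rot_max m) ?L" unfolding L .
    then show ?thesis unfolding x using z M fin by (simp add: m_assoc)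
  qed
  show ?thesis using that[OF 1 2] .
qed

end


section \<open>Braid equivalence of reduced expressions\<close>

inductive braid_step :: "'a set list \<Rightarrow> 'a set list \<Rightarrow> bool" where
  "braid Xs Ys \<or> braid Ys Xs \<Longrightarrow> braid_step (As @ Xs @ Bs) (As @ Ys @ Bs)"

abbreviation braid_equiv :: "'a set list \<Rightarrow> 'a set list \<Rightarrow> bool" (infix "\<leftrightharpoons>" 50) where
  "E \<leftrightharpoons> E' \<equiv> braid_step\<^sup>*\<^sup>* E E'"

lemma braid_step_sym: "braid_step E E' \<Longrightarrow> braid_step E' E"
  by (auto elim!: braid_step.cases intro: braid_step.intros)

lemma braid_equiv_sym: "E \<leftrightharpoons> E' \<Longrightarrow> E' \<leftrightharpoons> E"
proof (induction rule: rtranclp_induct)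
  case (step y z)
  then show ?case using braid_step_sym converse_rtranclp_into_rtranclp[of braid_step z y E] by blast
qed simp

lemma braid_step_append: "braid_step E E' \<Longrightarrow> braid_step (E @ B) (E' @ B)"
  using braid_step.intros by (fastforce elim!: braid_step.cases)

lemma braid_equiv_append: "E \<leftrightharpoons> E' \<Longrightarrow> E @ B \<leftrightharpoons> E' @ B"
proof (induction rule: rtranclp_induct)
  case (step y z)
  then show ?case using braid_step_append[of y z B] by (meson rtranclp.rtrancl_into_rtrancl)
qed simp

lemma braid_equiv_braid: "braid Xs Ys \<Longrightarrow> As @ Xs @ Bs \<leftrightharpoons> As @ Ys @ Bs"
  using braid_step.intros by (blast intro: r_into_rtranclp)

lemma move_append: "move E E' \<Longrightarrow> move (E @ B) (E' @ B)"
  using move.intros by (fastforce elim!: move.cases)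

lemma moves_append: "move\<^sup>*\<^sup>* E E' \<Longrightarrow> move\<^sup>*\<^sup>* (E @ B) (E' @ B)"
proof (induction rule: rtranclp_induct)
  case (step y z)
  then show ?case using move_append[of y z B] by (meson rtranclp.rtrancl_into_rtrancl)
qed simp

lemma braid_equiv_moves: "E \<leftrightharpoons> E' \<Longrightarrow> move\<^sup>*\<^sup>* E E'"
proof (induction rule: rtranclp_induct)
  case (step y z)
  then have "move y z" by (auto elim!: braid_step.cases intro: move.intros)
  then show ?case using step by (meson rtranclp.rtrancl_into_rtrancl)
qed simp

text \<open>For \<open>y\<close> fixed this criterion depends on \<open>A\<close> only through membership of elements \<open>y\<^sup>-\<^sup>1 j y\<close>, which makes
  the possible last steps up into a pair easy to compare.\<close>
lemma dmax_iff:
  assumes J: "finitary J" and A: "finitary A" and y: "rmin A y"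
  shows "dmax J (y \<otimes> longest A) A \<longleftrightarrow> (\<forall>j \<in> J. j \<in> ldesc y \<or> (\<exists>r \<in> A. j \<otimes> y = y \<otimes> r))"
proof -
  have AS: "A \<subseteq> S" and JS: "J \<subseteq> S" using A J finitary_sub by auto
  have "j \<in> ldesc (y \<otimes> longest A) \<longleftrightarrow> j \<in> ldesc y \<or> (\<exists>r \<in> A. j \<otimes> y = y \<otimes> r)" if j: "j \<in> J" for j
    using ldesc_rmin_cases[OF AS y longest_in[OF A]] ldesc_rmin_mult[OF AS y longest_in[OF A]]
      ldesc_transport[OF AS y longest_in[OF A]] longest_ldesc[OF A] j JS by blast
  then show ?thesis unfolding dmax_def using J A y rmin_longest_rdesc[OF A y] by auto
qed

lemma dmax_iff':
  assumes st: "dmax J x I" and A: "A \<subseteq> I"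
  shows "dmax J (x \<otimes> longest I \<otimes> longest A) A \<longleftrightarrow>
    (\<forall>j \<in> J. j \<in> ldesc (x \<otimes> longest I) \<or> (\<exists>r \<in> A. j \<otimes> (x \<otimes> longest I) = x \<otimes> longest I \<otimes> r))"
  using dmax_iff[OF dmaxD(1)[OF st] finitary_mono[OF dmaxD(2)[OF st] A] rmin_mono[OF dmax_rmin[OF st] A]] .

lemma rpath_up_rmin:
  assumes "rpath J F (y \<otimes> longest A) A" "s \<notin> A" "finitary (insert s A)" "rmin (insert s A) y"
  shows "rpath J (F @ [insert s A]) (y \<otimes> longest (insert s A)) (insert s A)"
proof -
  have "finitary A" using finitary_mono[OF assms(3)] by blast
  then have "y \<otimes> longest A \<otimes> longest A = y" using assms(4) by simp
  then show ?thesis using rpath.up[OF assms(1-3)] assms(4) by simp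
qed

text \<open>If no last step up into \<open>(x,I)\<close> exists, then the redundancy is all of \<open>I\<close>: conjugation by \<open>y = x w\<^sub>I\<close>
  carries \<open>I\<close> into \<open>J\<close>, and the right descents of \<open>y\<close> remain right descents of \<open>y w\<^sub>I = x\<close>.\<close>
lemma no_up_step_rdesc:
  assumes st: "dmax J x I" and no: "\<And>t. t \<in> I \<Longrightarrow> \<not> dmax J (x \<otimes> longest I \<otimes> longest (I - {t})) (I - {t})"
  shows "\<forall>t \<in> I. conj_by (x \<otimes> longest I) t \<in> J" and "rdesc (x \<otimes> longest I) \<subseteq> rdesc x"
proof -
  note D = dmaxD[OF st]
  let ?y = "x \<otimes> longest I"
  have ym: "rmin I ?y" using dmax_rmin[OF st] .
  have yc: "?y \<in> carrier W" using D by simp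
  show *: "\<forall>t \<in> I. conj_by ?y t \<in> J"
  proof
    fix t assume t: "t \<in> I"
    then obtain j where j: "j \<in> J" "j \<notin> ldesc ?y" "\<forall>r \<in> I - {t}. j \<otimes> ?y \<noteq> ?y \<otimes> r"
      using no[OF t] dmax_iff'[OF st, of "I - {t}"] by auto
    have "dmax J (x \<otimes> longest I \<otimes> longest I) I" using st D by simp
    then have "\<exists>r \<in> I. j \<otimes> ?y = ?y \<otimes> r" using dmax_iff'[OF st order_refl] j by blast
    then have "j \<otimes> ?y = ?y \<otimes> t" using j by blast
    then have "conj_by ?y t = j \<otimes> ?y \<otimes> inv ?y" unfolding conj_by_def by simp
    moreover have "j \<in> carrier W" using j(1) D(6) gens_closed by blast
    ultimately show "conj_by ?y t \<in> J" using j yc by (simp add: m_assoc del: inv_mult_group)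
  qed
  show "rdesc ?y \<subseteq> rdesc x"
  proof
    fix s assume "s \<in> rdesc ?y"
    then have "s \<in> rdesc (?y \<otimes> longest I)" using rdesc_normalizing[OF D(2) ym] * D by blast
    then show "s \<in> rdesc x" using D by simp
  qed
qed

lemma len_strip: "dmax J x I \<Longrightarrow> \<ell> (x \<otimes> longest I) + \<ell> (longest I) = \<ell> x"
  using rdesc_strip[OF _ _ _ longest_in] dmaxD by metis

lemma dmax_insert:
  assumes st: "dmax J x I" and s: "s \<in> rdesc x"
  shows "dmax J x (insert s I)"
proof -
  note D = dmaxD[OF st]
  have sub: "insert s I \<subseteq> S" "insert s I \<subseteq> rdesc x" using s D(5,7) unfolding rdesc_def by auto
  have "finite (insert s I)" using finitary_finite[OF D(2)] by simp
  from finitaryI[OF sub(1) this D(3) sub(2)] show ?thesis using st sub(2) unfolding dmax_def by blast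
qed

text \<open>Undoing a step down shortens \<open>x w\<^sub>I\<close> and keeps \<open>x\<close>, while undoing a step up shortens \<open>x\<close> and keeps
  \<open>x w\<^sub>I\<close>; the sum of the two lengths decreases in both cases.\<close>
definition weight :: "'a \<Rightarrow> 'a set \<Rightarrow> nat" where
  "weight x I = \<ell> x + \<ell> (x \<otimes> longest I)"

lemma weight_insert:
  assumes "dmax J x (insert s I)" "s \<notin> I" shows "weight x (insert s I) < weight x I"
proof -
  have "dmax J x I" using dmax_down[OF assms(1)] by blast
  moreover have "\<ell> (longest I) < \<ell> (longest (insert s I))"
    using len_longest_psubset[OF dmaxD(2)[OF assms(1)]] assms(2) by blast
  ultimately show ?thesis using len_strip[OF assms(1)] len_strip[of J x I] unfolding weight_def by linarith
qed

lemma weight_remove: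
  assumes st: "dmax J x I" and t: "t \<in> I" and st': "dmax J (x \<otimes> longest I \<otimes> longest (I - {t})) (I - {t})"
  shows "weight (x \<otimes> longest I \<otimes> longest (I - {t})) (I - {t}) < weight x I"
proof -
  note D = dmaxD[OF st]
  have "finitary (I - {t})" using dmaxD(2)[OF st'] .
  then have "x \<otimes> longest I \<otimes> longest (I - {t}) \<otimes> longest (I - {t}) = x \<otimes> longest I" using D by simp
  moreover have "\<ell> (longest (I - {t})) < \<ell> (longest I)" using len_longest_psubset[OF D(2)] t by blast
  ultimately show ?thesis using len_strip[OF st] len_strip[OF st'] unfolding weight_def by simp
qed

lemma rpath_up_remove:
  assumes st: "dmax J x I" and t: "t \<in> I" and p: "rpath J F (x \<otimes> longest I \<otimes> longest (I - {t})) (I - {t})"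
  shows "rpath J (F @ [I]) x I"
proof -
  note D = dmaxD[OF st]
  have I: "insert t (I - {t}) = I" using t by blast
  have "rpath J (F @ [insert t (I - {t})]) (x \<otimes> longest I \<otimes> longest (insert t (I - {t}))) (insert t (I - {t}))"
    using rpath_up_rmin[OF p, of t] D(2) dmax_rmin[OF st] I by simp
  then show ?thesis unfolding I using D by simp
qed

text \<open>Undo steps as long as possible. When neither kind of step can be undone, \<open>x w\<^sub>I\<close> has no right
  descent at all, so \<open>x = w\<^sub>I\<close> and \<open>I = J\<close>.\<close>
lemma ex_rpath: "dmax J x I \<Longrightarrow> \<exists>E. rpath J E x I"
proof (induction "weight x I" arbitrary: x I rule: less_induct)
  case less
  note D = dmaxD[OF less(2)]
  let ?y = "x \<otimes> longest I"
  consider s where "s \<in> rdesc x" "s \<notin> I"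
    | t where "t \<in> I" "dmax J (?y \<otimes> longest (I - {t})) (I - {t})"
    | "rdesc x \<subseteq> I" "\<And>t. t \<in> I \<Longrightarrow> \<not> dmax J (?y \<otimes> longest (I - {t})) (I - {t})"
    by blast
  then show ?case
  proof cases
    case 1
    have st: "dmax J x (insert s I)" using dmax_insert[OF less(2) 1(1)] .
    then obtain E where "rpath J E x (insert s I)" using less(1)[OF weight_insert[OF st 1(2)] st] by blast
    then have "rpath J (E @ [insert s I - {s}]) x (insert s I - {s})" using rpath.down by blast
    then show ?thesis using 1 by auto
  next
    case 2
    then obtain F where "rpath J F (?y \<otimes> longest (I - {t})) (I - {t})"
      using less(1)[OF weight_remove[OF less(2) 2] 2(2)] by blast
    then show ?thesis using rpath_up_remove[OF less(2) 2(1)] by blast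
  next
    case 3
    note N = no_up_step_rdesc[OF less(2) 3(2)]
    have "rdesc ?y = {}" using N(2) 3(1) dmax_rmin[OF less(2)] unfolding rmin_def by blast
    moreover have "?y \<in> generate W S" using D gens_generate by simp
    ultimately have y1: "?y = \<one>" using ex_rdesc[of S ?y] by blast
    then have "?y \<otimes> longest I = longest I" using D by simp
    then have x: "x = longest I" using D by simp
    have "I \<subseteq> J"
    proof
      fix t assume t: "t \<in> I"
      then have "conj_by \<one> t \<in> J" using N(1) unfolding y1 by blast
      moreover have "conj_by \<one> t = t" using t D unfolding conj_by_def by auto
      ultimately show "t \<in> J" by simp
    qed
    moreover have "J \<subseteq> I" using D(4) longest_ldesc[OF D(2)] x by simp
    ultimately have "I = J" by blast
    then show ?thesis using rpath.base D x by blast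
  qed
qed

lemma rpath_last_step:
  assumes "rpath J E x I"
  shows "(E = [J] \<and> x = longest J \<and> I = J) \<or>
    (\<exists>s E1. s \<notin> I \<and> E = E1 @ [I] \<and> rpath J E1 x (insert s I)) \<or>
    (\<exists>t E1. t \<in> I \<and> E = E1 @ [I] \<and> rpath J E1 (x \<otimes> longest I \<otimes> longest (I - {t})) (I - {t}))"
  using assms
proof cases
  case base
  then show ?thesis by blast
next
  case (down E1 I1 s)
  then have "insert s I = I1" by blast
  then show ?thesis using down by blast
next
  case (up E1 x1 I1 s)
  then have I1: "I1 = I - {s}" by blast
  note D = dmaxD[OF rpath_dmax[OF up(4)]]
  have "x \<otimes> longest I \<otimes> longest I1 = x1" using up D by (simp add: m_assoc)
  then have "rpath J E1 (x \<otimes> longest I \<otimes> longest (I - {s})) (I - {s})" using up(4) unfolding I1 by simp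
  moreover have "s \<in> I" "E = E1 @ [I]" using up by simp_all
  ultimately show ?thesis by blast
qed

lemma rpath_base_unique:
  assumes "rpath J E (longest J) J"
  shows "E = [J]"
proof -
  have J: "finitary J" using dmaxD(1)[OF rpath_dmax[OF assms]] .
  show ?thesis using rpath_last_step[OF assms]
  proof (elim disjE exE conjE)
    fix s E1 assume s: "s \<notin> J" "rpath J E1 (longest J) (insert s J)"
    then have "insert s J \<subseteq> rdesc (longest J)" using dmaxD(5)[OF rpath_dmax] by blast
    then show ?thesis using s longest_rdesc[OF J] by blast
  next
    fix t E1 assume t: "t \<in> J" "rpath J E1 (longest J \<otimes> longest J \<otimes> longest (J - {t})) (J - {t})"
    have f: "finitary (J - {t})" using finitary_mono[OF J] by blast
    have "J \<subseteq> ldesc (longest (J - {t}))" using dmaxD(4)[OF rpath_dmax[OF t(2)]] J f by simp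
    then show ?thesis using t longest_ldesc[OF f] by blast
  qed
qed

lemma matsumoto_down_down:
  assumes st: "dmax J x I" and s: "s \<in> rdesc x" "s \<notin> I" and t: "t \<in> rdesc x" "t \<notin> I" and st_ne: "s \<noteq> t"
  shows "\<exists>F G. rpath J F x (insert s I) \<and> rpath J G x (insert t I) \<and> F @ [I] \<leftrightharpoons> G @ [I]"
proof -
  let ?M = "insert t (insert s I)"
  have stM: "dmax J x ?M" using dmax_insert[OF dmax_insert[OF st s(1)] t(1)] .
  then obtain E where E: "rpath J E x ?M" using ex_rpath by blast
  obtain E0 where E0: "E = E0 @ [?M]" using rpath_nonempty[OF E] rpath_last[OF E] by (metis append_butlast_last_id)
  have m: "?M - {t} = insert s I" "?M - {s} = insert t I" "insert s I - {s} = I" "insert t I - {t} = I"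
    using s t st_ne by auto
  have F: "rpath J (E @ [insert s I]) x (insert s I)" using rpath.down[OF E, of t] m by simp
  have G: "rpath J (E @ [insert t I]) x (insert t I)" using rpath.down[OF E, of s] m by simp
  have "braid [?M, ?M - {t}, ?M - {t} - {s}] [?M, ?M - {s}, ?M - {s} - {t}]"
    using braid.down_down[of ?M t s] dmaxD(2)[OF stM] st_ne by blast
  then have "E0 @ [?M, insert s I, I] @ [] \<leftrightharpoons> E0 @ [?M, insert t I, I] @ []"
    unfolding m by (rule braid_equiv_braid)
  then show ?thesis using F G E0 by (intro exI[of _ "E @ [insert s I]"] exI[of _ "E @ [insert t I]"]) simp
qed

text \<open>If \<open>y\<^sup>-\<^sup>1 j y\<close> lies both in \<open>I - {s}\<close> and in \<open>I - {t}\<close>, then it lies in their intersection, which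
  therefore is a valid common source.\<close>
lemma matsumoto_up_up:
  assumes st: "dmax J x I" and s: "s \<in> I" "dmax J (x \<otimes> longest I \<otimes> longest (I - {s})) (I - {s})"
    and t: "t \<in> I" "dmax J (x \<otimes> longest I \<otimes> longest (I - {t})) (I - {t})" and st_ne: "s \<noteq> t"
  shows "\<exists>F G. rpath J F (x \<otimes> longest I \<otimes> longest (I - {s})) (I - {s}) \<and>
    rpath J G (x \<otimes> longest I \<otimes> longest (I - {t})) (I - {t}) \<and> F @ [I] \<leftrightharpoons> G @ [I]"
proof -
  note D = dmaxD[OF st]
  let ?y = "x \<otimes> longest I" and ?A = "I - {s} - {t}"
  have yc: "?y \<in> carrier W" using D by simp
  have ym: "rmin I ?y" using dmax_rmin[OF st] .
  have "dmax J (?y \<otimes> longest ?A) ?A"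
  proof (subst dmax_iff'[OF st], blast, rule ballI)
    fix j assume j: "j \<in> J"
    have 1: "j \<in> ldesc ?y \<or> (\<exists>r \<in> I - {s}. j \<otimes> ?y = ?y \<otimes> r)"
      using dmax_iff'[OF st, of "I - {s}"] s j by auto
    have 2: "j \<in> ldesc ?y \<or> (\<exists>r \<in> I - {t}. j \<otimes> ?y = ?y \<otimes> r)"
      using dmax_iff'[OF st, of "I - {t}"] t j by auto
    show "j \<in> ldesc ?y \<or> (\<exists>r \<in> ?A. j \<otimes> ?y = ?y \<otimes> r)"
    proof (subst disj_imp, rule impI)
      assume "j \<notin> ldesc ?y"
      then obtain r r' where r: "r \<in> I - {s}" "j \<otimes> ?y = ?y \<otimes> r" "r' \<in> I - {t}" "j \<otimes> ?y = ?y \<otimes> r'"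
        using 1 2 by blast
      moreover have "r \<in> carrier W" "r' \<in> carrier W" using r D(7) gens_closed by blast+
      ultimately have "r = r'" using yc by simp
      then show "\<exists>r \<in> ?A. j \<otimes> ?y = ?y \<otimes> r" using r by blast
    qed
  qed
  then obtain E where E: "rpath J E (?y \<otimes> longest ?A) ?A" using ex_rpath by blast
  obtain E0 where E0: "E = E0 @ [?A]" using rpath_nonempty[OF E] rpath_last[OF E] by (metis append_butlast_last_id)
  have m: "insert s ?A = I - {t}" "insert t ?A = I - {s}" "insert s (I - {s}) = I" "insert t (I - {t}) = I"
    using s t st_ne by auto
  have fin: "finitary (I - {s})" "finitary (I - {t})" using dmaxD(2)[OF s(2)] dmaxD(2)[OF t(2)] by auto
  have F: "rpath J (E @ [I - {s}]) (?y \<otimes> longest (I - {s})) (I - {s})"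
    using rpath_up_rmin[OF E, of t] m fin rmin_mono[OF ym, of "I - {s}"] by auto
  have G: "rpath J (E @ [I - {t}]) (?y \<otimes> longest (I - {t})) (I - {t})"
    using rpath_up_rmin[OF E, of s] m fin rmin_mono[OF ym, of "I - {t}"] by auto
  have "?A \<union> {t, s} = I" using s t by blast
  then have "finitary (?A \<union> {t, s})" using D(2) by simp
  moreover have "t \<in> S - ?A" "s \<in> S - ?A" "t \<noteq> s" using s t D(7) st_ne by auto
  ultimately have "braid [?A, insert t ?A, insert s (insert t ?A)] [?A, insert s ?A, insert t (insert s ?A)]"
    by (intro braid.up_up)
  then have "E0 @ [?A, I - {s}, I] @ [] \<leftrightharpoons> E0 @ [?A, I - {t}, I] @ []"
    unfolding m by (rule braid_equiv_braid)
  then show ?thesis using F G E0 by (intro exI[of _ "E @ [I - {s}]"] exI[of _ "E @ [I - {t}]"]) simp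
qed

text \<open>Write \<open>x = z w\<^sub>M\<close> with \<open>M = Is\<close>. The common source is \<open>(z w\<^sub>K, K)\<close> with \<open>K = M - {a}\<close> and
  \<open>a = w\<^sub>M w\<^sub>I t w\<^sub>I w\<^sub>M\<close>. It is a valid pair because \<open>j z = z a\<close> is equivalent to \<open>j y = y t\<close>,
  which the last step up from \<open>I - {t}\<close> excludes. The choice of \<open>a\<close> also makes
  \<open>I - {t}\<close> the penultimate subset of the rotation expression from \<open>K\<close> to \<open>I\<close>.\<close>
lemma matsumoto_down_up:
  assumes st: "dmax J x I" and s: "s \<in> rdesc x" "s \<notin> I"
    and t: "t \<in> I" "dmax J (x \<otimes> longest I \<otimes> longest (I - {t})) (I - {t})"
  shows "\<exists>F G. rpath J F x (insert s I) \<and>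
    rpath J G (x \<otimes> longest I \<otimes> longest (I - {t})) (I - {t}) \<and> F @ [I] \<leftrightharpoons> G @ [I]"
proof -
  note D = dmaxD[OF st]
  let ?M = "insert s I"
  let ?b = "conj_longest I t"
  let ?a = "conj_longest ?M ?b"
  let ?z = "x \<otimes> longest ?M" and ?y = "x \<otimes> longest I"
  have stM: "dmax J x ?M" using dmax_insert[OF st s(1)] .
  have M: "finitary ?M" using dmaxD(2)[OF stM] .
  have c: "t \<in> carrier W" "?b \<in> carrier W" "?z \<in> carrier W" "?y \<in> carrier W" "s \<in> S" "t \<in> S"
    using t D M s unfolding rdesc_def by auto
  have bI: "?b \<in> I" using conj_longest_in[OF D(2) t(1)] .
  have aM: "?a \<in> ?M" using conj_longest_in[OF M] bI by blast
  have as: "?a \<noteq> conj_longest ?M s" using conj_longest_inj[OF M c(2), of s] c bI s by auto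
  have MI: "?M - {s} = I" using s by blast
  have zm: "rmin ?M ?z" using dmax_rmin[OF stM] .
  have ym: "rmin I ?y" using dmax_rmin[OF st] .
  have y: "?y = ?z \<otimes> (longest ?M \<otimes> longest I)" using D M by (simp add: m_assoc)
  have ayt: "?a \<otimes> (longest ?M \<otimes> longest I) = longest ?M \<otimes> longest I \<otimes> t"
    using D M c unfolding conj_longest_def by (simp add: m_assoc)
  have ac: "?a \<in> carrier W" using c M by simp
  \<comment> \<open>By the criterion, only an element \<open>j\<close> with \<open>j z = z a\<close> could make this fail.\<close>
  have "dmax J (?z \<otimes> longest (?M - {?a})) (?M - {?a})"
  proof (subst dmax_iff'[OF stM], blast, rule ballI)
    fix j assume j: "j \<in> J"
    have jc: "j \<in> carrier W" using j D(6) gens_closed by blast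
    have "dmax J (?z \<otimes> longest ?M) ?M" using stM M D by simp
    then consider "j \<in> ldesc ?z" | r where "r \<in> ?M" "j \<otimes> ?z = ?z \<otimes> r"
      using dmax_iff'[OF stM order_refl] j by blast
    then show "j \<in> ldesc ?z \<or> (\<exists>r \<in> ?M - {?a}. j \<otimes> ?z = ?z \<otimes> r)"
    proof cases
      case 2
      have "r \<noteq> ?a"
      proof
        assume ra: "r = ?a"
        have "j \<otimes> ?y = j \<otimes> ?z \<otimes> (longest ?M \<otimes> longest I)" unfolding y using c jc M D by (simp add: m_assoc)
        also have "\<dots> = ?z \<otimes> ?a \<otimes> (longest ?M \<otimes> longest I)" using 2 ra by simp
        also have "\<dots> = ?z \<otimes> (?a \<otimes> (longest ?M \<otimes> longest I))"
          using m_assoc[OF c(3) ac, of "longest ?M \<otimes> longest I"] M D by simp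
        also have "\<dots> = ?y \<otimes> t" unfolding ayt y using c M D by (simp add: m_assoc)
        finally have jy: "j \<otimes> ?y = ?y \<otimes> t" .
        have "t \<notin> rdesc ?y" using ym t unfolding rmin_def by blast
        then have "j \<notin> ldesc ?y" using jy c unfolding ldesc_def rdesc_def by auto
        then obtain r' where "r' \<in> I - {t}" "j \<otimes> ?y = ?y \<otimes> r'"
          using dmax_iff'[OF st, of "I - {t}"] t j by auto
        moreover from this have "r' \<in> carrier W" using D(7) gens_closed by blast
        ultimately show False using jy c by simp
      qed
      then show ?thesis using 2 by blast
    qed simp
  qed
  then obtain E where E: "rpath J E (?z \<otimes> longest (?M - {?a})) (?M - {?a})" using ex_rpath by blast
  obtain E0 where E0: "E = E0 @ [?M - {?a}]"
    using rpath_nonempty[OF E] rpath_last[OF E] by (metis append_butlast_last_id)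
  have Ma: "insert ?a (?M - {?a}) = ?M" using aM by blast
  have F: "rpath J (E @ [?M]) x ?M"
    using rpath_up_remove[OF stM aM E] .
  obtain R where R: "rot_expr (?M - {?a}) ?a s (rot_delta (?M - {?a}) ?a s) = R @ [?M - {s}]"
    and RP: "\<And>J F z. rmin ?M z \<Longrightarrow> rpath J (F @ [?M - {?a}]) (z \<otimes> longest (?M - {?a})) (?M - {?a}) \<Longrightarrow>
      rpath J (F @ R) (z \<otimes> longest ?M \<otimes> longest (?M - {s}) \<otimes>
          longest (?M - {s} - {conj_longest (?M - {s}) (conj_longest ?M ?a)}))
        (?M - {s} - {conj_longest (?M - {s}) (conj_longest ?M ?a)})"
    using rotation_path[OF M aM insertI1 as] by blast
  have "conj_longest (?M - {s}) (conj_longest ?M ?a) = t" unfolding MI using c M D by simp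
  then have G: "rpath J (E0 @ R) (?y \<otimes> longest (I - {t})) (I - {t})"
    using RP[OF zm E[unfolded E0]] MI M D by simp
  have "?a \<in> S - (?M - {?a})" using aM finitary_sub[OF M] by blast
  then have "braid [?M - {?a}, ?M, ?M - {s}] (R @ [I])"
    using braid.switchback[of ?a "?M - {?a}" s] Ma M as R MI by simp
  then have "E0 @ [?M - {?a}, ?M, I] @ [] \<leftrightharpoons> E0 @ (R @ [I]) @ []"
    unfolding MI by (rule braid_equiv_braid)
  then show ?thesis using F G E0 by (intro exI[of _ "E @ [?M]"] exI[of _ "E0 @ R"]) simp
qed

text \<open>Complete the two last steps to a common source and apply induction to both branches.\<close>
theorem matsumoto: "rpath J E x I \<Longrightarrow> rpath J E' x I \<Longrightarrow> E \<leftrightharpoons> E'"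
proof (induction "weight x I" arbitrary: x I E E' rule: less_induct)
  case less
  have st: "dmax J x I" using rpath_dmax[OF less(2)] .
  let ?y = "x \<otimes> longest I"
  have IHd: "A \<leftrightharpoons> B" if "rpath J A x (insert s I)" "rpath J B x (insert s I)" "s \<notin> I" for A B s
    using less(1)[OF weight_insert[OF rpath_dmax[OF that(1)] that(3)] that(1,2)] .
  have IHu: "A \<leftrightharpoons> B" if "rpath J A (?y \<otimes> longest (I - {t})) (I - {t})"
      "rpath J B (?y \<otimes> longest (I - {t})) (I - {t})" "t \<in> I" for A B t
    using less(1)[OF weight_remove[OF st that(3) rpath_dmax[OF that(1)]] that(1,2)] .
  have glue: "A @ [I] \<leftrightharpoons> B @ [I]" if "A \<leftrightharpoons> F" "F @ [I] \<leftrightharpoons> G @ [I]" "B \<leftrightharpoons> G" for A B F G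
    using braid_equiv_append[OF that(1), of "[I]"] that(2)
      braid_equiv_sym[OF braid_equiv_append[OF that(3), of "[I]"]] by (meson rtranclp_trans)
  have down_rdesc: "s \<in> rdesc x" if "rpath J A x (insert s I)" for A s
    using dmaxD(5)[OF rpath_dmax[OF that]] by blast
  have mixed: "A @ [I] \<leftrightharpoons> B @ [I]"
    if A: "rpath J A x (insert s I)" "s \<notin> I" and B: "rpath J B (?y \<otimes> longest (I - {t})) (I - {t})" "t \<in> I"
    for A B s t
  proof -
    obtain F G where "rpath J F x (insert s I)" "rpath J G (?y \<otimes> longest (I - {t})) (I - {t})" "F @ [I] \<leftrightharpoons> G @ [I]"
      using matsumoto_down_up[OF st down_rdesc[OF A(1)] A(2) B(2) rpath_dmax[OF B(1)]] by blast
    then show ?thesis using glue IHd[OF A(1)] IHu[OF B(1)] A B by blast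
  qed
  show ?case using rpath_last_step[OF less(2)]
  proof (elim disjE exE conjE)
    assume "E = [J]" "x = longest J" "I = J"
    then show ?thesis using rpath_base_unique less(3) by simp
  next
    fix s E1 assume E: "s \<notin> I" "E = E1 @ [I]" "rpath J E1 x (insert s I)"
    show ?thesis using rpath_last_step[OF less(3)]
    proof (elim disjE exE conjE)
      assume "E' = [J]" "x = longest J" "I = J"
      then show ?thesis using rpath_base_unique less(2) by simp
    next
      fix t E2 assume E': "t \<notin> I" "E' = E2 @ [I]" "rpath J E2 x (insert t I)"
      show ?thesis
      proof (cases "s = t")
        case True
        then show ?thesis using IHd[OF E(3) _ E(1)] E E' braid_equiv_append by blast
      next
        case False
        obtain F G where "rpath J F x (insert s I)" "rpath J G x (insert t I)" "F @ [I] \<leftrightharpoons> G @ [I]"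
          using matsumoto_down_down[OF st down_rdesc[OF E(3)] E(1) down_rdesc[OF E'(3)] E'(1) False] by blast
        then show ?thesis using glue IHd[OF E(3) _ E(1)] IHd[OF E'(3) _ E'(1)] E E' by blast
      qed
    next
      fix t E2 assume "t \<in> I" "E' = E2 @ [I]" "rpath J E2 (?y \<otimes> longest (I - {t})) (I - {t})"
      then show ?thesis using mixed E by blast
    qed
  next
    fix s E1 assume E: "s \<in> I" "E = E1 @ [I]" "rpath J E1 (?y \<otimes> longest (I - {s})) (I - {s})"
    show ?thesis using rpath_last_step[OF less(3)]
    proof (elim disjE exE conjE)
      assume "E' = [J]" "x = longest J" "I = J"
      then show ?thesis using rpath_base_unique less(2) by simp
    next
      fix t E2 assume "t \<notin> I" "E' = E2 @ [I]" "rpath J E2 x (insert t I)"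
      then show ?thesis using mixed E braid_equiv_sym by blast
    next
      fix t E2 assume E': "t \<in> I" "E' = E2 @ [I]" "rpath J E2 (?y \<otimes> longest (I - {t})) (I - {t})"
      show ?thesis
      proof (cases "s = t")
        case True
        then show ?thesis using IHu[OF E(3) _ E(1)] E E' braid_equiv_append by blast
      next
        case False
        obtain F G where "rpath J F (?y \<otimes> longest (I - {s})) (I - {s})"
            "rpath J G (?y \<otimes> longest (I - {t})) (I - {t})" "F @ [I] \<leftrightharpoons> G @ [I]"
          using matsumoto_up_up[OF st E(1) rpath_dmax[OF E(3)] E'(1) rpath_dmax[OF E'(3)] False] by blast
        then show ?thesis using glue IHu[OF E(3) _ E(1)] IHu[OF E'(3) _ E'(1)] E E' by blast
      qed
    qed
  qed
qed

section \<open>Reducing an expression\<close>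

text \<open>Induction on the length of \<open>y = x w\<^sub>I\<close> and then on the size of \<open>I\<close>. The last two conjuncts state
  that the new minimal representative \<open>z\<close> is the shortest element of \<open>y W\<^sub>M\<close>; they provide the strict
  decrease of length when the claim is applied a second time.\<close>
lemma reduce_up_step:
  "rpath J E x I \<Longrightarrow> s \<notin> I \<Longrightarrow> finitary (insert s I) \<Longrightarrow>
    \<exists>E' z. move\<^sup>*\<^sup>* (E @ [insert s I]) E' \<and> rpath J E' (z \<otimes> longest (insert s I)) (insert s I) \<and>
      rmin (insert s I) z \<and> (\<exists>v \<in> generate W (insert s I). x \<otimes> longest I = z \<otimes> v)"
proof (induction "(\<ell> (x \<otimes> longest I), card I)" arbitrary: E x I s
    rule: wf_induct_rule[OF wf_lex_prod[OF wf_less_than wf_less_than]])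
  case (1 x I E s)
  have IH: "\<exists>E' z. move\<^sup>*\<^sup>* (E1 @ [insert s1 I1]) E' \<and> rpath J E' (z \<otimes> longest (insert s1 I1)) (insert s1 I1) \<and>
      rmin (insert s1 I1) z \<and> (\<exists>v \<in> generate W (insert s1 I1). x1 \<otimes> longest I1 = z \<otimes> v)"
    if "\<ell> (x1 \<otimes> longest I1) < \<ell> (x \<otimes> longest I) \<or>
      \<ell> (x1 \<otimes> longest I1) = \<ell> (x \<otimes> longest I) \<and> card I1 < card I"
      "rpath J E1 x1 I1" "s1 \<notin> I1" "finitary (insert s1 I1)" for E1 x1 I1 s1
    using 1(1)[of x1 I1 E1 s1] that by auto
  note p = 1(2) and sI = 1(3) and M = 1(4)
  have st: "dmax J x I" using rpath_dmax[OF p] .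
  note D = dmaxD[OF st]
  let ?M = "insert s I" and ?y = "x \<otimes> longest I"
  have MS: "?M \<subseteq> S" using finitary_sub[OF M] .
  have ym: "rmin I ?y" using dmax_rmin[OF st] .
  have yc: "?y \<in> carrier W" using D by simp
  have MI: "?M - {s} = I" using sI by blast
  consider "rmin ?M ?y" | "s \<in> rdesc ?y" "s \<in> rdesc x" | "s \<in> rdesc ?y" "s \<notin> rdesc x"
    using ym yc unfolding rmin_def by blast
  then show ?case
  proof cases
    case 1
    have "\<exists>v \<in> generate W ?M. ?y = ?y \<otimes> v" using yc by (intro bexI[of _ \<one>]) auto
    then show ?thesis using rpath.up[OF p sI M 1] 1 by blast
  next
    case 2
    \<comment> \<open>The last step into \<open>(x,I)\<close> may be taken to come down from \<open>M\<close>, and the step back up cancels it.\<close>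
    have stM: "dmax J x ?M" using dmax_insert[OF st 2(2)] .
    then obtain F where F: "rpath J F x ?M" using ex_rpath by blast
    obtain F0 where F0: "F = F0 @ [?M]"
      using rpath_nonempty[OF F] rpath_last[OF F] by (metis append_butlast_last_id)
    have "rpath J (F @ [I]) x I" using rpath.down[OF F, of s] MI by simp
    then have "E @ [?M] \<leftrightharpoons> (F @ [I]) @ [?M]" using braid_equiv_append[OF matsumoto[OF p]] by blast
    then have "move\<^sup>*\<^sup>* (E @ [?M]) (F0 @ [?M, I, ?M] @ [])" using braid_equiv_moves F0 by fastforce
    moreover have "star_quadratic [?M, I, ?M] [?M]" using star_quadratic.intros[OF M, of s] MI by simp
    then have "move (F0 @ [?M, I, ?M] @ []) (F0 @ [?M] @ [])" using move.intros by blast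
    ultimately have "move\<^sup>*\<^sup>* (E @ [?M]) F" unfolding F0 by simp
    moreover have "rpath J F (x \<otimes> longest ?M \<otimes> longest ?M) ?M" using F M D by simp
    moreover have "rmin ?M (x \<otimes> longest ?M)" using dmax_rmin[OF stM] .
    moreover have "longest I \<in> generate W ?M" using par_mono[OF _ longest_in[OF D(2)]] by blast
    then have "longest ?M \<otimes> longest I \<in> generate W ?M" using longest_in[OF M] par_mult by blast
    moreover have "?y = x \<otimes> longest ?M \<otimes> (longest ?M \<otimes> longest I)" using M D by (simp add: m_assoc)
    ultimately show ?thesis by blast
  next
    case 3
    then obtain t where t: "t \<in> I" "dmax J (?y \<otimes> longest (I - {t})) (I - {t})"
      using no_up_step_rdesc(2)[OF st] by blast
    \<comment> \<open>The detour through \<open>I\<close> between \<open>I - {t}\<close> and \<open>M\<close> is replaced by the one through \<open>?N = M - {t}\<close>.\<close>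
    let ?A = "I - {t}"
    let ?N = "insert s ?A"
    have stt: "s \<noteq> t" using t sI by blast
    have Af: "finitary ?A" and N: "finitary ?N" by (rule finitary_mono[OF M], blast)+
    have NS: "?N \<subseteq> S" using finitary_sub[OF N] .
    have tN: "t \<notin> ?N" "insert t ?N = ?M" "insert t ?A = I" using t stt by auto
    obtain F where F: "rpath J F (?y \<otimes> longest ?A) ?A" using ex_rpath t by blast
    obtain F0 where F0: "F = F0 @ [?A]"
      using rpath_nonempty[OF F] rpath_last[OF F] by (metis append_butlast_last_id)
    have "rpath J (F @ [I]) x I" using rpath_up_remove[OF st t(1) F] .
    then have c1: "E @ [?M] \<leftrightharpoons> (F @ [I]) @ [?M]" using braid_equiv_append[OF matsumoto[OF p]] by blast
    have "?A \<union> {t, s} = ?M" using t by blast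
    then have "finitary (?A \<union> {t, s})" using M by simp
    moreover have "t \<in> S - ?A" "s \<in> S - ?A" "t \<noteq> s" using t MS stt sI by auto
    ultimately have "braid [?A, insert t ?A, insert s (insert t ?A)] [?A, insert s ?A, insert t (insert s ?A)]"
      by (intro braid.up_up)
    then have "F0 @ [?A, I, ?M] @ [] \<leftrightharpoons> F0 @ [?A, ?N, ?M] @ []"
      unfolding tN by (rule braid_equiv_braid)
    then have "(F @ [I]) @ [?M] \<leftrightharpoons> (F @ [?N]) @ [?M]" unfolding F0 by simp
    with c1 have "E @ [?M] \<leftrightharpoons> (F @ [?N]) @ [?M]" by (rule rtranclp_trans)
    then have m1: "move\<^sup>*\<^sup>* (E @ [?M]) ((F @ [?N]) @ [?M])" by (rule braid_equiv_moves)
    have ye: "?y \<otimes> longest ?A \<otimes> longest ?A = ?y" using Af yc by simp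
    have "card ?A < card I" using t finitary_finite[OF D(2)] by (intro psubset_card_mono) auto
    then obtain E1 z1 v1 where E1: "move\<^sup>*\<^sup>* (F @ [?N]) E1" "rpath J E1 (z1 \<otimes> longest ?N) ?N"
        "rmin ?N z1" "v1 \<in> generate W ?N" "?y = z1 \<otimes> v1"
      using IH[OF _ F _ N] sI unfolding ye by blast
    have z1c: "z1 \<in> carrier W" "v1 \<in> carrier W" using E1 par_closed[OF NS] by auto
    \<comment> \<open>As \<open>s\<close> is a right descent of \<open>y\<close> contained in \<open>?N\<close>, passing to the coset of \<open>?N\<close> shortens \<open>y\<close>.\<close>
    have "v1 \<noteq> \<one>"
    proof
      assume "v1 = \<one>"
      then have "?y = z1" using E1 z1c by simp
      then show False using E1(3) 3(1) unfolding rmin_def by blast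
    qed
    then have "\<ell> v1 \<noteq> 0" using len_eq_0 z1c by blast
    then have lz: "\<ell> z1 < \<ell> ?y" using rmin_add[OF NS E1(3,4)] E1(5) by simp
    have ze: "z1 \<otimes> longest ?N \<otimes> longest ?N = z1" using N z1c by simp
    obtain E2 z2 v2 where E2: "move\<^sup>*\<^sup>* (E1 @ [?M]) E2" "rpath J E2 (z2 \<otimes> longest ?M) ?M"
        "rmin ?M z2" "v2 \<in> generate W ?M" "z1 = z2 \<otimes> v2"
      using IH[OF _ E1(2) tN(1)] M lz unfolding ze tN(2) by blast
    have c2: "z2 \<in> carrier W" "v2 \<in> carrier W" using E2 par_closed[OF MS] by auto
    have "move\<^sup>*\<^sup>* ((F @ [?N]) @ [?M]) (E1 @ [?M])" using moves_append[OF E1(1)] .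
    then have "move\<^sup>*\<^sup>* (E @ [?M]) E2" using m1 E2(1) by (meson rtranclp_trans)
    moreover have "v1 \<in> generate W ?M" using par_mono[OF _ E1(4)] by blast
    then have "v2 \<otimes> v1 \<in> generate W ?M" using E2 par_mult by blast
    moreover have "?y = z2 \<otimes> (v2 \<otimes> v1)" using E1(5) E2(5) c2 z1c by (simp add: m_assoc)
    ultimately show ?thesis using E2 by blast
  qed
qed

theorem expression_reduces: "expression E \<Longrightarrow> \<exists>E' x. move\<^sup>*\<^sup>* E E' \<and> rpath (hd E) E' x (last E)"
proof (induction E rule: rev_induct)
  case Nil
  then show ?case unfolding expression_def by simp
next
  case (snoc I' E)
  show ?case
  proof (cases "E = []")
    case True
    then have "finitary I'" using snoc(2) unfolding expression_def by simp
    then have "rpath I' [I'] (longest I') I'" by (rule rpath.base)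
    then show ?thesis using True by auto
  next
    case False
    then have r: "expression E" "finitary I'" "adjacent (last E) I'" using snoc(2) expression_snoc by blast+
    then obtain E1 x where E1: "move\<^sup>*\<^sup>* E E1" "rpath (hd E) E1 x (last E)" using snoc(1) by blast
    have h: "hd (E @ [I']) = hd E" "last (E @ [I']) = I'" using False by auto
    have m: "move\<^sup>*\<^sup>* (E @ [I']) (E1 @ [I'])" using moves_append[OF E1(1)] .
    from r(3) consider s where "s \<notin> last E" "I' = insert s (last E)" | s where "s \<in> last E" "I' = last E - {s}"
      unfolding adjacent_def by blast
    then show ?thesis
    proof cases
      case 1
      then obtain E2 z where "move\<^sup>*\<^sup>* (E1 @ [I']) E2" "rpath (hd E) E2 (z \<otimes> longest I') I'"
        using reduce_up_step[OF E1(2) 1(1)] r(2) by blast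
      then show ?thesis unfolding h using m by (meson rtranclp_trans)
    next
      case 2
      then have "rpath (hd E) (E1 @ [I']) x I'" using rpath.down[OF E1(2)] by blast
      then show ?thesis unfolding h using m by blast
    qed
  qed
qed

end

theorem theorem5p31:
  fixes W :: "('a, 'm) monoid_scheme" and S :: "'a set" and Is :: "'a set list"
  assumes "coxeter_system W S"
    and "coxeter_system.expression W S Is"
    and "\<not> coxeter_system.reduced W S Is"
  shows "\<exists>Is'. coxeter_system.reduced W S Is' \<and> (coxeter_system.move W S)\<^sup>*\<^sup>* Is Is'"
proof -
  interpret coxeter_system W S by fact
  obtain Is' x where "move\<^sup>*\<^sup>* Is Is'" "rpath (hd Is) Is' x (last Is)"
    using expression_reduces[OF assms(2)] by blast
  then show ?thesis using rpath_reduced by blast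
qed

end
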